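(* Let $\Omega\subset\mathbb{R}^d$ be an open bounded domain such that $$\inf_{0\ne u\in H^1_0(\Omega)}\frac{\int_\Omega|\nabla u|^2\,dx}{\int_\Omega |u|^2/\delta^2\,dx}>0,$$ and suppose moreover that $\Omega$ is convex. Then for every $N\in\mathbb{N}$, $$\sum_{j=1}^N\lambda_j(\Omega)\ \ge\ C_d\,|\Omega|^{-\frac2d}\,N^{1+\frac2d}+\frac{N}{64\,R_i^2(\Omega)} .$$
   Context: $\{\lambda_j(\Omega)\}_{j\in\mathbb{N}}$, $\mathbb{N}=\{1,2,\dots\}$, is the increasing sequence of eigenvalues, repeated according to multiplicity, of the Dirichlet Laplacian $-\Delta_\Omega$ on $L^2(\Omega)$ (the self-adjoint operator associated with the closed quadratic form $\int_\Omega|\nabla u|^2dx$ with form domain $H^1_0(\Omega)$; its spectrum is discrete since $\Omega$ is bounded). $|\Omega|$ denotes the volume of $\Omega$. For $x\in\Omega$, $\delta(x)=\mathrm{dist}(x,\partial\Omega)=\min_{y\in\partial\Omega}|x-y|$, and $R_i(\Omega)=\sup_{x\in\Omega}\delta(x)$ is the in-radius of $\Omega$. The constant $C_d$ is $$C_d=\frac{4\pi d}{d+2}\,\Gamma(d/2+1)^{2/d}.$$ *)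

theory Defs
  imports "HOL-Analysis.Analysis"
begin

text \<open>Elements of function spaces over \<open>\<Omega>\<close> are represented by functions on the whole space;
  only their restrictions to \<open>\<Omega>\<close> matter, and they are identified up to equality almost
  everywhere with respect to Lebesgue measure on \<open>\<Omega>\<close>.\<close>

primrec C_k :: "nat \<Rightarrow> ('a::euclidean_space \<Rightarrow> real) \<Rightarrow> bool" where
  "C_k 0 f \<longleftrightarrow> continuous_on UNIV f"
| "C_k (Suc k) f \<longleftrightarrow> (\<forall>x. f differentiable at x) \<and>
     (\<forall>b\<in>Basis. C_k k (\<lambda>x. frechet_derivative f (at x) b))"

definition test_functions :: "'a::euclidean_space set \<Rightarrow> ('a \<Rightarrow> real) set" where
  "test_functions \<Omega> =
     {\<phi>. (\<forall>k. C_k k \<phi>) \<and> compact (closure {x. \<phi> x \<noteq> 0}) \<and> closure {x. \<phi> x \<noteq> 0} \<subseteq> \<Omega>}"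

definition L2 :: "'a::euclidean_space set \<Rightarrow> ('a \<Rightarrow> 'b::euclidean_space) set" where
  "L2 \<Omega> = {f \<in> borel_measurable (lebesgue_on \<Omega>). integrable (lebesgue_on \<Omega>) (\<lambda>x. (norm (f x))\<^sup>2)}"

definition has_weak_gradient ::
    "'a::euclidean_space set \<Rightarrow> ('a \<Rightarrow> real) \<Rightarrow> ('a \<Rightarrow> 'a) \<Rightarrow> bool" where
  "has_weak_gradient \<Omega> u g \<longleftrightarrow>
     (\<forall>\<phi>\<in>test_functions \<Omega>. \<forall>b\<in>Basis.
        (LINT x|lebesgue_on \<Omega>. u x * frechet_derivative \<phi> (at x) b)
          = - (LINT x|lebesgue_on \<Omega>. (g x \<bullet> b) * \<phi> x))"

definition H1 :: "'a::euclidean_space set \<Rightarrow> ('a \<Rightarrow> real) set" where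
  "H1 \<Omega> = {u \<in> L2 \<Omega>. \<exists>g\<in>L2 \<Omega>. has_weak_gradient \<Omega> u g}"

text \<open>For \<open>u \<in> H1 \<Omega>\<close> with \<open>\<Omega>\<close> open the weak gradient is unique up to equality almost
  everywhere, so the choice of representative does not affect any of the integrals below.\<close>

definition weak_gradient :: "'a::euclidean_space set \<Rightarrow> ('a \<Rightarrow> real) \<Rightarrow> 'a \<Rightarrow> 'a" where
  "weak_gradient \<Omega> u = (SOME g. g \<in> L2 \<Omega> \<and> has_weak_gradient \<Omega> u g)"

definition H1_norm :: "'a::euclidean_space set \<Rightarrow> ('a \<Rightarrow> real) \<Rightarrow> real" where
  "H1_norm \<Omega> u = sqrt ((LINT x|lebesgue_on \<Omega>. (u x)\<^sup>2)
                      + (LINT x|lebesgue_on \<Omega>. (norm (weak_gradient \<Omega> u x))\<^sup>2))"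

definition H10 :: "'a::euclidean_space set \<Rightarrow> ('a \<Rightarrow> real) set" where
  "H10 \<Omega> = {u \<in> H1 \<Omega>. \<forall>\<epsilon>>0. \<exists>\<phi>\<in>test_functions \<Omega>. H1_norm \<Omega> (\<lambda>x. u x - \<phi> x) < \<epsilon>}"

definition dirichlet_form ::
    "'a::euclidean_space set \<Rightarrow> ('a \<Rightarrow> real) \<Rightarrow> ('a \<Rightarrow> real) \<Rightarrow> real" where
  "dirichlet_form \<Omega> u v = (LINT x|lebesgue_on \<Omega>. weak_gradient \<Omega> u x \<bullet> weak_gradient \<Omega> v x)"

text \<open>The graph of the self-adjoint operator associated with the closed form
  \<^const>\<open>dirichlet_form\<close> with form domain \<^const>\<open>H10\<close> (first representation theorem).\<close>

definition dirichlet_laplacian ::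
    "'a::euclidean_space set \<Rightarrow> (('a \<Rightarrow> real) \<times> ('a \<Rightarrow> real)) set" where
  "dirichlet_laplacian \<Omega> =
     {(u, f). u \<in> H10 \<Omega> \<and> f \<in> L2 \<Omega> \<and>
        (\<forall>v\<in>H10 \<Omega>. dirichlet_form \<Omega> u v = (LINT x|lebesgue_on \<Omega>. f x * v x))}"

definition eigenspace :: "'a::euclidean_space set \<Rightarrow> real \<Rightarrow> ('a \<Rightarrow> real) set" where
  "eigenspace \<Omega> \<mu> = {u. (u, \<lambda>x. \<mu> * u x) \<in> dirichlet_laplacian \<Omega>}"

text \<open>\<open>has_dim_ae \<Omega> E n\<close>: the quotient of the linear space \<open>E\<close> by equality almost everywhere on
  \<open>\<Omega>\<close> has a basis of \<open>n\<close> elements.\<close>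

definition has_dim_ae :: "'a::euclidean_space set \<Rightarrow> ('a \<Rightarrow> real) set \<Rightarrow> nat \<Rightarrow> bool" where
  "has_dim_ae \<Omega> E n \<longleftrightarrow>
     (\<exists>e :: nat \<Rightarrow> 'a \<Rightarrow> real.
        (\<forall>i<n. e i \<in> E) \<and>
        (\<forall>c :: nat \<Rightarrow> real.
           (AE x in lebesgue_on \<Omega>. (\<Sum>i<n. c i * e i x) = 0) \<longrightarrow> (\<forall>i<n. c i = 0)) \<and>
        (\<forall>u\<in>E. \<exists>c :: nat \<Rightarrow> real. AE x in lebesgue_on \<Omega>. u x = (\<Sum>i<n. c i * e i x)))"

text \<open>\<open>ev 1 \<le> ev 2 \<le> \<dots>\<close> is the sequence of all eigenvalues of the Dirichlet Laplacian, repeated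
  according to multiplicity: each real \<open>\<mu>\<close> occurs exactly as often as the dimension of its
  eigenspace (not at all if \<open>\<mu>\<close> is not an eigenvalue). For bounded \<open>\<Omega>\<close> the spectrum is discrete,
  and this determines \<open>ev\<close> uniquely on positive indices; \<open>ev 0\<close> is irrelevant.\<close>

definition dirichlet_eigenvalues :: "'a::euclidean_space set \<Rightarrow> (nat \<Rightarrow> real) \<Rightarrow> bool" where
  "dirichlet_eigenvalues \<Omega> ev \<longleftrightarrow>
     mono_on {1..} ev \<and>
     (\<forall>\<mu>. finite {j\<in>{1..}. ev j = \<mu>} \<and>
          has_dim_ae \<Omega> (eigenspace \<Omega> \<mu>) (card {j\<in>{1..}. ev j = \<mu>}))"

definition bdist :: "'a::euclidean_space set \<Rightarrow> 'a \<Rightarrow> real" where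
  "bdist \<Omega> x = infdist x (frontier \<Omega>)"

definition inradius :: "'a::euclidean_space set \<Rightarrow> real" where
  "inradius \<Omega> = (SUP x\<in>\<Omega>. bdist \<Omega> x)"

text \<open>The integrals are taken in \<open>[0, \<infinity>]\<close>, so the quotient is \<open>0\<close> when
  \<open>u\<^sup>2 / \<delta>\<^sup>2\<close> is not integrable.\<close>

definition hardy_constant :: "'a::euclidean_space set \<Rightarrow> ennreal" where
  "hardy_constant \<Omega> =
     (INF u\<in>{u \<in> H10 \<Omega>. \<not> (AE x in lebesgue_on \<Omega>. u x = 0)}.
        (\<integral>\<^sup>+x. ennreal ((norm (weak_gradient \<Omega> u x))\<^sup>2) \<partial>lebesgue_on \<Omega>)
        / (\<integral>\<^sup>+x. ennreal ((u x)\<^sup>2 / (bdist \<Omega> x)\<^sup>2) \<partial>lebesgue_on \<Omega>))"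

definition C_const :: "nat \<Rightarrow> real" where
  "C_const d = 4 * pi * real d / (real d + 2) * Gamma (real d / 2 + 1) powr (2 / real d)"

end

theory Submission
  imports Defs "HOL-Probability.Probability"
begin

text \<open>Write \<open>d\<close> for the dimension, \<open>S\<close> for the sum of the first \<open>N\<close> eigenvalues and \<open>\<phi>\<^sub>j\<close> for orthonormal
eigenfunctions. For a frequency \<open>\<xi>\<close> let \<open>w\<close> be the orthogonal projection of the plane wave
\<open>e(x) = exp(i \<xi>\<cdot>x)\<close> on the span of the \<open>\<phi>\<^sub>j\<close>, and \<open>F \<xi>\<close> its squared norm. Bessel gives \<open>0 \<le> F \<le> |\<Omega>|\<close>;
Plancherel gives \<open>\<integral>F = (2\<pi>)\<^sup>d N\<close> and \<open>\<integral>|\<xi>|\<^sup>2 F = (2\<pi>)\<^sup>d S\<close>. Among such \<open>F\<close> the second integral is smallest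
when \<open>F = |\<Omega>|\<close> on a ball \<open>|\<xi>|\<^sup>2 < K\<close> and \<open>F = 0\<close> outside (the bathtub principle). This is the argument of
Li and Yau, and it yields \<open>S \<ge> L\<close>, where \<open>L = d / (d + 2) * K * N\<close> is the first term of the claim.

The second term comes from the impossibility of \<open>F = |\<Omega>|\<close>: plane waves do not vanish on the boundary of
\<open>\<Omega>\<close>, so the defect \<open>|\<Omega>| - F \<xi> = \<integral>|e - w|\<^sup>2\<close> is bounded below. Convexity makes this quantitative with the
in-radius. If \<open>R\<close> exceeds the in-radius, no ball of radius \<open>R\<close> fits into \<open>\<Omega>\<close>, and by separation there are half-spaces
\<open>\<nu>\<^sub>p \<cdot> x \<le> t\<^sub>p\<close> containing \<open>\<Omega>\<close> and weights \<open>c\<^sub>p \<ge> 0\<close> with \<open>\<Sum>c\<^sub>p = 1\<close>, \<open>\<Sum>c\<^sub>p \<nu>\<^sub>p = 0\<close> and \<open>\<Sum>c\<^sub>p t\<^sub>p = R\<close>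
(\<open>balanced_supporting_halfspaces\<close>). The weighted distances \<open>\<Sum>c\<^sub>p (t\<^sub>p - \<nu>\<^sub>p \<cdot> x)\<close> to the bounding
hyperplanes then have the constant value \<open>R\<close>, so a function \<open>H\<close> that sums cut-offs of these distances stays
between \<open>1/2\<close> and \<open>1\<close> on \<open>\<Omega>\<close>. As \<open>H\<close> is a sum of derivatives of functions of size at most \<open>R/2\<close> on \<open>\<Omega>\<close>, integrating
\<open>1 - |e - w|\<^sup>2\<close> against \<open>H\<close> by parts shows, for every \<open>a > 0\<close>, that \<open>|\<Omega>|/2\<close> is at most
\<open>(1 + a) (|\<Omega>| - F \<xi>)\<close> plus \<open>R\<^sup>2/(4a)\<close> times the weighted average of \<open>2 \<integral>|\<partial>\<^sub>p w|\<^sup>2 + 2 (\<nu>\<^sub>p \<cdot> \<xi>)\<^sup>2 F \<xi>\<close>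
(\<open>defect_lower_bound\<close>).

Integrated over \<open>\<xi>\<close> with the weight \<open>min (K - |\<xi>|\<^sup>2) (2\<sigma>)\<close> (positive part), \<open>\<sigma> = 2K/(d + 2)\<close>, this becomes
\<open>3/8 \<sigma> N \<le> (1 + a) (S - L) + 2 R\<^sup>2 \<sigma> E / a\<close>, where \<open>E = \<Sum>c\<^sub>p \<Sum>\<^sub>j \<integral>|\<partial>\<^sub>p \<phi>\<^sub>j|\<^sup>2\<close> is the mean directional energy
(\<open>total_energy_defect_bound\<close>). Two further bounds on \<open>E\<close> close the argument. The barriers applied
to \<open>\<phi>\<^sub>j\<^sup>2\<close> give a Hardy-type inequality \<open>E \<ge> N/(4R\<^sup>2)\<close> (\<open>mean_energy_ge\<close>). The bathtub
principle with an ellipsoid in place of a ball bounds the energy in any single direction,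
\<open>E \<le> 2 (S - L) + 25/36 \<sigma> N\<close> (\<open>energy_le\<close>): one direction cannot carry much more than its share unless
\<open>S\<close> is far above \<open>L\<close>. If \<open>S - L\<close> were below \<open>N/(64R\<^sup>2)\<close>, the lower bound on \<open>E\<close> would force \<open>R\<^sup>2 \<sigma>\<close> to be
large and the inequality with \<open>a = 19/2 R\<^sup>2 \<sigma>\<close> would force it to be small (\<open>spectral_arithmetic\<close>).
Letting \<open>R\<close> decrease to the in-radius finishes the estimate.

All of this is done for smooth compactly supported \<open>\<phi>\<^sub>j\<close> (\<open>test_function_energy_lower_bound\<close>), where
no regularity questions arise. Eigenfunctions are limits of test functions in the Sobolev norm by the definition
of the form domain; Gram-Schmidt makes the approximants orthonormal
(\<open>orthonormal_approximation\<close>), and their energies converge to the eigenvalues.\<close>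

section \<open>Supporting half-spaces and the in-radius\<close>

lemma unit_direction_exists: "\<exists>\<nu>::'a::euclidean_space. norm \<nu> = 1"
  using vector_choose_size[of 1] by auto

lemma inradius_ge_of_cball_subset:
  fixes \<Omega> :: "'a::euclidean_space set"
  assumes "open \<Omega>" "bounded \<Omega>" "\<Omega> \<noteq> {}" "cball x r \<subseteq> \<Omega>" "0 \<le> r"
  shows "r \<le> inradius \<Omega>"
proof -
  have fr: "frontier \<Omega> \<noteq> {}"
    using assms frontier_eq_empty[of \<Omega>] not_bounded_UNIV by auto
  have xO: "x \<in> \<Omega>" using assms(4,5) by (meson centre_in_cball subsetD)
  have "r \<le> (INF y\<in>frontier \<Omega>. dist x y)"
  proof (rule cINF_greatest[OF fr])
    fix y assume "y \<in> frontier \<Omega>"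
    then have "y \<notin> \<Omega>" using assms(1) by (simp add: frontier_def interior_open)
    then have "y \<notin> cball x r" using assms(4) by blast
    then show "r \<le> dist x y" by simp
  qed
  also have "\<dots> = bdist \<Omega> x" unfolding bdist_def infdist_def using fr by simp
  also have "bdist \<Omega> x \<le> inradius \<Omega>"
    unfolding inradius_def
  proof (rule cSUP_upper[OF xO])
    obtain y where y: "y \<in> frontier \<Omega>" using fr by auto
    obtain B where B: "\<And>z. z \<in> closure \<Omega> \<Longrightarrow> norm z \<le> B"
      using bounded_closure[OF assms(2)] unfolding bounded_iff by auto
    show "bdd_above (bdist \<Omega> ` \<Omega>)"
    proof (rule bdd_aboveI2)
      fix z assume z: "z \<in> \<Omega>"
      have "bdist \<Omega> z \<le> dist z y" unfolding bdist_def using y by (rule infdist_le)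
      also have "\<dots> \<le> norm z + norm y" by (simp add: dist_norm norm_triangle_ineq4)
      also have "\<dots> \<le> B + B" using B z y closure_subset[of \<Omega>]
        by (intro add_mono) (auto simp: frontier_def)
      finally show "bdist \<Omega> z \<le> B + B" .
    qed
  qed
  finally show ?thesis .
qed

lemma inradius_pos:
  fixes \<Omega> :: "'a::euclidean_space set"
  assumes "open \<Omega>" "bounded \<Omega>" "\<Omega> \<noteq> {}"
  shows "0 < inradius \<Omega>"
proof -
  obtain x e where "e > 0" "cball x e \<subseteq> \<Omega>"
    using assms open_contains_cball by (metis all_not_in_conv)
  then show ?thesis using inradius_ge_of_cball_subset[OF assms, of x e] by auto
qed

text \<open>The pairs \<open>(\<nu>, t)\<close> describe the half-spaces \<open>\<nu> \<bullet> x \<le> t\<close> that contain \<open>\<Omega>\<close>, and the claim is that \<open>(0, R)\<close> lies in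
their convex hull. A hyperplane separating \<open>(0, R)\<close> from the hull would, after normalization, be given by a point \<open>y\<close>
with \<open>\<nu> \<bullet> y + R \<le> t\<close> for all these half-spaces; then the ball of radius \<open>R\<close> about \<open>y\<close> would lie in the closure of
\<open>\<Omega>\<close>, contradicting that \<open>R\<close> exceeds the in-radius.\<close>

lemma balanced_supporting_halfspaces:
  fixes \<Omega> :: "'a::euclidean_space set"
  assumes O: "open \<Omega>" "bounded \<Omega>" "convex \<Omega>" "\<Omega> \<noteq> {}" and R: "inradius \<Omega> < R"
  obtains I :: "('a \<times> real) set" and c where
    "finite I" "\<And>p. p \<in> I \<Longrightarrow> 0 \<le> c p" "\<And>p. p \<in> I \<Longrightarrow> norm (fst p) = 1"
    "\<And>p x. p \<in> I \<Longrightarrow> x \<in> \<Omega> \<Longrightarrow> fst p \<bullet> x \<le> snd p"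
    "sum c I = 1" "(\<Sum>p\<in>I. c p *\<^sub>R fst p) = 0" "(\<Sum>p\<in>I. c p * snd p) = R"
proof -
  define H where "H = {p :: 'a \<times> real. norm (fst p) = 1 \<and> (\<forall>x\<in>\<Omega>. fst p \<bullet> x \<le> snd p)}"
  obtain B where B: "\<And>z. z \<in> \<Omega> \<Longrightarrow> norm z \<le> B"
    using O(2) unfolding bounded_iff by auto
  have big: "(\<nu>, t) \<in> H" if "norm \<nu> = 1" "B \<le> t" for \<nu> :: 'a and t
    unfolding H_def using that B
    by (auto intro!: order_trans[OF norm_cauchy_schwarz] order_trans[OF B])
  have R0: "0 < R" using inradius_pos[OF O(1,2,4)] R by simp
  have "(0, R) \<in> convex hull H"
  proof (rule ccontr)
    assume n: "(0, R) \<notin> convex hull H"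
    have cv: "convex ((\<lambda>p. p - (0,R)) ` (convex hull H))"
      using convex_translation_subtract[of "convex hull H" "(0,R)"] by simp
    have "0 \<notin> (\<lambda>p. p - (0,R)) ` (convex hull H)" using n by (metis (no_types, lifting) image_iff eq_iff_diff_eq_0)
    from separating_hyperplane_set_0[OF cv this]
    obtain a where a: "a \<noteq> 0" "\<And>x. x \<in> (\<lambda>p. p - (0,R)) ` (convex hull H) \<Longrightarrow> 0 \<le> a \<bullet> x"
      by (elim exE conjE) (erule that, erule bspec)
    obtain n b where ab: "a = (n, b)" by (cases a)
    have sep: "0 \<le> n \<bullet> \<nu> + b * (t - R)" if "(\<nu>, t) \<in> H" for \<nu> t
    proof -
      have "(\<nu>, t) - (0, R) \<in> (\<lambda>p. p - (0,R)) ` (convex hull H)"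
        using that hull_subset[of H convex] by blast
      then have "0 \<le> a \<bullet> ((\<nu>, t) - (0, R))" by (rule a(2))
      then show ?thesis by (simp add: ab)
    qed
    \<comment> \<open>half-spaces can be enlarged, so the last coordinate of the normal is nonnegative\<close>
    have b0: "b \<ge> 0"
    proof (rule ccontr)
      assume b: "\<not> b \<ge> 0"
      obtain \<nu> :: 'a where nu: "norm \<nu> = 1" using unit_direction_exists by auto
      define t where "t = max B (R + (norm n + 1) / (- b))"
      have "0 \<le> n \<bullet> \<nu> + b * (t - R)" using nu by (intro sep big) (auto simp: t_def)
      moreover have "n \<bullet> \<nu> \<le> norm n" using norm_cauchy_schwarz[of n \<nu>] nu by simp
      moreover have "b * (t - R) \<le> b * ((norm n + 1) / (- b))"
        using b by (intro mult_left_mono_neg) (auto simp: t_def)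
      moreover have "b * ((norm n + 1) / (- b)) = - (norm n + 1)" using b by (simp add: field_simps)
      ultimately show False by linarith
    qed
    \<comment> \<open>every direction bounds some half-space containing the bounded set, so the separating hyperplane is not vertical\<close>
    have bp: "b > 0"
    proof (rule ccontr)
      assume "\<not> b > 0"
      then have b: "b = 0" using b0 by (rule order_antisym[OF leI])
      have nz: "n \<noteq> 0"
      proof
        assume "n = 0"
        then have "a = 0" using b ab zero_prod_def by metis
        then show False using a(1) by blast
      qed
      have "norm (- n /\<^sub>R norm n) = 1" using nz by simp
      then have "(- n /\<^sub>R norm n, B) \<in> H" using big by blast
      then have "0 \<le> n \<bullet> (- n /\<^sub>R norm n)" using sep[of "- n /\<^sub>R norm n" B] b by simp
      moreover have "n \<bullet> (- n /\<^sub>R norm n) = - norm n"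
        using nz by (simp add: dot_square_norm power2_eq_square)
      ultimately show False using nz by (metis neg_0_le_iff_le norm_le_zero_iff)
    qed
    define y where "y = - n /\<^sub>R b"
    have low: "\<nu> \<bullet> y + R \<le> t" if "(\<nu>, t) \<in> H" for \<nu> t
    proof -
      have "b * (\<nu> \<bullet> y + R) \<le> b * t" using sep[OF that] bp
        unfolding y_def by (simp add: inner_commute[of \<nu> n] algebra_simps mult.assoc[symmetric])
      then show ?thesis using bp by simp
    qed
    have "cball y R \<subseteq> closure \<Omega>"
    proof (rule ccontr)
      assume "\<not> cball y R \<subseteq> closure \<Omega>"
      then obtain z where z: "z \<in> cball y R" "z \<notin> closure \<Omega>" by blast
      obtain a' b' where s: "a' \<bullet> z < b'" "\<forall>x\<in>closure \<Omega>. a' \<bullet> x > b'"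
        using separating_hyperplane_closed_point[OF convex_closure[OF O(3)] closed_closure z(2)] by blast
      have a0: "a' \<noteq> 0"
      proof
        assume "a' = 0"
        then show False using s O(4) closure_subset by (metis all_not_in_conv inner_zero_left less_asym subsetD)
      qed
      have "(- a' /\<^sub>R norm a', - b' / norm a') \<in> H"
        unfolding H_def using a0 s closure_subset[of \<Omega>]
        by (auto simp: divide_simps less_imp_le subset_iff)
      then have "(- a' /\<^sub>R norm a') \<bullet> y + R \<le> - b' / norm a'" by (rule low)
      then have "norm a' * ((- a' /\<^sub>R norm a') \<bullet> y + R) \<le> norm a' * (- b' / norm a')"
        by (rule mult_left_mono) simp
      then have 1: "- (a' \<bullet> y) + R * norm a' \<le> - b'"
        using a0 by (simp add: distrib_left right_diff_distrib mult.assoc[symmetric] mult.commute)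
      have "a' \<bullet> (y - z) \<le> norm a' * norm (y - z)" by (rule norm_cauchy_schwarz)
      also have "\<dots> \<le> norm a' * R" using z(1) by (intro mult_left_mono) (auto simp: dist_norm)
      finally show False using 1 s(1) by (simp add: inner_diff_right mult.commute)
    qed
    then have "ball y R \<subseteq> \<Omega>"
      using O convex_interior_closure[OF O(3)] interior_open[OF O(1)]
      by (metis interior_cball interior_mono)
    then have "cball y ((R + inradius \<Omega>) / 2) \<subseteq> \<Omega>"
      using R by (auto simp: subset_iff)
    then have "(R + inradius \<Omega>) / 2 \<le> inradius \<Omega>"
      using R0 inradius_pos[OF O(1,2,4)] by (intro inradius_ge_of_cball_subset[OF O(1,2,4)]) auto
    then show False using R by simp
  qed
  then obtain I u where I: "finite I" "I \<subseteq> H" "\<forall>x\<in>I. 0 \<le> u x" "sum u I = 1" "(\<Sum>v\<in>I. u v *\<^sub>R v) = (0, R)"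
    unfolding convex_hull_explicit by auto
  have "fst (\<Sum>v\<in>I. u v *\<^sub>R v) = (\<Sum>v\<in>I. u v *\<^sub>R fst v)" by (simp add: fst_sum)
  moreover have "snd (\<Sum>v\<in>I. u v *\<^sub>R v) = (\<Sum>v\<in>I. u v * snd v)" by (simp add: snd_sum)
  ultimately show thesis using that[of I u] I by (auto simp: H_def subset_iff)
qed

section \<open>Volumes of balls and ellipsoids\<close>

text \<open>Up to a null set, Vitali's covering theorem writes \<open>S\<close> as a disjoint union of balls. The preimage of a ball under the
isometry is a ball of the same radius, and balls of equal radius have equal volume. The null set need not be followed
through \<open>f\<close>, which is why only an inequality is proved; applying it to both \<open>f\<close> and its inverse gives equality.\<close>

lemma emeasure_linear_isometry_ge:
  fixes f g :: "'a::euclidean_space \<Rightarrow> 'a"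
  assumes f: "linear f" "\<And>x. norm (f x) = norm x" and fg: "\<And>x. f (g x) = x" "\<And>x. g (f x) = x"
    and S: "open S"
  shows "emeasure lborel S \<le> emeasure lborel (f -` S)"
proof -
  have cf: "continuous_on UNIV f" using f(1) linear_continuous_on linear_conv_bounded_linear by blast
  have distf: "dist (f x) (f y) = dist x y" for x y
    using f by (metis dist_norm linear_diff)
  have vball: "f -` ball x r = ball (g x) r" for x r
    using distf[of "g x"] fg by auto
  define K where "K = {(x, r). r > 0 \<and> ball x r \<subseteq> S}"
  have "\<And>x d. \<lbrakk>x \<in> S; 0 < d\<rbrakk> \<Longrightarrow> \<exists>i. i \<in> K \<and> x \<in> ball (fst i) (snd i) \<and> snd i < d"
  proof -
    fix x :: 'a and d :: real assume x: "x \<in> S" "0 < d"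
    obtain e where e: "e > 0" "ball x e \<subseteq> S" using S x open_contains_ball by blast
    show "\<exists>i. i \<in> K \<and> x \<in> ball (fst i) (snd i) \<and> snd i < d"
    proof (intro exI conjI)
      have "ball x (min e (d/2)) \<subseteq> ball x e" by (rule subset_ball) simp
      then show "(x, min e (d/2)) \<in> K" using e x unfolding K_def by auto
    qed (use x e in auto)
  qed
  then obtain C where C: "countable C" "C \<subseteq> K"
     "pairwise (\<lambda>i j. disjnt (ball (fst i) (snd i)) (ball (fst j) (snd j))) C"
     "negligible (S - (\<Union>i\<in>C. ball (fst i) (snd i)))"
    by (rule Vitali_covering_theorem_balls)
  let ?U = "\<Union>i\<in>C. ball (fst i) (snd i)"
  have dj: "disjoint_family_on (\<lambda>i. ball (fst i) (snd i)) C"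
    using C(3) unfolding disjoint_family_on_def pairwise_def disjnt_def by blast
  have dj': "disjoint_family_on (\<lambda>i. f -` ball (fst i) (snd i)) C"
    using dj unfolding disjoint_family_on_def by blast
  have US: "?U \<subseteq> S" using C(2) by (auto simp: K_def subset_iff; fastforce)
  have nul: "S - ?U \<in> null_sets lborel"
  proof -
    have "S - ?U \<in> null_sets lebesgue" using C(4) negligible_iff_null_sets by blast
    moreover have "S - ?U \<in> sets borel" using S by (intro sets.Diff borel_open open_UN) auto
    ultimately show ?thesis by (simp add: null_sets_completion_iff)
  qed
  have "emeasure lborel S = emeasure lborel ?U"
  proof -
    have "S = ?U \<union> (S - ?U)" using US by auto
    moreover have "?U \<in> sets lborel" by (auto intro!: borel_open)
    ultimately show ?thesis using emeasure_Un_null_set[OF _ nul, of ?U] by presburger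
  qed
  also have "\<dots> = (\<integral>\<^sup>+i. emeasure lborel (ball (fst i) (snd i)) \<partial>count_space C)"
    using C dj by (intro emeasure_UN_countable) auto
  also have "\<dots> = (\<integral>\<^sup>+i. emeasure lborel (f -` ball (fst i) (snd i)) \<partial>count_space C)"
  proof (intro nn_integral_cong)
    fix i assume "i \<in> space (count_space C)"
    then have "0 < snd i" using C(2) by (auto simp: K_def)
    then show "emeasure lborel (ball (fst i) (snd i)) = emeasure lborel (f -` ball (fst i) (snd i))"
      by (simp add: vball emeasure_ball)
  qed
  also have "\<dots> = emeasure lborel (\<Union>i\<in>C. f -` ball (fst i) (snd i))"
    using C dj' by (intro emeasure_UN_countable[symmetric]) (auto simp: vball)
  also have "\<dots> \<le> emeasure lborel (f -` S)"
    using US open_vimage[OF S cf] by (intro emeasure_mono) auto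
  finally show ?thesis .
qed

lemma lborel_distr_linear_isometry:
  fixes f g :: "'a::euclidean_space \<Rightarrow> 'a"
  assumes f: "linear f" "\<And>x. norm (f x) = norm x" and fg: "\<And>x. f (g x) = x" "\<And>x. g (f x) = x"
  shows "distr lborel borel f = lborel"
proof -
  have g: "linear g" using f fg by (metis (no_types, lifting) linear_iff)
  have ng: "norm (g x) = norm x" for x using f fg by metis
  have cf: "continuous_on UNIV f" using f(1) linear_continuous_on linear_conv_bounded_linear by blast
  have [measurable]: "f \<in> borel_measurable borel" using cf by (rule borel_measurable_continuous_onI)
  have eq: "emeasure (distr lborel borel f) S = emeasure lborel S" if "open S" for S
  proof -
    have "emeasure lborel (f -` S) \<le> emeasure lborel (g -` (f -` S))"
      using g ng fg by (intro emeasure_linear_isometry_ge[of g f]) (auto intro: open_vimage[OF that cf])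
    moreover have "g -` (f -` S) = S" using fg by auto
    ultimately show ?thesis using emeasure_linear_isometry_ge[OF f fg that] that
      by (simp add: emeasure_distr)
  qed
  show ?thesis
    by (rule lborel_eqI[symmetric]) (simp_all add: eq open_box emeasure_lborel_box)
qed

definition reflection :: "'a::real_inner \<Rightarrow> 'a \<Rightarrow> 'a" where
  "reflection u x = x - (2 * (u \<bullet> x) / (u \<bullet> u)) *\<^sub>R u"

lemma linear_reflection: "linear (reflection u)"
  unfolding reflection_def
  by (rule linearI) (auto simp: inner_add_right algebra_simps add_divide_distrib scaleR_add_left)

lemma reflection_inner: "reflection u x \<bullet> reflection u y = x \<bullet> y"
  by (cases "u = 0") (auto simp: reflection_def inner_diff_left inner_diff_right inner_commute field_simps)

lemma reflection_reflection: "reflection u (reflection u x) = x"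
  by (cases "u = 0") (auto simp: reflection_def inner_diff_right algebra_simps field_simps)

lemma norm_reflection: "norm (reflection u x) = norm x"
  by (simp add: norm_eq_sqrt_inner reflection_inner)

text \<open>A Householder reflection carries any unit vector to a coordinate vector, which makes the ellipsoids below axis-parallel.\<close>

lemma reflection_swaps:
  assumes "norm a = norm b" shows "reflection (a - b) a = b"
proof (cases "a = b")
  case False
  have n: "a \<bullet> a = b \<bullet> b" using assms by (simp add: norm_eq)
  have "2 * ((a - b) \<bullet> a) = (a - b) \<bullet> (a - b)"
    by (simp add: inner_diff_left inner_diff_right n inner_commute)
  moreover have "(a - b) \<bullet> (a - b) \<noteq> 0" using False by simp
  ultimately show ?thesis by (simp add: reflection_def)
qed (simp add: reflection_def)

lemma emeasure_ball0:
  assumes "t \<ge> 0"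
  shows "emeasure lborel {\<xi>::'a::euclidean_space. (norm \<xi>)\<^sup>2 < t} = ennreal (unit_ball_vol (DIM('a)) * t powr (DIM('a)/2))"
proof -
  have "{\<xi>::'a. (norm \<xi>)\<^sup>2 < t} = ball 0 (sqrt t)"
    using assms by (auto simp: real_less_rsqrt real_sqrt_less_iff) (metis norm_ge_zero real_less_lsqrt real_sqrt_less_iff real_sqrt_unique)
  moreover have "sqrt t ^ DIM('a) = t powr (DIM('a)/2)"
    using assms by (cases "t = 0") (auto simp: powr_half_sqrt[symmetric] powr_realpow[symmetric] powr_powr)
  ultimately show ?thesis using assms by (simp add: emeasure_ball)
qed

text \<open>The ellipsoid has the half-axis \<open>sqrt (2 t)\<close> in the direction \<open>\<nu>\<close> and the half-axes \<open>sqrt t\<close> in all orthogonal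
directions, which explains the factor \<open>sqrt 2\<close>.\<close>

lemma emeasure_ellipsoid:
  fixes \<nu> :: "'a::euclidean_space"
  assumes nu: "norm \<nu> = 1" and t: "t \<ge> 0"
  shows "emeasure lborel {\<xi>. (norm \<xi>)\<^sup>2 - (\<nu> \<bullet> \<xi>)\<^sup>2 / 2 < t}
    = ennreal (sqrt 2 * unit_ball_vol (DIM('a)) * t powr (DIM('a)/2))"
proof -
  obtain b :: 'a where b: "b \<in> Basis" by (meson nonempty_Basis ex_in_conv)
  define E where "E = (\<lambda>n::'a. {\<xi>. (norm \<xi>)\<^sup>2 - (n \<bullet> \<xi>)\<^sup>2 / 2 < t})"
  have oE: "open (E n)" for n unfolding E_def
    by (intro open_Collect_less continuous_intros) auto
  let ?h = "reflection (\<nu> - b)"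
  have hm: "?h \<in> borel_measurable borel"
    using linear_reflection linear_continuous_on linear_conv_bounded_linear borel_measurable_continuous_onI by blast
  have hnu: "?h \<nu> = b" using nu b by (intro reflection_swaps) simp
  have "emeasure lborel (E b) = emeasure (distr lborel borel ?h) (E b)"
    by (subst lborel_distr_linear_isometry[of ?h ?h]) (auto simp: linear_reflection norm_reflection reflection_reflection)
  also have "\<dots> = emeasure lborel (?h -` E b)" using oE hm by (simp add: emeasure_distr)
  also have "?h -` E b = E \<nu>"
  proof -
    have "b \<bullet> ?h \<xi> = \<nu> \<bullet> \<xi>" for \<xi> using reflection_inner[of "\<nu> - b" \<nu> \<xi>] hnu by simp
    then show ?thesis by (auto simp: E_def norm_reflection)
  qed
  finally have 1: "emeasure lborel (E \<nu>) = emeasure lborel (E b)" ..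
  \<comment> \<open>the ellipsoid in the direction \<open>b\<close> is the image of a ball under stretching by \<open>sqrt 2\<close> along \<open>b\<close>\<close>
  define c where "c = (\<lambda>j::'a. if j = b then sqrt 2 else 1)"
  define T where "T = (\<lambda>x::'a. 0 + (\<Sum>j\<in>Basis. (c j * (x \<bullet> j)) *\<^sub>R j))"
  have Tj: "T x \<bullet> j = c j * (x \<bullet> j)" if "j \<in> Basis" for x j
    unfolding T_def using that by (simp add: inner_sum_left inner_Basis if_distrib cong: if_cong)
  have lb: "lborel = density (distr lborel borel T) (\<lambda>_. ennreal (\<Prod>j\<in>Basis. \<bar>c j\<bar>))"
  proof -
    have "\<And>j. j \<in> Basis \<Longrightarrow> c j \<noteq> 0" by (simp add: c_def)
    then show ?thesis unfolding T_def using lborel_affine_euclidean[of c "0"] by blast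
  qed
  have cprod: "(\<Prod>j\<in>Basis. \<bar>c j\<bar>) = sqrt 2"
  proof -
    have "(\<Prod>j\<in>Basis. \<bar>c j\<bar>) = (\<Prod>j\<in>Basis. if j = b then sqrt 2 else 1)"
      by (intro prod.cong) (auto simp: c_def)
    then show ?thesis using b by simp
  qed
  have Tm: "T \<in> borel_measurable borel" unfolding T_def by measurable
  have TE: "T -` E b = {\<xi>. (norm \<xi>)\<^sup>2 < t}"
  proof -
    have "(norm (T x))\<^sup>2 - (b \<bullet> T x)\<^sup>2 / 2 = (norm x)\<^sup>2" for x
    proof -
      have "(norm (T x))\<^sup>2 = (\<Sum>j\<in>Basis. (c j * (x \<bullet> j))\<^sup>2)"
        by (subst power2_norm_eq_inner, subst euclidean_inner) (auto simp: Tj power2_eq_square)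
      also have "\<dots> = (\<Sum>j\<in>Basis. (x \<bullet> j)\<^sup>2 + (if j = b then (x \<bullet> b)\<^sup>2 else 0))"
        by (intro sum.cong) (auto simp: c_def power_mult_distrib)
      also have "\<dots> = (norm x)\<^sup>2 + (x \<bullet> b)\<^sup>2"
        using b by (simp add: sum.distrib euclidean_inner[of x x] power2_norm_eq_inner) (simp add: power2_eq_square)
      finally show ?thesis using Tj[OF b, of x] by (simp add: c_def inner_commute power_mult_distrib)
    qed
    then show ?thesis by (auto simp: E_def)
  qed
  have "emeasure lborel (E b) = (\<integral>\<^sup>+x. ennreal (sqrt 2) * indicator (E b) x \<partial>distr lborel borel T)"
    by (subst lb) (use oE in \<open>simp add: emeasure_density cprod\<close>)
  also have "\<dots> = ennreal (sqrt 2) * emeasure lborel (T -` E b)"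
    using oE Tm by (subst nn_integral_cmult_indicator) (auto simp: emeasure_distr)
  also have "\<dots> = ennreal (sqrt 2 * unit_ball_vol (DIM('a)) * t powr (DIM('a)/2))"
    using emeasure_ball0[OF t, where 'a='a] by (simp add: TE ennreal_mult[symmetric] mult.assoc)
  finally show ?thesis using 1 by (simp add: E_def)
qed

section \<open>Layer-cake integrals\<close>

lemma nn_integral_powr_Icc:
  assumes p: "p \<ge> 0" and K: "K \<ge> 0"
  shows "(\<integral>\<^sup>+t. ennreal (t powr p) * indicator {0..K} t \<partial>lborel) = ennreal (K powr (p+1) / (p+1))"
  using p K by (intro nn_integral_has_integral_lebesgue' has_integral_powr_from_0) auto

text \<open>The layer-cake formula in the form needed for powers of \<open>K - \<rho>\<close>: when the level sets of \<open>\<rho>\<close> grow like \<open>t powr p\<close>,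
integrating them over \<open>t \<in> {0..K}\<close> raises the exponent by one.\<close>

lemma nn_integral_layer:
  fixes F :: "'a::euclidean_space \<Rightarrow> real \<Rightarrow> ennreal"
  assumes F: "(\<lambda>p. F (fst p) (snd p)) \<in> borel_measurable (borel \<Otimes>\<^sub>M borel)"
    and eq: "\<And>t. 0 \<le> t \<Longrightarrow> t \<le> K \<Longrightarrow> (\<integral>\<^sup>+\<xi>. F \<xi> t \<partial>lborel) = ennreal (c * t powr p)"
    and c: "0 \<le> c" "0 \<le> p" "0 \<le> K"
  shows "(\<integral>\<^sup>+\<xi>. (\<integral>\<^sup>+t. F \<xi> t * indicator {0..K} t \<partial>lborel) \<partial>lborel) = ennreal (c * K powr (p+1) / (p+1))"
proof -
  have "(\<integral>\<^sup>+\<xi>. (\<integral>\<^sup>+t. F \<xi> t * indicator {0..K} t \<partial>lborel) \<partial>lborel)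
      = (\<integral>\<^sup>+t. (\<integral>\<^sup>+\<xi>. F \<xi> t * indicator {0..K} t \<partial>lborel) \<partial>lborel)"
  proof (rule lborel_pair.Fubini'[symmetric])
    note F[measurable]
    show "(\<lambda>(\<xi>, t). F \<xi> t * indicator {0..K} t) \<in> borel_measurable (lborel \<Otimes>\<^sub>M lborel)"
      unfolding case_prod_beta'
      by (subst measurable_cong_sets[OF sets_pair_measure_cong[OF sets_lborel sets_lborel] refl]) measurable
  qed
  also have "\<dots> = (\<integral>\<^sup>+t. ennreal c * (ennreal (t powr p) * indicator {0..K} t) \<partial>lborel)"
  proof (rule nn_integral_cong)
    fix t :: real
    have [measurable]: "(\<lambda>\<xi>. F \<xi> t) \<in> borel_measurable lborel"
      using measurable_compose[OF _ F, of "\<lambda>\<xi>. (\<xi>, t)"] by simp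
    show "(\<integral>\<^sup>+\<xi>. F \<xi> t * indicator {0..K} t \<partial>lborel) = ennreal c * (ennreal (t powr p) * indicator {0..K} t)"
      using c by (cases "t \<in> {0..K}") (auto simp: eq ennreal_mult)
  qed
  also have "\<dots> = ennreal c * ennreal (K powr (p+1) / (p+1))"
    using c by (subst nn_integral_cmult) (auto simp: nn_integral_powr_Icc)
  finally show ?thesis using c by (simp add: ennreal_mult[symmetric])
qed

lemma nn_integral_pos_part:
  fixes \<rho> :: "'a::euclidean_space \<Rightarrow> real"
  assumes [measurable]: "\<rho> \<in> borel_measurable borel" and r0: "\<And>\<xi>. 0 \<le> \<rho> \<xi>"
    and vol: "\<And>t. 0 \<le> t \<Longrightarrow> emeasure lborel {\<xi>. \<rho> \<xi> < t} = ennreal (c * t powr p)"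
    and c: "0 \<le> c" "0 \<le> p" "0 \<le> K"
  shows "(\<integral>\<^sup>+\<xi>. ennreal (max 0 (K - \<rho> \<xi>)) \<partial>lborel) = ennreal (c * K powr (p+1) / (p+1))"
proof -
  have "ennreal (max 0 (K - \<rho> \<xi>)) = (\<integral>\<^sup>+t. indicator {\<xi>. \<rho> \<xi> < t} \<xi> * indicator {0..K} t \<partial>lborel)" for \<xi>
  proof -
    have "(\<integral>\<^sup>+t. indicator {\<xi>. \<rho> \<xi> < t} \<xi> * indicator {0..K} t \<partial>lborel) = (\<integral>\<^sup>+t. indicator {\<rho> \<xi><..K} t \<partial>lborel)"
      using r0[of \<xi>] by (intro nn_integral_cong) (auto split: split_indicator)
    also have "\<dots> = ennreal (max 0 (K - \<rho> \<xi>))"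
      by (cases "\<rho> \<xi> \<le> K") (auto simp: max_def)
    finally show ?thesis ..
  qed
  moreover have "(\<integral>\<^sup>+\<xi>. (\<integral>\<^sup>+t. indicator {\<xi>. \<rho> \<xi> < t} \<xi> * indicator {0..K} t \<partial>lborel) \<partial>lborel) = ennreal (c * K powr (p+1) / (p+1))"
    using c by (intro nn_integral_layer) (auto simp: vol)
  ultimately show ?thesis by simp
qed

lemma nn_integral_pos_part_square:
  fixes \<rho> :: "'a::euclidean_space \<Rightarrow> real"
  assumes [measurable]: "\<rho> \<in> borel_measurable borel" and r0: "\<And>\<xi>. 0 \<le> \<rho> \<xi>"
    and vol: "\<And>t. 0 \<le> t \<Longrightarrow> emeasure lborel {\<xi>. \<rho> \<xi> < t} = ennreal (c * t powr p)"
    and c: "0 \<le> c" "0 \<le> p" "0 \<le> K"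
  shows "(\<integral>\<^sup>+\<xi>. ennreal ((max 0 (K - \<rho> \<xi>))\<^sup>2) \<partial>lborel) = ennreal (2 * c * K powr (p+2) / ((p+1) * (p+2)))"
proof -
  have "ennreal ((max 0 (K - \<rho> \<xi>))\<^sup>2) = (\<integral>\<^sup>+t. ennreal (2 * max 0 (t - \<rho> \<xi>)) * indicator {0..K} t \<partial>lborel)" for \<xi>
  proof -
    have "(\<integral>\<^sup>+t. ennreal (2 * max 0 (t - \<rho> \<xi>)) * indicator {0..K} t \<partial>lborel)
       = (\<integral>\<^sup>+t. ennreal (2 * (t - \<rho> \<xi>)) * indicator {\<rho> \<xi>..K} t \<partial>lborel)"
      using r0[of \<xi>] by (intro nn_integral_cong) (auto split: split_indicator simp: max_def)
    also have "\<dots> = ennreal ((max 0 (K - \<rho> \<xi>))\<^sup>2)"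
    proof (cases "\<rho> \<xi> \<le> K")
      case True
      have "(\<integral>\<^sup>+t. ennreal (2 * (t - \<rho> \<xi>)) * indicator {\<rho> \<xi>..K} t \<partial>lborel) = ennreal ((K - \<rho> \<xi>)\<^sup>2 - (\<rho> \<xi> - \<rho> \<xi>)\<^sup>2)"
        using True by (intro nn_integral_FTC_Icc) (auto intro!: derivative_eq_intros simp flip: has_real_derivative_iff_has_vector_derivative)
      then show ?thesis using True by (simp add: max_def)
    qed simp
    finally show ?thesis ..
  qed
  moreover have "(\<integral>\<^sup>+\<xi>. (\<integral>\<^sup>+t. ennreal (2 * max 0 (t - \<rho> \<xi>)) * indicator {0..K} t \<partial>lborel) \<partial>lborel) = ennreal (2 * c / (p+1) * K powr (p+1+1) / (p+1+1))"
  proof (rule nn_integral_layer)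
    fix t :: real assume t: "0 \<le> t" "t \<le> K"
    have "(\<integral>\<^sup>+\<xi>. ennreal (2 * max 0 (t - \<rho> \<xi>)) \<partial>lborel) = 2 * (\<integral>\<^sup>+\<xi>. ennreal (max 0 (t - \<rho> \<xi>)) \<partial>lborel)"
      by (subst nn_integral_cmult[symmetric]) (auto simp: ennreal_mult)
    also have "\<dots> = ennreal (2 * c / (p+1) * t powr (p+1))"
      using c t by (subst nn_integral_pos_part[OF assms(1) r0 vol c(1,2) t(1)])
        (auto simp: ennreal_mult[symmetric] simp flip: ennreal_numeral)
    finally show "(\<integral>\<^sup>+\<xi>. ennreal (2 * max 0 (t - \<rho> \<xi>)) \<partial>lborel) = ennreal (2 * c / (p+1) * t powr (p+1))" .
  qed (use c in auto)
  ultimately show ?thesis using c by (simp add: add.commute mult.commute)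
qed

section \<open>Gaussian integrals and Plancherel's identity\<close>

lemma integrable_continuous_compact_support:
  fixes f :: "'a::euclidean_space \<Rightarrow> real"
  assumes "continuous_on UNIV f" "compact K" "\<And>x. x \<notin> K \<Longrightarrow> f x = 0"
  shows "integrable lborel f"
proof -
  have "integrable lborel (\<lambda>x. indicator K x *\<^sub>R f x)"
    using assms by (intro borel_integrable_compact continuous_on_subset[OF assms(1)]) auto
  moreover have "(\<lambda>x. indicator K x *\<^sub>R f x) = f"
    using assms(3) by (auto simp: fun_eq_iff split: split_indicator)
  ultimately show ?thesis by simp
qed

lemma lborel_integral_affine:
  fixes f :: "'a::euclidean_space \<Rightarrow> real"
  assumes [measurable]: "f \<in> borel_measurable borel" and c: "c \<noteq> 0"
  shows "(LINT x|lborel. f x) = \<bar>c\<bar> ^ DIM('a) * (LINT x|lborel. f (t + c *\<^sub>R x))"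
  by (subst lborel_affine[OF c, of t]) (simp add: integral_density integral_distr)

lemma gaussian_iexp_integral:
  "integrable lborel (\<lambda>t. complex_of_real (exp (- t\<^sup>2 / 2)) * iexp (s * t))"
  "(CLINT t|lborel. complex_of_real (exp (- t\<^sup>2 / 2)) * iexp (s * t)) = complex_of_real (sqrt (2 * pi) * exp (- s\<^sup>2 / 2))"
proof -
  have e: "complex_of_real (exp (- t\<^sup>2 / 2)) * iexp (s * t)
      = complex_of_real (sqrt (2 * pi)) * (std_normal_density t *\<^sub>R iexp (s * t))" for t
    by (simp add: std_normal_density_def scaleR_conv_of_real)
  have i: "integrable lborel (\<lambda>t. std_normal_density t *\<^sub>R iexp (s * t))"
  proof (rule Bochner_Integration.integrable_bound)
    show "integrable lborel std_normal_density" by simp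
  qed (auto simp: norm_mult)
  then show "integrable lborel (\<lambda>t. complex_of_real (exp (- t\<^sup>2 / 2)) * iexp (s * t))"
    unfolding e by (rule integrable_mult_right)
  have "complex_of_real (exp (- s\<^sup>2 / 2)) = char std_normal_distribution s"
    by (simp add: char_std_normal_distribution)
  also have "\<dots> = (CLINT t|lborel. std_normal_density t *\<^sub>R iexp (s * t))"
    unfolding char_def by (subst integral_density) auto
  finally have "(CLINT t|lborel. std_normal_density t *\<^sub>R iexp (s * t)) = complex_of_real (exp (- s\<^sup>2 / 2))" ..
  then show "(CLINT t|lborel. complex_of_real (exp (- t\<^sup>2 / 2)) * iexp (s * t)) = complex_of_real (sqrt (2 * pi) * exp (- s\<^sup>2 / 2))"
    by (subst e, subst integral_mult_right_zero) simp
qed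

lemma gaussian_cos_integral:
  fixes z :: "'a::euclidean_space"
  shows "integrable lborel (\<lambda>\<xi>::'a. exp (- (norm \<xi>)\<^sup>2 / 2) * cos (\<xi> \<bullet> z))"
    "(LINT \<xi>|lborel. exp (- (norm \<xi>)\<^sup>2 / 2) * cos (\<xi> \<bullet> z)) = sqrt (2 * pi) ^ DIM('a) * exp (- (norm z)\<^sup>2 / 2)"
proof -
  define g where "g = (\<lambda>b t. complex_of_real (exp (- t\<^sup>2 / 2)) * iexp ((z \<bullet> b) * t))"
  let ?P = "\<Pi>\<^sub>M b\<in>(Basis::'a set). (lborel::real measure)"
  let ?h = "\<lambda>f. \<Sum>b\<in>Basis. f b *\<^sub>R (b::'a)"
  interpret product_sigma_finite "\<lambda>b::'a. (lborel::real measure)" ..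
  have nsq: "(norm x)\<^sup>2 = (\<Sum>b\<in>Basis. (x \<bullet> b)\<^sup>2)" for x :: 'a
    by (subst power2_norm_eq_inner, subst euclidean_inner) (simp add: power2_eq_square)
  have F: "(\<Prod>b\<in>Basis. g b (\<xi> \<bullet> b)) = complex_of_real (exp (- (norm \<xi>)\<^sup>2 / 2)) * iexp (\<xi> \<bullet> z)" for \<xi>
  proof -
    have "(\<Prod>b\<in>Basis. g b (\<xi> \<bullet> b)) = (\<Prod>b\<in>Basis. exp (complex_of_real (- (\<xi> \<bullet> b)\<^sup>2 / 2) + \<i> * complex_of_real ((z \<bullet> b) * (\<xi> \<bullet> b))))"
      by (simp only: g_def exp_add exp_of_real)
    also have "\<dots> = exp (\<Sum>b\<in>Basis. complex_of_real (- (\<xi> \<bullet> b)\<^sup>2 / 2) + \<i> * complex_of_real ((z \<bullet> b) * (\<xi> \<bullet> b)))"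
      by (simp add: exp_sum)
    also have "(\<Sum>b\<in>Basis. complex_of_real (- (\<xi> \<bullet> b)\<^sup>2 / 2) + \<i> * complex_of_real ((z \<bullet> b) * (\<xi> \<bullet> b)))
       = complex_of_real (\<Sum>b\<in>Basis. - (\<xi> \<bullet> b)\<^sup>2 / 2) + \<i> * complex_of_real (\<Sum>b\<in>Basis. (z \<bullet> b) * (\<xi> \<bullet> b))"
      by (simp only: sum.distrib sum_distrib_left of_real_sum)
    also have "(\<Sum>b\<in>Basis. - (\<xi> \<bullet> b)\<^sup>2 / 2) = - (norm \<xi>)\<^sup>2 / 2"
      by (simp add: nsq sum_negf sum_divide_distrib)
    also have "(\<Sum>b\<in>Basis. (z \<bullet> b) * (\<xi> \<bullet> b)) = \<xi> \<bullet> z"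
      by (simp add: euclidean_inner[of \<xi> z] mult.commute)
    finally show ?thesis by (simp only: exp_add exp_of_real)
  qed
  have hb: "?h f \<bullet> b = f b" if "b \<in> Basis" for f b using that by simp
  have hm: "?h \<in> ?P \<rightarrow>\<^sub>M borel" by measurable
  have mF: "(\<lambda>\<xi>::'a. \<Prod>b\<in>Basis. g b (\<xi> \<bullet> b)) \<in> borel_measurable borel"
    unfolding g_def by measurable
  have gi: "integrable lborel (g b)" for b unfolding g_def by (rule gaussian_iexp_integral)
  have I1: "integrable ?P (\<lambda>f. \<Prod>b\<in>Basis. g b (f b))"
    by (intro product_integrable_prod gi) simp
  have I2: "integrable lborel (\<lambda>\<xi>::'a. \<Prod>b\<in>Basis. g b (\<xi> \<bullet> b))"
    by (subst lborel_eq, subst integrable_distr_eq[OF hm mF]) (use I1 in \<open>simp add: hb cong: prod.cong\<close>)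
  have "(CLINT \<xi>|lborel. (\<Prod>b\<in>Basis. g b (\<xi> \<bullet> b))) = (CLINT f|?P. (\<Prod>b\<in>Basis. g b (f b)))"
    by (subst lborel_eq, subst integral_distr[OF hm mF]) (simp add: hb cong: prod.cong)
  also have "\<dots> = (\<Prod>b\<in>Basis. CLINT t|lborel. g b t)"
    by (intro product_integral_prod gi) simp
  also have "\<dots> = (\<Prod>b\<in>(Basis::'a set). complex_of_real (sqrt (2 * pi) * exp (- (z \<bullet> b)\<^sup>2 / 2)))"
    unfolding g_def gaussian_iexp_integral by simp
  also have "\<dots> = complex_of_real (sqrt (2 * pi) ^ DIM('a) * exp (- (norm z)\<^sup>2 / 2))"
    by (simp add: prod.distrib nsq exp_sum sum_negf[symmetric] sum_divide_distrib flip: of_real_prod of_real_mult)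
  finally have I3: "(CLINT \<xi>|lborel. (\<Prod>b\<in>Basis. g b (\<xi> \<bullet> b))) = complex_of_real (sqrt (2 * pi) ^ DIM('a) * exp (- (norm z)\<^sup>2 / 2))" .
  have R: "Re (\<Prod>b\<in>Basis. g b (\<xi> \<bullet> b)) = exp (- (norm \<xi>)\<^sup>2 / 2) * cos (\<xi> \<bullet> z)" for \<xi>
    unfolding F by (simp add: Re_exp)
  show "integrable lborel (\<lambda>\<xi>::'a. exp (- (norm \<xi>)\<^sup>2 / 2) * cos (\<xi> \<bullet> z))"
    using integrable_Re[OF I2] unfolding R .
  show "(LINT \<xi>|lborel. exp (- (norm \<xi>)\<^sup>2 / 2) * cos (\<xi> \<bullet> z)) = sqrt (2 * pi) ^ DIM('a) * exp (- (norm z)\<^sup>2 / 2)"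
    using integral_Re[OF I2] unfolding R I3 by simp
qed

lemma gaussian_cos_integral_scaled:
  fixes z :: "'a::euclidean_space"
  assumes s: "s > 0"
  shows "integrable lborel (\<lambda>\<xi>::'a. exp (- (norm \<xi>)\<^sup>2 / (2 * s\<^sup>2)))"
    "(LINT \<xi>|lborel. exp (- (norm \<xi>)\<^sup>2 / (2 * s\<^sup>2)) * cos (\<xi> \<bullet> z)) = s ^ DIM('a) * (sqrt (2 * pi) ^ DIM('a) * exp (- (norm (s *\<^sub>R z))\<^sup>2 / 2))"
proof -
  have e: "exp (- (norm (0 + s *\<^sub>R \<xi>))\<^sup>2 / (2 * s\<^sup>2)) = exp (- (norm \<xi>)\<^sup>2 / 2)" for \<xi> :: 'a
    using s by (simp add: power_mult_distrib)
  have "(LINT \<xi>|lborel. exp (- (norm \<xi>)\<^sup>2 / (2 * s\<^sup>2)) * cos (\<xi> \<bullet> z))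
      = \<bar>s\<bar> ^ DIM('a) * (LINT \<xi>|lborel. exp (- (norm (0 + s *\<^sub>R \<xi>))\<^sup>2 / (2 * s\<^sup>2)) * cos ((0 + s *\<^sub>R \<xi>) \<bullet> z))"
    by (rule lborel_integral_affine) (use s in auto)
  also have "\<dots> = \<bar>s\<bar> ^ DIM('a) * (LINT \<xi>|lborel. exp (- (norm \<xi>)\<^sup>2 / 2) * cos (\<xi> \<bullet> (s *\<^sub>R z)))"
    unfolding e by simp
  finally show "(LINT \<xi>|lborel. exp (- (norm \<xi>)\<^sup>2 / (2 * s\<^sup>2)) * cos (\<xi> \<bullet> z)) = s ^ DIM('a) * (sqrt (2 * pi) ^ DIM('a) * exp (- (norm (s *\<^sub>R z))\<^sup>2 / 2))"
    using s by (subst (asm) gaussian_cos_integral(2)) simp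
  have "integrable lborel (\<lambda>\<xi>::'a. exp (- (norm \<xi>)\<^sup>2 / 2))" using gaussian_cos_integral(1)[of 0] by simp
  then have "integrable lborel (\<lambda>\<xi>::'a. exp (- (norm (0 + s *\<^sub>R \<xi>))\<^sup>2 / (2 * s\<^sup>2)))" unfolding e .
  then show "integrable lborel (\<lambda>\<xi>::'a. exp (- (norm \<xi>)\<^sup>2 / (2 * s\<^sup>2)))"
    using s by (subst lborel_affine[of s 0]) (auto simp: integrable_density integrable_distr_eq)
qed

definition cos_transform :: "('a::euclidean_space \<Rightarrow> real) \<Rightarrow> 'a \<Rightarrow> real" where
  "cos_transform f \<xi> = (LINT x|lborel. f x * cos (\<xi> \<bullet> x))"

definition sin_transform :: "('a::euclidean_space \<Rightarrow> real) \<Rightarrow> 'a \<Rightarrow> real" where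
  "sin_transform f \<xi> = (LINT x|lborel. f x * sin (\<xi> \<bullet> x))"

definition compactly_supported :: "('a::euclidean_space \<Rightarrow> real) \<Rightarrow> bool" where
  "compactly_supported f \<longleftrightarrow> continuous_on UNIV f \<and> (\<exists>K. compact K \<and> (\<forall>x. x \<notin> K \<longrightarrow> f x = 0))"

lemma compactly_supportedI: "continuous_on UNIV f \<Longrightarrow> compact K \<Longrightarrow> (\<And>x. x \<notin> K \<Longrightarrow> f x = 0) \<Longrightarrow> compactly_supported f"
  unfolding compactly_supported_def by blast

lemma compactly_supportedE:
  assumes "compactly_supported f"
  obtains K where "continuous_on UNIV f" "compact K" "\<And>x. x \<notin> K \<Longrightarrow> f x = 0"
  using assms unfolding compactly_supported_def by blast

lemma compactly_supported_integrable: "compactly_supported f \<Longrightarrow> integrable lborel f"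
  by (elim compactly_supportedE) (rule integrable_continuous_compact_support)

lemma compactly_supported_mult:
  "compactly_supported f \<Longrightarrow> continuous_on UNIV g \<Longrightarrow> compactly_supported (\<lambda>x. f x * g x)"
  by (elim compactly_supportedE) (rule compactly_supportedI, auto intro: continuous_intros)

lemma compactly_supported_add:
  assumes "compactly_supported f" "compactly_supported g"
  shows "compactly_supported (\<lambda>x. f x + g x)"
proof -
  obtain K where K: "continuous_on UNIV f" "compact K" "\<And>x. x \<notin> K \<Longrightarrow> f x = 0"
    using assms(1) unfolding compactly_supported_def by blast
  obtain L where L: "continuous_on UNIV g" "compact L" "\<And>x. x \<notin> L \<Longrightarrow> g x = 0"
    using assms(2) unfolding compactly_supported_def by blast
  show ?thesis using K L by (intro compactly_supportedI[of _ "K \<union> L"]) (auto intro: continuous_intros)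
qed

lemma compactly_supported_bounded:
  assumes "compactly_supported f"
  obtains B where "0 \<le> B" "\<And>x. \<bar>f x\<bar> \<le> B"
proof -
  obtain K where K: "continuous_on UNIV f" "compact K" "\<And>x. x \<notin> K \<Longrightarrow> f x = 0"
    using assms unfolding compactly_supported_def by blast
  have "bounded (f ` K)" using K by (meson compact_continuous_image compact_imp_bounded continuous_on_subset subset_UNIV)
  then obtain B where "B > 0" "\<And>x. x \<in> K \<Longrightarrow> \<bar>f x\<bar> \<le> B" by (auto simp: bounded_pos)
  then show thesis using that[of B] K(3) by (metis abs_zero less_imp_le)
qed

definition autocorrelation :: "('a::euclidean_space \<Rightarrow> real) \<Rightarrow> 'a \<Rightarrow> real" where
  "autocorrelation f z = (LINT x|lborel. f x * f (x + z))"

text \<open>The squared modulus of the Fourier transform of \<open>f\<close> is the Fourier transform of its autocorrelation. The remaining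
parts collect what is needed to recover the value at \<open>0\<close> of the autocorrelation, which is the squared norm of \<open>f\<close>.\<close>

lemma transform_square_eq:
  fixes f :: "'a::euclidean_space \<Rightarrow> real"
  assumes f: "compactly_supported f"
  shows "(cos_transform f \<xi>)\<^sup>2 + (sin_transform f \<xi>)\<^sup>2 = (LINT z|lborel. autocorrelation f z * cos (\<xi> \<bullet> z))"
    and "integrable lborel (autocorrelation f)"
    and "autocorrelation f \<midarrow>0\<rightarrow> autocorrelation f 0"
    and "\<exists>B. \<forall>z. \<bar>autocorrelation f z\<bar> \<le> B"
proof -
  obtain K where K: "continuous_on UNIV f" "compact K" "\<And>x. x \<notin> K \<Longrightarrow> f x = 0"
    using f unfolding compactly_supported_def by blast
  obtain B where B: "0 \<le> B" "\<And>x. \<bar>f x\<bar> \<le> B" using compactly_supported_bounded[OF f] by blast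
  have cf: "continuous_on A (\<lambda>x. f (h x))" if "continuous_on A h" for A :: "'b::topological_space set" and h
    using continuous_on_compose2[OF K(1) that] by auto
  have fi: "integrable lborel f" using f by (rule compactly_supported_integrable)
  have fm[measurable]: "f \<in> borel_measurable borel" using K(1) by (rule borel_measurable_continuous_onI)
  let ?K2 = "(\<lambda>p. (fst p, snd p - fst p)) ` (K \<times> K)"
  have K2: "compact ?K2" by (intro compact_continuous_image compact_Times K continuous_intros)
  have K2': "(x, z) \<in> ?K2" if "x \<in> K" "x + z \<in> K" for x z
    using that by (intro image_eqI[of _ _ "(x, x + z)"]) auto
  have ip: "integrable (lborel \<Otimes>\<^sub>M lborel) (\<lambda>(x, z). f x * f (x + z) * g (x, z))"
    if "continuous_on UNIV g" for g :: "'a \<times> 'a \<Rightarrow> real"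
    unfolding lborel_prod
  proof (rule integrable_continuous_compact_support[OF _ K2])
    show "continuous_on UNIV (\<lambda>(x, z). f x * f (x + z) * g (x, z))"
      unfolding case_prod_beta' using that by (intro continuous_intros cf) auto
  next
    fix p :: "'a \<times> 'a" assume "p \<notin> ?K2"
    then have "fst p \<notin> K \<or> fst p + snd p \<notin> K" using K2'[of "fst p" "snd p"] by auto
    then show "(case p of (x, z) \<Rightarrow> f x * f (x + z) * g (x, z)) = 0" using K(3) by (auto simp: case_prod_beta')
  qed
  have cs: "integrable lborel (\<lambda>x. f x * cos (\<xi> \<bullet> x))" "integrable lborel (\<lambda>x. f x * sin (\<xi> \<bullet> x))"
    by (auto intro!: compactly_supported_integrable compactly_supported_mult f continuous_intros)
  have "(cos_transform f \<xi>)\<^sup>2 + (sin_transform f \<xi>)\<^sup>2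
     = (LINT x|lborel. f x * cos (\<xi> \<bullet> x) * cos_transform f \<xi> + f x * sin (\<xi> \<bullet> x) * sin_transform f \<xi>)"
    using cs by (simp add: cos_transform_def sin_transform_def power2_eq_square)
  also have "\<dots> = (LINT x|lborel. (LINT z|lborel. f x * f (x + z) * cos (\<xi> \<bullet> z)))"
  proof (rule Bochner_Integration.integral_cong)
    fix x :: 'a
    have "f x * cos (\<xi> \<bullet> x) * cos_transform f \<xi> + f x * sin (\<xi> \<bullet> x) * sin_transform f \<xi>
      = (LINT y|lborel. f x * f y * cos (\<xi> \<bullet> (y - x)))"
    proof -
      have "(LINT y|lborel. f x * f y * cos (\<xi> \<bullet> (y - x)))
        = (LINT y|lborel. f x * cos (\<xi> \<bullet> x) * (f y * cos (\<xi> \<bullet> y)) + f x * sin (\<xi> \<bullet> x) * (f y * sin (\<xi> \<bullet> y)))"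
        by (simp add: inner_diff_right cos_diff algebra_simps)
      also have "\<dots> = f x * cos (\<xi> \<bullet> x) * cos_transform f \<xi> + f x * sin (\<xi> \<bullet> x) * sin_transform f \<xi>"
        using cs by (simp add: cos_transform_def sin_transform_def)
      finally show ?thesis ..
    qed
    also have "\<dots> = (LINT z|lborel. f x * f (x + z) * cos (\<xi> \<bullet> z))"
      by (subst lborel_integral_affine[of _ 1 x]) auto
    finally show "f x * cos (\<xi> \<bullet> x) * cos_transform f \<xi> + f x * sin (\<xi> \<bullet> x) * sin_transform f \<xi>
       = (LINT z|lborel. f x * f (x + z) * cos (\<xi> \<bullet> z))" .
  qed simp
  also have "\<dots> = (LINT z|lborel. (LINT x|lborel. f x * f (x + z) * cos (\<xi> \<bullet> z)))"
  proof (rule lborel_pair.Fubini_integral[symmetric])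
    have "continuous_on UNIV (\<lambda>p::'a \<times> 'a. cos (\<xi> \<bullet> snd p))" by (intro continuous_intros)
    from ip[OF this] show "integrable (lborel \<Otimes>\<^sub>M lborel) (\<lambda>(x, z). f x * f (x + z) * cos (\<xi> \<bullet> z))" by simp
  qed
  also have "\<dots> = (LINT z|lborel. autocorrelation f z * cos (\<xi> \<bullet> z))"
    unfolding autocorrelation_def by simp
  finally show "(cos_transform f \<xi>)\<^sup>2 + (sin_transform f \<xi>)\<^sup>2 = (LINT z|lborel. autocorrelation f z * cos (\<xi> \<bullet> z))" .
  have "integrable (lborel \<Otimes>\<^sub>M lborel) (\<lambda>(x, z). f x * f (x + z))"
    using ip[of "\<lambda>_. 1", OF continuous_on_const] by simp
  from lborel_pair.integrable_snd[OF this] show "integrable lborel (autocorrelation f)"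
    unfolding autocorrelation_def .
  have dom: "integrable lborel (\<lambda>x. B * \<bar>f x\<bar>)" using fi by auto
  have bnd: "\<bar>f x * f (x + z)\<bar> \<le> B * \<bar>f x\<bar>" for x z
    using B(2)[of "x + z"] by (simp add: abs_mult mult.commute[of B] mult_left_mono)
  show "autocorrelation f \<midarrow>0\<rightarrow> autocorrelation f 0"
    unfolding tendsto_at_iff_sequentially
  proof (intro allI impI)
    fix X :: "nat \<Rightarrow> 'a" assume X: "\<forall>i. X i \<in> UNIV - {0}" "X \<longlonglongrightarrow> 0"
    show "(autocorrelation f \<circ> X) \<longlonglongrightarrow> autocorrelation f 0"
      unfolding autocorrelation_def comp_def
    proof (rule integral_dominated_convergence[where w="\<lambda>x. B * \<bar>f x\<bar>"])
      have "isCont f x" for x using K(1) continuous_on_eq_continuous_at open_UNIV by blast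
      then have "(\<lambda>i. f (x + X i)) \<longlonglongrightarrow> f (x + 0)" for x
        by (intro isCont_tendsto_compose[of "x + 0" f] tendsto_intros X(2)) auto
      then show "AE x in lborel. (\<lambda>i. f x * f (x + X i)) \<longlonglongrightarrow> f x * f (x + 0)"
        by (intro AE_I2 tendsto_mult tendsto_const) auto
    qed (use dom bnd in auto)
  qed
  show "\<exists>B. \<forall>z. \<bar>autocorrelation f z\<bar> \<le> B"
  proof (intro exI[of _ "LINT x|lborel. B * \<bar>f x\<bar>"] allI)
    fix z
    have "\<bar>autocorrelation f z\<bar> \<le> (LINT x|lborel. \<bar>f x * f (x + z)\<bar>)"
      unfolding autocorrelation_def by (rule integral_abs_bound)
    also have "\<dots> \<le> (LINT x|lborel. B * \<bar>f x\<bar>)"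
    proof (rule integral_mono'[OF dom])
      show "\<bar>f x * f (x + z)\<bar> \<le> B * \<bar>f x\<bar>" for x by (rule bnd)
      show "0 \<le> B * \<bar>f x\<bar>" for x using B(1) by simp
    qed
    finally show "\<bar>autocorrelation f z\<bar> \<le> (LINT x|lborel. B * \<bar>f x\<bar>)" .
  qed
qed

lemma gaussian_transform_square:
  fixes f :: "'a::euclidean_space \<Rightarrow> real"
  assumes f: "compactly_supported f" and s: "s > 0"
  defines "W \<equiv> \<lambda>\<xi>::'a. exp (- (norm \<xi>)\<^sup>2 / (2 * s\<^sup>2))"
  shows "integrable lborel (\<lambda>\<xi>. W \<xi> * ((cos_transform f \<xi>)\<^sup>2 + (sin_transform f \<xi>)\<^sup>2))"
    "(LINT \<xi>|lborel. W \<xi> * ((cos_transform f \<xi>)\<^sup>2 + (sin_transform f \<xi>)\<^sup>2))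
      = sqrt (2 * pi) ^ DIM('a) * (LINT z|lborel. autocorrelation f (z /\<^sub>R s) * exp (- (norm z)\<^sup>2 / 2))"
proof -
  let ?h = "autocorrelation f"
  note T = transform_square_eq[OF f]
  have hm[measurable]: "?h \<in> borel_measurable borel" using borel_measurable_integrable[OF T(2)] by simp
  have Wi: "integrable lborel W" unfolding W_def by (rule gaussian_cos_integral_scaled[OF s])
  have Wm[measurable]: "W \<in> borel_measurable borel" using borel_measurable_integrable[OF Wi] by simp
  have W0: "0 \<le> W \<xi>" for \<xi> by (simp add: W_def)
  have ip: "integrable (lborel \<Otimes>\<^sub>M lborel) (\<lambda>(\<xi>, z). W \<xi> * (?h z * cos (\<xi> \<bullet> z)))"
  proof (rule lborel_pair.Fubini_integrable)
    show m: "(\<lambda>(\<xi>, z). W \<xi> * (?h z * cos (\<xi> \<bullet> z))) \<in> borel_measurable (lborel \<Otimes>\<^sub>M lborel)"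
      unfolding case_prod_beta'
      by (subst measurable_cong_sets[OF sets_pair_measure_cong[OF sets_lborel sets_lborel] refl]) measurable
    have hc: "integrable lborel (\<lambda>z. ?h z * cos (\<xi> \<bullet> z))" for \<xi>
      by (rule Bochner_Integration.integrable_bound[OF T(2)]) (auto simp: abs_mult mult_left_le)
    then show "AE \<xi> in lborel. integrable lborel (\<lambda>z. case (\<xi>, z) of (\<xi>, z) \<Rightarrow> W \<xi> * (?h z * cos (\<xi> \<bullet> z)))"
      by simp
    show "integrable lborel (\<lambda>\<xi>. LINT z|lborel. norm (case (\<xi>, z) of (\<xi>, z) \<Rightarrow> W \<xi> * (?h z * cos (\<xi> \<bullet> z))))"
    proof (rule Bochner_Integration.integrable_bound)
      show "integrable lborel (\<lambda>\<xi>. W \<xi> * (LINT z|lborel. \<bar>?h z\<bar>))" using Wi by simp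
      show "(\<lambda>\<xi>. LINT z|lborel. norm (case (\<xi>, z) of (\<xi>, z) \<Rightarrow> W \<xi> * (?h z * cos (\<xi> \<bullet> z)))) \<in> borel_measurable lborel"
        using m by (intro lborel.borel_measurable_lebesgue_integral) measurable
      show "AE \<xi> in lborel. norm (LINT z|lborel. norm (case (\<xi>, z) of (\<xi>, z) \<Rightarrow> W \<xi> * (?h z * cos (\<xi> \<bullet> z)))) \<le> norm (W \<xi> * (LINT z|lborel. \<bar>?h z\<bar>))"
      proof (rule AE_I2)
        fix \<xi>
        have "(LINT z|lborel. \<bar>?h z * cos (\<xi> \<bullet> z)\<bar>) \<le> (LINT z|lborel. \<bar>?h z\<bar>)"
          by (intro integral_mono') (use T(2) in \<open>auto simp: abs_mult mult_left_le\<close>)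
        then show "norm (LINT z|lborel. norm (case (\<xi>, z) of (\<xi>, z) \<Rightarrow> W \<xi> * (?h z * cos (\<xi> \<bullet> z)))) \<le> norm (W \<xi> * (LINT z|lborel. \<bar>?h z\<bar>))"
          using W0[of \<xi>] by (simp add: abs_mult[of "W \<xi>"] mult_left_mono)
      qed
    qed
  qed
  have e: "W \<xi> * ((cos_transform f \<xi>)\<^sup>2 + (sin_transform f \<xi>)\<^sup>2) = (LINT z|lborel. W \<xi> * (?h z * cos (\<xi> \<bullet> z)))" for \<xi>
    unfolding T(1) by simp
  show "integrable lborel (\<lambda>\<xi>. W \<xi> * ((cos_transform f \<xi>)\<^sup>2 + (sin_transform f \<xi>)\<^sup>2))"
    unfolding e using lborel_pair.integrable_fst[OF ip] by simp
  have "(LINT \<xi>|lborel. W \<xi> * ((cos_transform f \<xi>)\<^sup>2 + (sin_transform f \<xi>)\<^sup>2))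
     = (LINT z|lborel. (LINT \<xi>|lborel. W \<xi> * (?h z * cos (\<xi> \<bullet> z))))"
    unfolding e by (rule lborel_pair.Fubini_integral[symmetric, OF ip])
  also have "\<dots> = (LINT z|lborel. ?h z * (LINT \<xi>|lborel. W \<xi> * cos (\<xi> \<bullet> z)))"
    by (intro Bochner_Integration.integral_cong refl) (simp add: mult.left_commute flip: integral_mult_right_zero)
  also have "\<dots> = (LINT z|lborel. ?h z * (s ^ DIM('a) * (sqrt (2 * pi) ^ DIM('a) * exp (- (norm (s *\<^sub>R z))\<^sup>2 / 2))))"
    unfolding W_def gaussian_cos_integral_scaled(2)[OF s] ..
  also have "\<dots> = s ^ DIM('a) * sqrt (2 * pi) ^ DIM('a) * (LINT z|lborel. ?h z * exp (- (norm (s *\<^sub>R z))\<^sup>2 / 2))"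
  proof -
    have "?h z * (s ^ DIM('a) * (sqrt (2 * pi) ^ DIM('a) * exp (- (norm (s *\<^sub>R z))\<^sup>2 / 2)))
      = s ^ DIM('a) * sqrt (2 * pi) ^ DIM('a) * (?h z * exp (- (norm (s *\<^sub>R z))\<^sup>2 / 2))" for z
      by (simp only: mult_ac)
    then show ?thesis by (simp only: integral_mult_right_zero)
  qed
  also have "(LINT z|lborel. ?h z * exp (- (norm (s *\<^sub>R z))\<^sup>2 / 2))
     = (1 / s) ^ DIM('a) * (LINT z|lborel. ?h (z /\<^sub>R s) * exp (- (norm z)\<^sup>2 / 2))"
  proof -
    have "(LINT z|lborel. ?h z * exp (- (norm (s *\<^sub>R z))\<^sup>2 / 2))
      = \<bar>1 / s\<bar> ^ DIM('a) * (LINT z|lborel. ?h (0 + (1 / s) *\<^sub>R z) * exp (- (norm (s *\<^sub>R (0 + (1 / s) *\<^sub>R z)))\<^sup>2 / 2))"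
      using s by (intro lborel_integral_affine) simp_all
    moreover have "(1 / s) *\<^sub>R z = z /\<^sub>R s" for z :: 'a by (simp add: inverse_eq_divide)
    moreover have "norm (s *\<^sub>R (0 + z /\<^sub>R s)) = norm z" for z :: 'a using s by simp
    moreover have "\<bar>1 / s\<bar> = 1 / s" using s by simp
    ultimately show ?thesis by (simp only: add_0)
  qed
  also have "s ^ DIM('a) * sqrt (2 * pi) ^ DIM('a) * ((1 / s) ^ DIM('a) * I)
      = (s ^ DIM('a) * (1 / s) ^ DIM('a)) * (sqrt (2 * pi) ^ DIM('a) * I)" for I by (simp only: mult_ac)
  also have "s ^ DIM('a) * (1 / s) ^ DIM('a) = 1"
    unfolding power_mult_distrib[symmetric] using s by simp
  finally show "(LINT \<xi>|lborel. W \<xi> * ((cos_transform f \<xi>)\<^sup>2 + (sin_transform f \<xi>)\<^sup>2))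
      = sqrt (2 * pi) ^ DIM('a) * (LINT z|lborel. autocorrelation f (z /\<^sub>R s) * exp (- (norm z)\<^sup>2 / 2))"
    by (simp only: mult_1_left)
qed

text \<open>Damping the squared transform with a Gaussian \<open>exp (- |\<xi>|\<^sup>2 / (2 (n + 1)\<^sup>2))\<close> turns its integral into an average of the
autocorrelation against a Gaussian that concentrates at \<open>0\<close>. As \<open>n\<close> grows, the average tends to the value at \<open>0\<close> by
dominated convergence, while the damped integral increases to the full one; this proves integrability as well.\<close>

theorem plancherel:
  fixes f :: "'a::euclidean_space \<Rightarrow> real"
  assumes f: "compactly_supported f"
  shows "integrable lborel (\<lambda>\<xi>. (cos_transform f \<xi>)\<^sup>2 + (sin_transform f \<xi>)\<^sup>2)"
    "(LINT \<xi>|lborel. (cos_transform f \<xi>)\<^sup>2 + (sin_transform f \<xi>)\<^sup>2) = (2 * pi) ^ DIM('a) * (LINT x|lborel. (f x)\<^sup>2)"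
proof -
  let ?h = "autocorrelation f"
  let ?C = "\<lambda>\<xi>. (cos_transform f \<xi>)\<^sup>2 + (sin_transform f \<xi>)\<^sup>2"
  define W where "W = (\<lambda>n \<xi>. exp (- (norm (\<xi>::'a))\<^sup>2 / (2 * (real (Suc n))\<^sup>2)))"
  note T = transform_square_eq[OF f]
  have G1: "integrable lborel (\<lambda>\<xi>. W n \<xi> * ?C \<xi>)" for n
    unfolding W_def by (rule gaussian_transform_square[OF f]) simp
  have G2: "(LINT \<xi>|lborel. W n \<xi> * ?C \<xi>)
      = sqrt (2 * pi) ^ DIM('a) * (LINT z|lborel. ?h (z /\<^sub>R real (Suc n)) * exp (- (norm (z::'a))\<^sup>2 / 2))" for n
    unfolding W_def by (rule gaussian_transform_square[OF f]) simp
  have hm[measurable]: "?h \<in> borel_measurable borel" using borel_measurable_integrable[OF T(2)] by simp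
  obtain B where B: "\<And>z. \<bar>?h z\<bar> \<le> B" using T(4) by blast
  have "continuous_on UNIV f" using f unfolding compactly_supported_def by blast
  then have fm[measurable]: "f \<in> borel_measurable borel" by (rule borel_measurable_continuous_onI)
  have "cos_transform f \<in> borel_measurable borel"
    unfolding cos_transform_def[abs_def]
  proof (rule lborel.borel_measurable_lebesgue_integral)
    show "(\<lambda>(\<xi>, x). f x * cos (\<xi> \<bullet> x)) \<in> borel_measurable (borel \<Otimes>\<^sub>M lborel)"
      unfolding case_prod_beta'
      by (subst measurable_cong_sets[OF sets_pair_measure_cong[OF refl sets_lborel] refl]) measurable
  qed
  moreover have "sin_transform f \<in> borel_measurable borel"
    unfolding sin_transform_def[abs_def]
  proof (rule lborel.borel_measurable_lebesgue_integral)
    show "(\<lambda>(\<xi>, x). f x * sin (\<xi> \<bullet> x)) \<in> borel_measurable (borel \<Otimes>\<^sub>M lborel)"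
      unfolding case_prod_beta'
      by (subst measurable_cong_sets[OF sets_pair_measure_cong[OF refl sets_lborel] refl]) measurable
  qed
  ultimately have Cm[measurable]: "?C \<in> borel_measurable borel" by measurable
  have "(\<lambda>n. LINT z|lborel. ?h (z /\<^sub>R real (Suc n)) * exp (- (norm (z::'a))\<^sup>2 / 2)) \<longlonglongrightarrow> (LINT z|lborel. ?h 0 * exp (- (norm (z::'a))\<^sup>2 / 2))"
  proof (rule integral_dominated_convergence[where w="\<lambda>z. B * exp (- (norm z)\<^sup>2 / 2)"])
    show "integrable lborel (\<lambda>z::'a. B * exp (- (norm z)\<^sup>2 / 2))"
    proof (rule integrable_mult_right)
      show "integrable lborel (\<lambda>z::'a. exp (- (norm z)\<^sup>2 / 2))"
        using gaussian_cos_integral(1)[of "0::'a"] by simp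
    qed
    show "AE z in lborel. (\<lambda>n. ?h (z /\<^sub>R real (Suc n)) * exp (- (norm z)\<^sup>2 / 2)) \<longlonglongrightarrow> ?h 0 * exp (- (norm z)\<^sup>2 / 2)"
    proof (intro AE_I2 tendsto_mult tendsto_const)
      fix z :: 'a
      have "isCont ?h 0" using T(3) by (simp add: isCont_def)
      moreover have "(\<lambda>n. z /\<^sub>R real (Suc n)) \<longlonglongrightarrow> 0"
        using tendsto_scaleR[OF LIMSEQ_inverse_real_of_nat tendsto_const[of z]] by simp
      ultimately show "(\<lambda>n. ?h (z /\<^sub>R real (Suc n))) \<longlonglongrightarrow> ?h 0" by (rule isCont_tendsto_compose)
    qed
    show "AE z in lborel. norm (?h (z /\<^sub>R real (Suc n)) * exp (- (norm z)\<^sup>2 / 2)) \<le> B * exp (- (norm z)\<^sup>2 / 2)" for n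
      using B by (auto simp: abs_mult mult_right_mono)
  qed auto
  also have "(LINT z|lborel. ?h 0 * exp (- (norm (z::'a))\<^sup>2 / 2)) = ?h 0 * sqrt (2 * pi) ^ DIM('a)"
  proof -
    have "(LINT z|lborel. exp (- (norm (z::'a))\<^sup>2 / 2)) = sqrt (2 * pi) ^ DIM('a)"
      using gaussian_cos_integral(2)[of "0::'a"] by simp
    then show ?thesis by (simp only: integral_mult_right_zero)
  qed
  finally have "(\<lambda>n. sqrt (2 * pi) ^ DIM('a) * (LINT z|lborel. ?h (z /\<^sub>R real (Suc n)) * exp (- (norm (z::'a))\<^sup>2 / 2))) \<longlonglongrightarrow> sqrt (2 * pi) ^ DIM('a) * (?h 0 * sqrt (2 * pi) ^ DIM('a))"
    by (rule tendsto_mult_left)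
  then have L1: "(\<lambda>n. LINT \<xi>|lborel. W n \<xi> * ?C \<xi>) \<longlonglongrightarrow> sqrt (2 * pi) ^ DIM('a) * (?h 0 * sqrt (2 * pi) ^ DIM('a))"
    unfolding G2 .
  have "sqrt (2 * pi) ^ DIM('a) * (?h 0 * sqrt (2 * pi) ^ DIM('a)) = (sqrt (2 * pi) * sqrt (2 * pi)) ^ DIM('a) * ?h 0"
    by (simp only: power_mult_distrib mult_ac)
  also have "sqrt (2 * pi) * sqrt (2 * pi) = 2 * pi" by simp
  finally have c: "sqrt (2 * pi) ^ DIM('a) * (?h 0 * sqrt (2 * pi) ^ DIM('a)) = (2 * pi) ^ DIM('a) * ?h 0" .
  have h0: "?h 0 = (LINT x|lborel. (f x)\<^sup>2)" by (simp add: autocorrelation_def power2_eq_square)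
  have L2: "(\<lambda>n. ennreal (LINT \<xi>|lborel. W n \<xi> * ?C \<xi>)) \<longlonglongrightarrow> ennreal ((2 * pi) ^ DIM('a) * (LINT x|lborel. (f x)\<^sup>2))"
    using tendsto_ennrealI[OF L1] unfolding c unfolding h0 .
  have "(\<lambda>n. \<integral>\<^sup>+\<xi>. ennreal (W n \<xi> * ?C \<xi>) \<partial>lborel) \<longlonglongrightarrow> (\<integral>\<^sup>+\<xi>. ennreal (?C \<xi>) \<partial>lborel)"
  proof (rule nn_integral_LIMSEQ)
    show "incseq (\<lambda>n \<xi>. ennreal (W n \<xi> * ?C \<xi>))"
      unfolding incseq_def le_fun_def W_def
    proof (intro allI impI ennreal_leI mult_right_mono)
      fix m n :: nat and \<xi> :: 'a assume "m \<le> n"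
      then have "(norm \<xi>)\<^sup>2 / (2 * (real (Suc n))\<^sup>2) \<le> (norm \<xi>)\<^sup>2 / (2 * (real (Suc m))\<^sup>2)"
        by (intro divide_left_mono mult_left_mono power_mono) auto
      then show "exp (- (norm \<xi>)\<^sup>2 / (2 * (real (Suc m))\<^sup>2)) \<le> exp (- (norm \<xi>)\<^sup>2 / (2 * (real (Suc n))\<^sup>2))"
        by simp
    qed simp
    fix \<xi> :: 'a
    have "(\<lambda>n. - (norm \<xi>)\<^sup>2 / 2 * (inverse (real (Suc n)))\<^sup>2) \<longlonglongrightarrow> - (norm \<xi>)\<^sup>2 / 2 * 0\<^sup>2"
      by (intro tendsto_intros LIMSEQ_inverse_real_of_nat)
    then have "(\<lambda>n. exp (- (norm \<xi>)\<^sup>2 / 2 * (inverse (real (Suc n)))\<^sup>2)) \<longlonglongrightarrow> exp (- (norm \<xi>)\<^sup>2 / 2 * 0\<^sup>2)"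
      by (rule tendsto_exp)
    moreover have "exp (- (norm \<xi>)\<^sup>2 / 2 * (inverse (real (Suc n)))\<^sup>2) = W n \<xi>" for n
    proof -
      have "- a / 2 * (inverse r)\<^sup>2 = - a / (2 * r\<^sup>2)" for a r :: real
        unfolding power_inverse divide_inverse inverse_mult_distrib by (simp only: mult.assoc)
      then show ?thesis by (simp only: W_def)
    qed
    moreover have "exp (- (norm \<xi>)\<^sup>2 / 2 * 0\<^sup>2) = 1" by simp
    ultimately have "(\<lambda>n. W n \<xi>) \<longlonglongrightarrow> 1" by (simp only:)
    then have "(\<lambda>n. W n \<xi> * ?C \<xi>) \<longlonglongrightarrow> 1 * ?C \<xi>" by (intro tendsto_mult tendsto_const)
    then show "(\<lambda>n. ennreal (W n \<xi> * ?C \<xi>)) \<longlonglongrightarrow> ennreal (?C \<xi>)" by (intro tendsto_ennrealI) simp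
  qed (auto simp: W_def)
  moreover have "(\<integral>\<^sup>+\<xi>. ennreal (W n \<xi> * ?C \<xi>) \<partial>lborel) = ennreal (LINT \<xi>|lborel. W n \<xi> * ?C \<xi>)" for n
    using G1[of n] by (intro nn_integral_eq_integral) (auto simp: W_def)
  ultimately have nn: "(\<integral>\<^sup>+\<xi>. ennreal (?C \<xi>) \<partial>lborel) = ennreal ((2 * pi) ^ DIM('a) * (LINT x|lborel. (f x)\<^sup>2))"
    using L2 LIMSEQ_unique by auto
  show "integrable lborel ?C"
    using nn by (intro integrableI_nonneg) (auto simp: top.not_eq_extremum)
  then show "(LINT \<xi>|lborel. ?C \<xi>) = (2 * pi) ^ DIM('a) * (LINT x|lborel. (f x)\<^sup>2)"
    by (subst integral_eq_nn_integral) (simp_all add: nn del: ennreal_plus)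
qed

section \<open>Derivatives of compactly supported functions\<close>

text \<open>The integral of \<open>f\<close> is invariant under translation, so difference quotients integrate to \<open>0\<close>; by the mean value
theorem they are uniformly bounded and vanish outside a fixed compact set. Every integration by parts below is
this lemma applied to a product.\<close>

lemma integral_directional_derivative_eq_0:
  fixes f :: "'a::euclidean_space \<Rightarrow> real"
  assumes d: "\<And>x. (f has_derivative f' x) (at x)"
    and c: "continuous_on UNIV (\<lambda>x. f' x n)"
    and K: "compact K" "\<And>x. x \<notin> K \<Longrightarrow> f x = 0"
  shows "(LINT x|lborel. f' x n) = 0" "integrable lborel (\<lambda>x. f' x n)" "\<And>x. x \<notin> K \<Longrightarrow> f' x n = 0"
proof -
  have cf: "continuous_on UNIV f"
    by (intro continuous_at_imp_continuous_on ballI has_derivative_continuous[OF d])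
  have [measurable]: "f \<in> borel_measurable borel" using cf by (rule borel_measurable_continuous_onI)
  have fi: "integrable lborel f" by (rule integrable_continuous_compact_support[OF cf K])
  show z: "f' x n = 0" if "x \<notin> K" for x
  proof -
    have "(f has_derivative (\<lambda>_. 0)) (at x)"
    proof (rule has_derivative_transform_within_open[where f="\<lambda>_. 0" and s="- K"])
      show "open (- K)" using compact_imp_closed[OF K(1)] by (rule open_Compl)
      show "x \<in> - K" using that by simp
      show "0 = f y" if "y \<in> - K" for y using K(2)[of y] that by simp
    qed simp
    from has_derivative_unique[OF d this] have "f' x = (\<lambda>_. 0)" .
    then show ?thesis by simp
  qed
  with c K(1) have cs: "compactly_supported (\<lambda>x. f' x n)" by (rule compactly_supportedI)
  then show "integrable lborel (\<lambda>x. f' x n)" by (rule compactly_supported_integrable)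
  obtain B where B: "0 \<le> B" "\<And>x. \<bar>f' x n\<bar> \<le> B" using compactly_supported_bounded[OF cs] by blast
  \<comment> \<open>all translates of the support by \<open>- s n\<close> with \<open>s \<in> {0..1}\<close>\<close>
  define K' where "K' = (\<lambda>p. fst p - snd p *\<^sub>R n) ` (K \<times> {0..1::real})"
  have K': "compact K'" unfolding K'_def
    by (intro compact_continuous_image compact_Times K compact_Icc continuous_intros)
  have K'2: "f (x + s *\<^sub>R n) = 0" if "x \<notin> K'" "0 \<le> s" "s \<le> 1" for x s
  proof (rule ccontr)
    assume "f (x + s *\<^sub>R n) \<noteq> 0"
    then have "x + s *\<^sub>R n \<in> K" using K by blast
    then have "x \<in> K'" unfolding K'_def using that(2,3) by (intro image_eqI[of _ _ "(x + s *\<^sub>R n, s)"]) auto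
    then show False using that by simp
  qed
  define t where "t = (\<lambda>i. 1 / real (Suc i))"
  have t: "0 < t i" "t i \<le> 1" for i by (auto simp: t_def)
  have dl: "((\<lambda>s. f (x + s *\<^sub>R n)) has_real_derivative f' (x + s *\<^sub>R n) n) (at s)" for x s
  proof -
    have "((\<lambda>s. x + s *\<^sub>R n) has_derivative (\<lambda>h. h *\<^sub>R n)) (at s)"
      by (auto intro!: derivative_eq_intros)
    from diff_chain_at[OF this d] have "((\<lambda>s. f (x + s *\<^sub>R n)) has_derivative (\<lambda>h. f' (x + s *\<^sub>R n) (h *\<^sub>R n))) (at s)"
      by (simp add: o_def)
    moreover have "(\<lambda>h. f' (x + s *\<^sub>R n) (h *\<^sub>R n)) = (*) (f' (x + s *\<^sub>R n) n)"
    proof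
      fix h show "f' (x + s *\<^sub>R n) (h *\<^sub>R n) = f' (x + s *\<^sub>R n) n * h"
        using linear_scale[OF has_derivative_linear[OF d[of "x + s *\<^sub>R n"]], of h n] by simp
    qed
    ultimately show ?thesis unfolding has_field_derivative_def by simp
  qed
  define D where "D = (\<lambda>i x. (f (x + t i *\<^sub>R n) - f x) / t i)"
  have D0: "(LINT x|lborel. D i x) = 0" for i
  proof -
    have "integrable lborel (\<lambda>x. f (x + t i *\<^sub>R n))"
    proof (rule integrable_continuous_compact_support[OF _ K'])
      show "continuous_on UNIV (\<lambda>x. f (x + t i *\<^sub>R n))"
        by (intro continuous_on_compose2[OF cf] continuous_intros) auto
      show "f (x + t i *\<^sub>R n) = 0" if "x \<notin> K'" for x using K'2[OF that] t[of i] by simp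
    qed
    moreover have "(LINT x|lborel. f x) = (LINT x|lborel. f (x + t i *\<^sub>R n))"
      using lborel_integral_affine[of f 1 "t i *\<^sub>R n"] by (simp add: add.commute)
    ultimately show ?thesis using fi by (simp add: D_def)
  qed
  have "(\<lambda>i. LINT x|lborel. D i x) \<longlonglongrightarrow> (LINT x|lborel. f' x n)"
  proof (rule integral_dominated_convergence[where w="\<lambda>x. B * indicator K' x"])
    show "integrable lborel (\<lambda>x. B * indicator K' x)"
    proof (intro integrable_mult_right integrable_real_indicator)
      show "K' \<in> sets lborel" using borel_compact[OF K'] by simp
      show "emeasure lborel K' < \<infinity>" by (rule emeasure_compact_finite[OF K'])
    qed
    show "(\<lambda>x. f' x n) \<in> borel_measurable lborel" using c by (simp add: borel_measurable_continuous_onI)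
    show "D i \<in> borel_measurable lborel" for i unfolding D_def by measurable
    show "AE x in lborel. (\<lambda>i. D i x) \<longlonglongrightarrow> f' x n"
    proof (rule AE_I2)
      fix x
      have "(\<lambda>h. (f (x + (0 + h) *\<^sub>R n) - f (x + 0 *\<^sub>R n)) / h) \<midarrow>0\<rightarrow> f' x n"
        using dl[of x 0] by (simp add: DERIV_def)
      then have "(\<lambda>h. (f (x + h *\<^sub>R n) - f x) / h) \<midarrow>0\<rightarrow> f' x n" by simp
      moreover have "filterlim t (at 0) sequentially"
      proof -
        have "t \<longlonglongrightarrow> 0" unfolding t_def using LIMSEQ_inverse_real_of_nat by (simp only: inverse_eq_divide)
        moreover have "t i \<noteq> 0" for i using t(1)[of i] by simp
        ultimately show ?thesis by (simp add: filterlim_at)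
      qed
      ultimately show "(\<lambda>i. D i x) \<longlonglongrightarrow> f' x n" unfolding D_def by (rule filterlim_compose)
    qed
    show "AE x in lborel. norm (D i x) \<le> B * indicator K' x" for i
    proof (rule AE_I2)
      fix x
      show "norm (D i x) \<le> B * indicator K' x"
      proof (cases "x \<in> K'")
        case True
        have "\<exists>z>0. z < t i \<and> f (x + t i *\<^sub>R n) - f (x + 0 *\<^sub>R n) = (t i - 0) * f' (x + z *\<^sub>R n) n"
          by (rule MVT2[OF t(1)[of i], of "\<lambda>s. f (x + s *\<^sub>R n)" "\<lambda>s. f' (x + s *\<^sub>R n) n"]) (rule dl)
        then obtain z where z: "f (x + t i *\<^sub>R n) - f (x + 0 *\<^sub>R n) = (t i - 0) * f' (x + z *\<^sub>R n) n" by blast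
        then have "D i x = f' (x + z *\<^sub>R n) n" using t(1)[of i] by (simp add: D_def)
        then show ?thesis using B True by simp
      next
        case False
        then show ?thesis using K'2[OF False, of 0] K'2[OF False, of "t i"] t[of i] by (simp add: D_def)
      qed
    qed
  qed
  then show "(LINT x|lborel. f' x n) = 0" unfolding D0 by (simp add: LIMSEQ_const_iff)
qed

definition dderiv :: "'a::euclidean_space \<Rightarrow> ('a \<Rightarrow> real) \<Rightarrow> 'a \<Rightarrow> real" where
  "dderiv n f x = frechet_derivative f (at x) n"

text \<open>Continuity is asked of the directional derivatives in all directions rather than only along the basis, because the
normals of the half-spaces are arbitrary unit vectors.\<close>

definition C1c :: "('a::euclidean_space \<Rightarrow> real) \<Rightarrow> bool" where
  "C1c f \<longleftrightarrow> (\<forall>x. f differentiable at x) \<and> (\<forall>n. continuous_on UNIV (dderiv n f)) \<and> compactly_supported f"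

lemma C1c_has_derivative: "C1c f \<Longrightarrow> (f has_derivative (\<lambda>n. dderiv n f x)) (at x)"
  unfolding C1c_def dderiv_def by (simp add: frechet_derivative_works[symmetric])

lemma dderiv_eqI: "(f has_derivative f') (at x) \<Longrightarrow> dderiv n f x = f' n"
  unfolding dderiv_def by (simp only: frechet_derivative_at[symmetric])

lemma C1c_compactly_supported:
  assumes "C1c f"
  shows "compactly_supported f" "compactly_supported (dderiv n f)" "(LINT x|lborel. dderiv n f x) = 0"
proof -
  show cs: "compactly_supported f" using assms by (simp add: C1c_def)
  then obtain K where K: "compact K" "\<And>x. x \<notin> K \<Longrightarrow> f x = 0" unfolding compactly_supported_def by blast
  have c: "continuous_on UNIV (dderiv n f)" using assms by (simp add: C1c_def)
  note I = integral_directional_derivative_eq_0[OF C1c_has_derivative[OF assms] c K]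
  show "compactly_supported (dderiv n f)" using c K(1) I(3) by (rule compactly_supportedI)
  show "(LINT x|lborel. dderiv n f x) = 0" using I(1) .
qed

lemma C1c_continuous: "C1c f \<Longrightarrow> continuous_on UNIV f" "C1c f \<Longrightarrow> continuous_on UNIV (dderiv n f)"
  by (auto simp: C1c_def compactly_supported_def)

lemma C1c_mult:
  assumes f: "C1c f" and g: "\<And>x. (g has_derivative g' x) (at x)" "\<And>n. continuous_on UNIV (\<lambda>x. g' x n)"
  shows "C1c (\<lambda>x. f x * g x)" "dderiv n (\<lambda>x. f x * g x) x = f x * g' x n + dderiv n f x * g x"
proof -
  have d: "((\<lambda>x. f x * g x) has_derivative (\<lambda>n. f x * g' x n + dderiv n f x * g x)) (at x)" for x
    by (rule has_derivative_mult[OF C1c_has_derivative[OF f] g(1)])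
  then show e: "dderiv n (\<lambda>x. f x * g x) x = f x * g' x n + dderiv n f x * g x" for n x
    by (rule dderiv_eqI)
  have gc: "continuous_on UNIV g" by (intro continuous_at_imp_continuous_on ballI has_derivative_continuous[OF g(1)])
  show "C1c (\<lambda>x. f x * g x)"
    unfolding C1c_def
  proof (intro conjI allI)
    show "(\<lambda>x. f x * g x) differentiable at x" for x by (rule differentiableI[OF d])
    show "continuous_on UNIV (dderiv n (\<lambda>x. f x * g x))" for n
      unfolding e[abs_def] using C1c_continuous[OF f] gc g(2) by (intro continuous_intros)
    show "compactly_supported (\<lambda>x. f x * g x)"
      by (rule compactly_supported_mult[OF C1c_compactly_supported(1)[OF f] gc])
  qed
qed

lemma C1c_add:
  assumes f: "C1c f" and g: "C1c g"
  shows "C1c (\<lambda>x. f x + g x)" "dderiv n (\<lambda>x. f x + g x) x = dderiv n f x + dderiv n g x"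
proof -
  have d: "((\<lambda>x. f x + g x) has_derivative (\<lambda>n. dderiv n f x + dderiv n g x)) (at x)" for x
    by (rule has_derivative_add[OF C1c_has_derivative[OF f] C1c_has_derivative[OF g]])
  then show e: "dderiv n (\<lambda>x. f x + g x) x = dderiv n f x + dderiv n g x" for n x
    by (rule dderiv_eqI)
  show "C1c (\<lambda>x. f x + g x)"
    unfolding C1c_def
  proof (intro conjI allI)
    show "(\<lambda>x. f x + g x) differentiable at x" for x by (rule differentiableI[OF d])
    show "continuous_on UNIV (dderiv n (\<lambda>x. f x + g x))" for n
      unfolding e[abs_def] using C1c_continuous[OF f] C1c_continuous[OF g] by (intro continuous_intros)
    show "compactly_supported (\<lambda>x. f x + g x)"
      by (intro compactly_supported_add C1c_compactly_supported f g)
  qed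
qed

lemma C1c_cmult:
  assumes f: "C1c f"
  shows "C1c (\<lambda>x. c * f x)" "dderiv n (\<lambda>x. c * f x) x = c * dderiv n f x"
  using C1c_mult[OF f has_derivative_const[of c] continuous_on_const] by (simp_all add: mult.commute)

lemma dderiv_zero: "dderiv n (\<lambda>x. 0) x = 0"
  by (rule dderiv_eqI[OF has_derivative_const])

lemma C1c_zero: "C1c (\<lambda>x. 0)"
  unfolding C1c_def dderiv_zero[abs_def]
  by (auto intro: compactly_supportedI[of _ "{}"])

lemma C1c_sum:
  assumes "\<And>i. i \<in> I \<Longrightarrow> C1c (f i)" "finite I"
  shows "C1c (\<lambda>x. \<Sum>i\<in>I. c i * f i x)" "dderiv n (\<lambda>x. \<Sum>i\<in>I. c i * f i x) x = (\<Sum>i\<in>I. c i * dderiv n (f i) x)"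
proof -
  have "C1c (\<lambda>x. \<Sum>i\<in>I. c i * f i x) \<and> (\<forall>x. dderiv n (\<lambda>x. \<Sum>i\<in>I. c i * f i x) x = (\<Sum>i\<in>I. c i * dderiv n (f i) x))"
    using assms(2,1)
  proof (induction I)
    case (insert i I)
    have fi: "C1c (f i)" using insert.prems by simp
    have IH: "C1c (\<lambda>x. \<Sum>i\<in>I. c i * f i x)" "\<And>x. dderiv n (\<lambda>x. \<Sum>i\<in>I. c i * f i x) x = (\<Sum>i\<in>I. c i * dderiv n (f i) x)"
      using insert.IH insert.prems by simp_all
    note A = C1c_add[OF C1c_cmult(1)[OF fi, of "c i"] IH(1)]
    show ?case using A(1) insert.hyps by (simp add: A(2) C1c_cmult(2)[OF fi] IH(2))
  qed (simp add: C1c_zero dderiv_zero)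
  then show "C1c (\<lambda>x. \<Sum>i\<in>I. c i * f i x)" "dderiv n (\<lambda>x. \<Sum>i\<in>I. c i * f i x) x = (\<Sum>i\<in>I. c i * dderiv n (f i) x)"
    by auto
qed

lemma transform_dderiv:
  assumes f: "C1c f"
  shows "cos_transform (dderiv n f) \<xi> = (n \<bullet> \<xi>) * sin_transform f \<xi>"
    "sin_transform (dderiv n f) \<xi> = - (n \<bullet> \<xi>) * cos_transform f \<xi>"
proof -
  have 1: "((\<lambda>x. cos (\<xi> \<bullet> x)) has_derivative (\<lambda>n. - sin (\<xi> \<bullet> x) * (\<xi> \<bullet> n))) (at x)" for x
    by (auto intro!: derivative_eq_intros)
  have 2: "((\<lambda>x. sin (\<xi> \<bullet> x)) has_derivative (\<lambda>n. cos (\<xi> \<bullet> x) * (\<xi> \<bullet> n))) (at x)" for x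
    by (auto intro!: derivative_eq_intros)
  have c1: "continuous_on UNIV (\<lambda>x. - sin (\<xi> \<bullet> x) * (\<xi> \<bullet> n))" for n by (intro continuous_intros)
  have c2: "continuous_on UNIV (\<lambda>x. cos (\<xi> \<bullet> x) * (\<xi> \<bullet> n))" for n by (intro continuous_intros)
  note M1 = C1c_mult[OF f 1 c1] and M2 = C1c_mult[OF f 2 c2]
  have i: "integrable lborel (\<lambda>x. f x * sin (\<xi> \<bullet> x))" "integrable lborel (\<lambda>x. f x * cos (\<xi> \<bullet> x))"
    "integrable lborel (\<lambda>x. dderiv n f x * sin (\<xi> \<bullet> x))" "integrable lborel (\<lambda>x. dderiv n f x * cos (\<xi> \<bullet> x))"
    by (intro compactly_supported_integrable compactly_supported_mult C1c_compactly_supported f continuous_intros)+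
  have "0 = (LINT x|lborel. f x * (- sin (\<xi> \<bullet> x) * (\<xi> \<bullet> n)) + dderiv n f x * cos (\<xi> \<bullet> x))"
    using C1c_compactly_supported(3)[OF M1(1), of n] unfolding M1(2) by simp
  also have "\<dots> = (LINT x|lborel. - (\<xi> \<bullet> n) * (f x * sin (\<xi> \<bullet> x)) + dderiv n f x * cos (\<xi> \<bullet> x))"
    by (simp add: mult_ac)
  also have "\<dots> = - (\<xi> \<bullet> n) * sin_transform f \<xi> + cos_transform (dderiv n f) \<xi>"
    using i by (subst Bochner_Integration.integral_add) (auto simp: sin_transform_def cos_transform_def)
  finally show "cos_transform (dderiv n f) \<xi> = (n \<bullet> \<xi>) * sin_transform f \<xi>" by (simp add: inner_commute)
  have "0 = (LINT x|lborel. f x * (cos (\<xi> \<bullet> x) * (\<xi> \<bullet> n)) + dderiv n f x * sin (\<xi> \<bullet> x))"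
    using C1c_compactly_supported(3)[OF M2(1), of n] unfolding M2(2) by simp
  also have "\<dots> = (LINT x|lborel. (\<xi> \<bullet> n) * (f x * cos (\<xi> \<bullet> x)) + dderiv n f x * sin (\<xi> \<bullet> x))"
    by (simp add: mult_ac)
  also have "\<dots> = (\<xi> \<bullet> n) * cos_transform f \<xi> + sin_transform (dderiv n f) \<xi>"
    using i by (subst Bochner_Integration.integral_add) (auto simp: sin_transform_def cos_transform_def)
  finally show "sin_transform (dderiv n f) \<xi> = - (n \<bullet> \<xi>) * cos_transform f \<xi>" by (simp add: inner_commute)
qed

lemma plancherel_dderiv:
  fixes f :: "'a::euclidean_space \<Rightarrow> real"
  assumes f: "C1c f"
  shows "integrable lborel (\<lambda>\<xi>. (n \<bullet> \<xi>)\<^sup>2 * ((cos_transform f \<xi>)\<^sup>2 + (sin_transform f \<xi>)\<^sup>2))"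
    "(LINT \<xi>|lborel. (n \<bullet> \<xi>)\<^sup>2 * ((cos_transform f \<xi>)\<^sup>2 + (sin_transform f \<xi>)\<^sup>2)) = (2 * pi) ^ DIM('a) * (LINT x|lborel. (dderiv n f x)\<^sup>2)"
proof -
  have "(n \<bullet> \<xi>)\<^sup>2 * ((cos_transform f \<xi>)\<^sup>2 + (sin_transform f \<xi>)\<^sup>2) = (cos_transform (dderiv n f) \<xi>)\<^sup>2 + (sin_transform (dderiv n f) \<xi>)\<^sup>2" for \<xi>
    unfolding transform_dderiv[OF f] by (simp add: algebra_simps power_mult_distrib)
  then show "integrable lborel (\<lambda>\<xi>. (n \<bullet> \<xi>)\<^sup>2 * ((cos_transform f \<xi>)\<^sup>2 + (sin_transform f \<xi>)\<^sup>2))"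
    "(LINT \<xi>|lborel. (n \<bullet> \<xi>)\<^sup>2 * ((cos_transform f \<xi>)\<^sup>2 + (sin_transform f \<xi>)\<^sup>2)) = (2 * pi) ^ DIM('a) * (LINT x|lborel. (dderiv n f x)\<^sup>2)"
    using plancherel[OF C1c_compactly_supported(2)[OF f]] by simp_all
qed

text \<open>Polarization of Plancherel's identity.\<close>

lemma plancherel_inner:
  fixes f g :: "'a::euclidean_space \<Rightarrow> real"
  assumes f: "compactly_supported f" and g: "compactly_supported g"
  shows "integrable lborel (\<lambda>\<xi>. cos_transform f \<xi> * cos_transform g \<xi> + sin_transform f \<xi> * sin_transform g \<xi>)"
    "(LINT \<xi>|lborel. cos_transform f \<xi> * cos_transform g \<xi> + sin_transform f \<xi> * sin_transform g \<xi>) = (2 * pi) ^ DIM('a) * (LINT x|lborel. f x * g x)"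
proof -
  let ?h = "\<lambda>x. f x + g x"
  let ?C = "\<lambda>f \<xi>. (cos_transform f \<xi>)\<^sup>2 + (sin_transform f \<xi>)\<^sup>2"
  have h: "compactly_supported ?h" using f g by (rule compactly_supported_add)
  have tr: "cos_transform ?h \<xi> = cos_transform f \<xi> + cos_transform g \<xi>" "sin_transform ?h \<xi> = sin_transform f \<xi> + sin_transform g \<xi>" for \<xi>
  proof -
    have i: "integrable lborel (\<lambda>x. k x * sin (\<xi> \<bullet> x))" "integrable lborel (\<lambda>x. k x * cos (\<xi> \<bullet> x))" if "compactly_supported k" for k
      by (intro compactly_supported_integrable compactly_supported_mult that continuous_intros)+
    show "cos_transform ?h \<xi> = cos_transform f \<xi> + cos_transform g \<xi>" "sin_transform ?h \<xi> = sin_transform f \<xi> + sin_transform g \<xi>"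
      using i[OF f] i[OF g] by (simp_all add: cos_transform_def sin_transform_def distrib_right)
  qed
  have sq: "integrable lborel (\<lambda>x. (k x)\<^sup>2)" if "compactly_supported k" for k :: "'a \<Rightarrow> real"
    unfolding power2_eq_square using that
    by (intro compactly_supported_integrable compactly_supported_mult) (auto simp: compactly_supported_def)
  have fg: "integrable lborel (\<lambda>x. f x * g x)"
    using f g by (intro compactly_supported_integrable compactly_supported_mult) (auto simp: compactly_supported_def)
  have e: "cos_transform f \<xi> * cos_transform g \<xi> + sin_transform f \<xi> * sin_transform g \<xi> = (?C ?h \<xi> - ?C f \<xi> - ?C g \<xi>) / 2" for \<xi>
    unfolding tr by (simp add: power2_eq_square algebra_simps)
  note P = plancherel[OF f] plancherel[OF g] plancherel[OF h]
  show "integrable lborel (\<lambda>\<xi>. cos_transform f \<xi> * cos_transform g \<xi> + sin_transform f \<xi> * sin_transform g \<xi>)"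
    unfolding e by (intro Bochner_Integration.integrable_diff integrable_divide P)
  have "(LINT \<xi>|lborel. (?C ?h \<xi> - ?C f \<xi> - ?C g \<xi>) / 2) = ((LINT \<xi>|lborel. ?C ?h \<xi>) - (LINT \<xi>|lborel. ?C f \<xi>) - (LINT \<xi>|lborel. ?C g \<xi>)) / 2"
    using P(1,3,5) by (simp only: integral_divide_zero Bochner_Integration.integral_diff Bochner_Integration.integrable_diff)
  also have "\<dots> = (2 * pi) ^ DIM('a) * (((LINT x|lborel. (?h x)\<^sup>2) - (LINT x|lborel. (f x)\<^sup>2) - (LINT x|lborel. (g x)\<^sup>2)) / 2)"
    unfolding P(2,4,6) by (simp add: algebra_simps)
  also have "(LINT x|lborel. (?h x)\<^sup>2) = (LINT x|lborel. (f x)\<^sup>2 + (g x)\<^sup>2 + 2 * (f x * g x))"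
    by (simp add: power2_sum mult.assoc)
  also have "\<dots> = (LINT x|lborel. (f x)\<^sup>2) + (LINT x|lborel. (g x)\<^sup>2) + 2 * (LINT x|lborel. f x * g x)"
    using sq[OF f] sq[OF g] fg by simp
  finally show "(LINT \<xi>|lborel. cos_transform f \<xi> * cos_transform g \<xi> + sin_transform f \<xi> * sin_transform g \<xi>) = (2 * pi) ^ DIM('a) * (LINT x|lborel. f x * g x)"
    unfolding e by simp
qed

section \<open>Integration by parts against barriers\<close>

lemma has_real_derivative_pos_part_square:
  "((\<lambda>z::real. (max 0 z)\<^sup>2) has_real_derivative 2 * max 0 z) (at z)"
proof -
  consider "z > 0" | "z < 0" | "z = 0" by linarith
  then show ?thesis
  proof cases
    case 1
    have "((\<lambda>z::real. z\<^sup>2) has_real_derivative 2 * z) (at z)" by (auto intro!: derivative_eq_intros)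
    then have "((\<lambda>z::real. (max 0 z)\<^sup>2) has_real_derivative 2 * z) (at z)"
      by (rule has_field_derivative_transform_within_open[where S="{0<..}"]) (use 1 in auto)
    then show ?thesis using 1 by simp
  next
    case 2
    have "((\<lambda>z::real. 0) has_real_derivative 0) (at z)" by simp
    then have "((\<lambda>z::real. (max 0 z)\<^sup>2) has_real_derivative 0) (at z)"
      by (rule has_field_derivative_transform_within_open[where S="{..<0}"]) (use 2 in auto)
    then show ?thesis using 2 by simp
  next
    case 3
    have "(\<lambda>h::real. ((max 0 (0 + h))\<^sup>2 - (max 0 0)\<^sup>2) / h) \<midarrow>0\<rightarrow> 0"
    proof (rule Lim_null_comparison[where g="\<lambda>h. \<bar>h\<bar>"])
      show "\<forall>\<^sub>F h in at 0. norm (((max 0 (0 + h))\<^sup>2 - (max 0 0)\<^sup>2) / h) \<le> \<bar>h\<bar>"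
        by (intro always_eventually allI) (auto simp: max_def power2_eq_square)
      show "((\<lambda>h::real. \<bar>h\<bar>) \<longlongrightarrow> 0) (at 0)" by (rule tendsto_rabs_zero) (rule tendsto_ident_at)
    qed
    then show ?thesis using 3 by (simp add: DERIV_def)
  qed
qed

text \<open>As a function of the distance \<open>l = t - \<nu> \<bullet> x\<close> to the bounding hyperplane of the half-space \<open>p = (\<nu>, t)\<close>, the barrier
is the antiderivative (up to sign) of the cut-off \<open>max 0 (1 - l / (2 R))\<close>; this cut-off is \<open>barrier'\<close>. The constant
\<open>R / 2\<close> is subtracted to centre the range \<open>{0..R}\<close>, so that the barrier has the smallest possible supremum norm.\<close>

definition barrier :: "real \<Rightarrow> 'a::euclidean_space \<times> real \<Rightarrow> 'a \<Rightarrow> real" where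
  "barrier R p x = (max 0 (2 * R - (snd p - fst p \<bullet> x)))\<^sup>2 / (4 * R) - R / 2"

definition barrier' :: "real \<Rightarrow> 'a::euclidean_space \<times> real \<Rightarrow> 'a \<Rightarrow> real" where
  "barrier' R p x = max 0 (2 * R - (snd p - fst p \<bullet> x)) / (2 * R)"

lemma barrier_has_derivative:
  "R > 0 \<Longrightarrow> (barrier R p has_derivative (\<lambda>n. barrier' R p x * (fst p \<bullet> n))) (at x)"
proof -
  assume R: "R > 0"
  have 1: "((\<lambda>x. 2 * R - (snd p - fst p \<bullet> x)) has_derivative (\<lambda>n. fst p \<bullet> n)) (at x)"
    by (auto intro!: derivative_eq_intros)
  have "((\<lambda>x. (max 0 (2 * R - (snd p - fst p \<bullet> x)))\<^sup>2) has_derivative (\<lambda>n. 2 * max 0 (2 * R - (snd p - fst p \<bullet> x)) * (fst p \<bullet> n))) (at x)"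
    using diff_chain_at[OF 1 has_real_derivative_pos_part_square[THEN has_field_derivative_imp_has_derivative]]
    by (simp add: o_def)
  then have "((\<lambda>x. (max 0 (2 * R - (snd p - fst p \<bullet> x)))\<^sup>2 / (4 * R) - R / 2) has_derivative (\<lambda>n. 2 * max 0 (2 * R - (snd p - fst p \<bullet> x)) * (fst p \<bullet> n) / (4 * R) - 0)) (at x)"
    unfolding divide_inverse by (intro has_derivative_diff has_derivative_mult_left has_derivative_const)
  moreover have "(\<lambda>n. 2 * max 0 (2 * R - (snd p - fst p \<bullet> x)) * (fst p \<bullet> n) / (4 * R) - 0) = (\<lambda>n. barrier' R p x * (fst p \<bullet> n))"
    using R by (simp add: fun_eq_iff barrier'_def field_simps)
  ultimately show ?thesis unfolding barrier_def[abs_def] by simp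
qed

lemma barrier_bounds:
  assumes "R > 0" "fst p \<bullet> x \<le> snd p"
  shows "\<bar>barrier R p x\<bar> \<le> R / 2" "barrier' R p x \<le> 1" "1 - (snd p - fst p \<bullet> x) / (2 * R) \<le> barrier' R p x"
proof -
  define m where "m = max 0 (2 * R - (snd p - fst p \<bullet> x))"
  have m: "0 \<le> m" "m \<le> 2 * R" "2 * R - (snd p - fst p \<bullet> x) \<le> m" using assms by (auto simp: m_def)
  have "m\<^sup>2 \<le> (2 * R)\<^sup>2" using m by (intro power_mono)
  then have "m\<^sup>2 / (4 * R) \<le> R" using assms(1) by (simp add: field_simps power2_eq_square)
  moreover have "0 \<le> m\<^sup>2 / (4 * R)" using assms(1) by simp
  ultimately show "\<bar>barrier R p x\<bar> \<le> R / 2" unfolding barrier_def m_def[symmetric] abs_le_iff by linarith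
  show "barrier' R p x \<le> 1" unfolding barrier'_def m_def[symmetric] using m assms(1) by simp
  have "1 - (snd p - fst p \<bullet> x) / (2 * R) = (2 * R - (snd p - fst p \<bullet> x)) / (2 * R)" using assms(1) by (simp add: field_simps)
  also have "\<dots> \<le> m / (2 * R)" using m assms(1) by (intro divide_right_mono) auto
  finally show "1 - (snd p - fst p \<bullet> x) / (2 * R) \<le> barrier' R p x" unfolding barrier'_def m_def[symmetric] .
qed

lemma continuous_barrier:
  "R > 0 \<Longrightarrow> continuous_on UNIV (barrier R p)" "R > 0 \<Longrightarrow> continuous_on UNIV (barrier' R p)"
  unfolding barrier_def[abs_def] barrier'_def[abs_def] by (intro continuous_intros; simp)+

text \<open>The weighted distances \<open>\<Sum>p\<in>I. c p * (snd p - fst p \<bullet> x)\<close> to the bounding hyperplanes are equal to \<open>R\<close> for every \<open>x\<close>.\<close>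

locale balanced_halfspaces =
  fixes \<Omega> :: "'a::euclidean_space set" and I :: "('a \<times> real) set" and c :: "'a \<times> real \<Rightarrow> real" and R :: real
  assumes open_Omega: "open \<Omega>" and bounded_Omega: "bounded \<Omega>" and R_pos: "0 < R"
    and c_nonneg: "\<And>p. p \<in> I \<Longrightarrow> 0 \<le> c p"
    and unit_normal: "\<And>p. p \<in> I \<Longrightarrow> norm (fst p) = 1"
    and halfspace: "\<And>p x. p \<in> I \<Longrightarrow> x \<in> \<Omega> \<Longrightarrow> fst p \<bullet> x \<le> snd p"
    and c_sum: "sum c I = 1" and balanced: "(\<Sum>p\<in>I. c p *\<^sub>R fst p) = 0" and c_offset: "(\<Sum>p\<in>I. c p * snd p) = R"
begin

definition H :: "'a \<Rightarrow> real" where "H x = (\<Sum>p\<in>I. c p * barrier' R p x)"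

text \<open>The cut-off \<open>max 0 (1 - l / (2 R))\<close> lies above the line \<open>1 - l / (2 R)\<close>. Averaged with the weights \<open>c\<close>, the line takes
the constant value \<open>1 - R / (2 R)\<close>.\<close>

lemma H_bounds: assumes "x \<in> \<Omega>" shows "1 / 2 \<le> H x" "H x \<le> 1"
proof -
  have "(\<Sum>p\<in>I. c p * (fst p \<bullet> x)) = (\<Sum>p\<in>I. c p *\<^sub>R fst p) \<bullet> x" by (simp add: inner_sum_left)
  then have z: "(\<Sum>p\<in>I. c p * (fst p \<bullet> x)) = 0" by (simp add: balanced)
  have "1 / 2 = (\<Sum>p\<in>I. c p) - ((\<Sum>p\<in>I. c p * snd p) - (\<Sum>p\<in>I. c p * (fst p \<bullet> x))) / (2 * R)"
    using R_pos by (simp add: z c_sum c_offset)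
  also have "\<dots> = (\<Sum>p\<in>I. c p * (1 - (snd p - fst p \<bullet> x) / (2 * R)))"
    by (simp add: right_diff_distrib sum_subtractf flip: sum_divide_distrib)
  also have "\<dots> \<le> H x" unfolding H_def
    using barrier_bounds(3)[OF R_pos halfspace] assms c_nonneg by (intro sum_mono mult_left_mono) auto
  finally show "1 / 2 \<le> H x" .
  have "H x \<le> (\<Sum>p\<in>I. c p * 1)" unfolding H_def
    using barrier_bounds(2)[OF R_pos halfspace] assms c_nonneg by (intro sum_mono mult_left_mono) auto
  then show "H x \<le> 1" by (simp add: c_sum)
qed

lemma continuous_H: "continuous_on UNIV H"
  unfolding H_def[abs_def] by (intro continuous_intros continuous_barrier R_pos)

text \<open>Each summand of \<open>H\<close> is the derivative of a barrier along its normal. Moving this derivative to \<open>\<psi>\<close> costs at most the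
supremum \<open>R / 2\<close> of the barrier. The barrier is controlled only inside the half-space, hence on \<open>\<Omega>\<close>, so
the derivatives of \<open>\<psi>\<close> must vanish outside \<open>\<Omega>\<close>.\<close>

lemma integral_H_le:
  assumes psi: "C1c \<psi>" and d0: "\<And>p x. p \<in> I \<Longrightarrow> x \<notin> \<Omega> \<Longrightarrow> dderiv (fst p) \<psi> x = 0"
    and B: "\<And>p x. p \<in> I \<Longrightarrow> x \<in> \<Omega> \<Longrightarrow> R / 2 * \<bar>dderiv (fst p) \<psi> x\<bar> \<le> B p x"
    and Bi: "\<And>p. p \<in> I \<Longrightarrow> integrable lborel (\<lambda>x. indicator \<Omega> x * B p x)"
  shows "(LINT x|lborel. \<psi> x * H x) \<le> (\<Sum>p\<in>I. c p * (LINT x|lborel. indicator \<Omega> x * B p x))"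
proof -
  have i1: "integrable lborel (\<lambda>x. \<psi> x * barrier' R p x)" for p
    by (intro compactly_supported_integrable compactly_supported_mult C1c_compactly_supported psi continuous_barrier R_pos)
  have i2: "integrable lborel (\<lambda>x. dderiv n \<psi> x * barrier R p x)" for p n
    by (intro compactly_supported_integrable compactly_supported_mult C1c_compactly_supported psi continuous_barrier R_pos)
  have "(LINT x|lborel. \<psi> x * H x) = (LINT x|lborel. (\<Sum>p\<in>I. c p * (\<psi> x * barrier' R p x)))"
    unfolding H_def by (simp add: sum_distrib_left mult.left_commute)
  also have "\<dots> = (\<Sum>p\<in>I. c p * (LINT x|lborel. \<psi> x * barrier' R p x))"
    using i1 by (subst Bochner_Integration.integral_sum) auto
  also have "\<dots> \<le> (\<Sum>p\<in>I. c p * (LINT x|lborel. indicator \<Omega> x * B p x))"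
  proof (intro sum_mono mult_left_mono c_nonneg)
    fix p assume p: "p \<in> I"
    have nn: "fst p \<bullet> fst p = 1" using unit_normal[OF p] by (simp add: norm_eq_1)
    have cb: "continuous_on UNIV (\<lambda>x. barrier' R p x * (fst p \<bullet> n))" for n
      by (intro continuous_intros continuous_barrier R_pos)
    note M = C1c_mult[OF psi barrier_has_derivative[OF R_pos, of p] cb]
    have "0 = (LINT x|lborel. \<psi> x * barrier' R p x + dderiv (fst p) \<psi> x * barrier R p x)"
      using C1c_compactly_supported(3)[OF M(1), of "fst p"] unfolding M(2) by (simp add: nn)
    also have "\<dots> = (LINT x|lborel. \<psi> x * barrier' R p x) + (LINT x|lborel. dderiv (fst p) \<psi> x * barrier R p x)"
      using i1 i2 by (rule Bochner_Integration.integral_add)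
    finally have "(LINT x|lborel. \<psi> x * barrier' R p x) = (LINT x|lborel. - (dderiv (fst p) \<psi> x * barrier R p x))"
      by simp
    also have "\<dots> \<le> (LINT x|lborel. indicator \<Omega> x * B p x)"
    proof (rule integral_mono)
      show "integrable lborel (\<lambda>x. - (dderiv (fst p) \<psi> x * barrier R p x))" using i2 by simp
      show "integrable lborel (\<lambda>x. indicator \<Omega> x * B p x)" using Bi[OF p] .
      fix x
      show "- (dderiv (fst p) \<psi> x * barrier R p x) \<le> indicator \<Omega> x * B p x"
      proof (cases "x \<in> \<Omega>")
        case True
        have "- (dderiv (fst p) \<psi> x * barrier R p x) \<le> \<bar>dderiv (fst p) \<psi> x\<bar> * \<bar>barrier R p x\<bar>"
          by (metis abs_ge_minus_self abs_mult)
        also have "\<dots> \<le> \<bar>dderiv (fst p) \<psi> x\<bar> * (R / 2)"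
          using barrier_bounds(1)[OF R_pos halfspace[OF p True]] by (intro mult_left_mono) auto
        also have "\<dots> \<le> B p x" using B[OF p True] by (simp add: mult.commute)
        finally show ?thesis using True by simp
      qed (simp add: d0[OF p])
    qed
    finally show "(LINT x|lborel. \<psi> x * barrier' R p x) \<le> (LINT x|lborel. indicator \<Omega> x * B p x)" .
  qed
  finally show ?thesis .
qed

end

section \<open>Plane waves and orthonormal families\<close>

lemma integral_double_sum:
  fixes g :: "nat \<Rightarrow> nat \<Rightarrow> 'b \<Rightarrow> real"
  assumes "\<And>i j. i < N \<Longrightarrow> j < N \<Longrightarrow> integrable M (g i j)"
  shows "(LINT x|M. (\<Sum>i<N. \<Sum>j<N. b i j * g i j x)) = (\<Sum>i<N. \<Sum>j<N. b i j * (LINT x|M. g i j x))"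
proof -
  have "(LINT x|M. (\<Sum>i<N. \<Sum>j<N. b i j * g i j x)) = (\<Sum>i<N. LINT x|M. (\<Sum>j<N. b i j * g i j x))"
    by (intro Bochner_Integration.integral_sum Bochner_Integration.integrable_sum integrable_mult_right assms) auto
  also have "\<dots> = (\<Sum>i<N. \<Sum>j<N. LINT x|M. b i j * g i j x)"
    by (intro sum.cong refl Bochner_Integration.integral_sum integrable_mult_right assms) auto
  finally show ?thesis by (simp only: integral_mult_right_zero)
qed

locale orthonormal_family =
  fixes \<Omega> :: "'a::euclidean_space set" and \<phi> :: "nat \<Rightarrow> 'a \<Rightarrow> real" and N :: nat
  assumes Omega: "open \<Omega>" "bounded \<Omega>"
    and C1c: "\<And>j. j < N \<Longrightarrow> C1c (\<phi> j)"
    and zero_outside: "\<And>j x. j < N \<Longrightarrow> x \<notin> \<Omega> \<Longrightarrow> \<phi> j x = 0" "\<And>j n x. j < N \<Longrightarrow> x \<notin> \<Omega> \<Longrightarrow> dderiv n (\<phi> j) x = 0"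
    and orthonormal: "\<And>i j. i < N \<Longrightarrow> j < N \<Longrightarrow> (LINT x|lborel. \<phi> i x * \<phi> j x) = (if i = j then 1 else 0)"
begin

definition vol :: real where "vol = measure lborel \<Omega>"
definition energy :: "'a \<Rightarrow> real" where "energy n = (\<Sum>j<N. LINT x|lborel. (dderiv n (\<phi> j) x)\<^sup>2)"

text \<open>\<open>wc \<xi> + i ws \<xi>\<close> is the orthogonal projection \<open>w\<close> of the plane wave \<open>exp (i \<xi>\<cdot>x)\<close> on the span of the \<open>\<phi> j\<close>, \<open>F \<xi>\<close> is the
squared norm of \<open>w\<close>, and \<open>P n \<xi>\<close> is the squared norm of its derivative in the direction \<open>n\<close>. Real and imaginary parts
are kept apart so that all functions are real-valued.\<close>

definition F :: "'a \<Rightarrow> real" where "F \<xi> = (\<Sum>j<N. (cos_transform (\<phi> j) \<xi>)\<^sup>2 + (sin_transform (\<phi> j) \<xi>)\<^sup>2)"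
definition wc :: "'a \<Rightarrow> 'a \<Rightarrow> real" where "wc \<xi> x = (\<Sum>j<N. cos_transform (\<phi> j) \<xi> * \<phi> j x)"
definition ws :: "'a \<Rightarrow> 'a \<Rightarrow> real" where "ws \<xi> x = (\<Sum>j<N. sin_transform (\<phi> j) \<xi> * \<phi> j x)"
definition P :: "'a \<Rightarrow> 'a \<Rightarrow> real" where
  "P n \<xi> = (LINT x|lborel. (dderiv n (wc \<xi>) x)\<^sup>2 + (dderiv n (ws \<xi>) x)\<^sup>2)"

lemma C1c_w: "C1c (wc \<xi>)" "C1c (ws \<xi>)"
  "dderiv n (wc \<xi>) x = (\<Sum>j<N. cos_transform (\<phi> j) \<xi> * dderiv n (\<phi> j) x)"
  "dderiv n (ws \<xi>) x = (\<Sum>j<N. sin_transform (\<phi> j) \<xi> * dderiv n (\<phi> j) x)"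
  unfolding wc_def[abs_def] ws_def[abs_def] using C1c by (auto intro!: C1c_sum)

lemma w_outside: "x \<notin> \<Omega> \<Longrightarrow> wc \<xi> x = 0" "x \<notin> \<Omega> \<Longrightarrow> ws \<xi> x = 0"
  "x \<notin> \<Omega> \<Longrightarrow> dderiv n (wc \<xi>) x = 0" "x \<notin> \<Omega> \<Longrightarrow> dderiv n (ws \<xi>) x = 0"
  by (auto simp: wc_def ws_def C1c_w zero_outside)

lemma int_mult: "compactly_supported f \<Longrightarrow> compactly_supported g \<Longrightarrow> integrable lborel (\<lambda>x. f x * g x)"
  by (intro compactly_supported_integrable compactly_supported_mult) (auto simp: compactly_supported_def)

lemma int_phi: "i < N \<Longrightarrow> j < N \<Longrightarrow> integrable lborel (\<lambda>x. \<phi> i x * \<phi> j x)"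
  by (intro int_mult C1c_compactly_supported C1c)

lemma int_dphi: "i < N \<Longrightarrow> j < N \<Longrightarrow> integrable lborel (\<lambda>x. dderiv n (\<phi> i) x * dderiv n (\<phi> j) x)"
  by (intro int_mult C1c_compactly_supported C1c)

lemma square_of_sum: "(\<Sum>i<N. a i * f i)\<^sup>2 = (\<Sum>i<N. \<Sum>j<N. a i * a j * (f i * f j))" for a f :: "nat \<Rightarrow> real"
  unfolding power2_eq_square sum_product by (simp only: mult_ac)

lemma integral_square_combination:
  "(LINT x|lborel. (\<Sum>j<N. a j * \<phi> j x)\<^sup>2) = (\<Sum>j<N. (a j)\<^sup>2)"
  "(LINT x|lborel. (\<Sum>j<N. a j * dderiv n (\<phi> j) x)\<^sup>2) = (\<Sum>i<N. \<Sum>j<N. a i * a j * (LINT x|lborel. dderiv n (\<phi> i) x * dderiv n (\<phi> j) x))"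
proof -
  have "(LINT x|lborel. (\<Sum>j<N. a j * \<phi> j x)\<^sup>2) = (\<Sum>i<N. \<Sum>j<N. a i * a j * (LINT x|lborel. \<phi> i x * \<phi> j x))"
    unfolding square_of_sum by (rule integral_double_sum) (rule int_phi)
  also have "\<dots> = (\<Sum>i<N. \<Sum>j<N. if i = j then (a i)\<^sup>2 else 0)"
    by (intro sum.cong refl) (auto simp: orthonormal power2_eq_square)
  also have "\<dots> = (\<Sum>j<N. (a j)\<^sup>2)" by simp
  finally show "(LINT x|lborel. (\<Sum>j<N. a j * \<phi> j x)\<^sup>2) = (\<Sum>j<N. (a j)\<^sup>2)" .
  show "(LINT x|lborel. (\<Sum>j<N. a j * dderiv n (\<phi> j) x)\<^sup>2) = (\<Sum>i<N. \<Sum>j<N. a i * a j * (LINT x|lborel. dderiv n (\<phi> i) x * dderiv n (\<phi> j) x))"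
    unfolding square_of_sum by (rule integral_double_sum) (rule int_dphi)
qed

lemma int_w:
  "integrable lborel (\<lambda>x. (wc \<xi> x)\<^sup>2)" "integrable lborel (\<lambda>x. (ws \<xi> x)\<^sup>2)"
  "integrable lborel (\<lambda>x. (dderiv n (wc \<xi>) x)\<^sup>2)" "integrable lborel (\<lambda>x. (dderiv n (ws \<xi>) x)\<^sup>2)"
  unfolding power2_eq_square by (intro int_mult C1c_compactly_supported C1c_w)+

lemma integral_w_square: "(LINT x|lborel. (wc \<xi> x)\<^sup>2 + (ws \<xi> x)\<^sup>2) = F \<xi>"
proof -
  have "(LINT x|lborel. (wc \<xi> x)\<^sup>2 + (ws \<xi> x)\<^sup>2) = (LINT x|lborel. (wc \<xi> x)\<^sup>2) + (LINT x|lborel. (ws \<xi> x)\<^sup>2)"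
    by (rule Bochner_Integration.integral_add[OF int_w(1,2)])
  then show ?thesis unfolding wc_def ws_def integral_square_combination F_def by (simp add: sum.distrib)
qed

lemma emeasure_Omega: "\<Omega> \<in> sets lborel" "emeasure lborel \<Omega> < \<infinity>"
  using Omega emeasure_bounded_finite by auto

definition defect :: "'a \<Rightarrow> 'a \<Rightarrow> real" where
  "defect \<xi> x = (cos (\<xi> \<bullet> x) - wc \<xi> x)\<^sup>2 + (sin (\<xi> \<bullet> x) - ws \<xi> x)\<^sup>2"

text \<open>Pythagoras: the plane wave has squared norm \<open>vol\<close> on \<open>\<Omega>\<close>, its projection has squared norm \<open>F \<xi>\<close>, and the defect is the
squared modulus of the difference. Nonnegativity of the defect is Bessel's inequality \<open>F \<xi> \<le> vol\<close>.\<close>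

lemma integral_defect:
  "integrable lborel (\<lambda>x. indicator \<Omega> x * defect \<xi> x)"
  "(LINT x|lborel. indicator \<Omega> x * defect \<xi> x) = vol - F \<xi>"
proof -
  have e: "indicator \<Omega> x * defect \<xi> x
     = indicator \<Omega> x - 2 * (wc \<xi> x * cos (\<xi> \<bullet> x)) - 2 * (ws \<xi> x * sin (\<xi> \<bullet> x)) + ((wc \<xi> x)\<^sup>2 + (ws \<xi> x)\<^sup>2)" for x
  proof (cases "x \<in> \<Omega>")
    case True
    have "(cos (\<xi> \<bullet> x))\<^sup>2 + (sin (\<xi> \<bullet> x))\<^sup>2 = 1" by simp
    then show ?thesis using True by (simp add: defect_def power2_diff)
  qed (simp add: w_outside)
  have i0: "integrable lborel (\<lambda>x. indicator \<Omega> x :: real)"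
    using emeasure_Omega by (intro integrable_real_indicator)
  have i1: "integrable lborel (\<lambda>x. wc \<xi> x * cos (\<xi> \<bullet> x))" "integrable lborel (\<lambda>x. ws \<xi> x * sin (\<xi> \<bullet> x))"
    by (intro compactly_supported_integrable compactly_supported_mult C1c_compactly_supported C1c_w continuous_intros)+
  note i2 = Bochner_Integration.integrable_add[OF int_w(1,2)]
  show "integrable lborel (\<lambda>x. indicator \<Omega> x * defect \<xi> x)"
    unfolding e by (intro Bochner_Integration.integrable_add Bochner_Integration.integrable_diff integrable_mult_right i0 i1 int_w)
  have ip: "integrable lborel (\<lambda>x. \<phi> j x * cos (\<xi> \<bullet> x))" "integrable lborel (\<lambda>x. \<phi> j x * sin (\<xi> \<bullet> x))" if "j < N" for j
    by (intro compactly_supported_integrable compactly_supported_mult C1c_compactly_supported C1c continuous_intros that)+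
  have "(LINT x|lborel. wc \<xi> x * cos (\<xi> \<bullet> x)) = (LINT x|lborel. (\<Sum>j<N. cos_transform (\<phi> j) \<xi> * (\<phi> j x * cos (\<xi> \<bullet> x))))"
    unfolding wc_def by (simp add: sum_distrib_right mult.assoc)
  also have "\<dots> = (\<Sum>j<N. (cos_transform (\<phi> j) \<xi>)\<^sup>2)"
    using ip by (subst Bochner_Integration.integral_sum) (auto simp: power2_eq_square simp flip: cos_transform_def)
  finally have c1: "(LINT x|lborel. wc \<xi> x * cos (\<xi> \<bullet> x)) = (\<Sum>j<N. (cos_transform (\<phi> j) \<xi>)\<^sup>2)" .
  have "(LINT x|lborel. ws \<xi> x * sin (\<xi> \<bullet> x)) = (LINT x|lborel. (\<Sum>j<N. sin_transform (\<phi> j) \<xi> * (\<phi> j x * sin (\<xi> \<bullet> x))))"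
    unfolding ws_def by (simp add: sum_distrib_right mult.assoc)
  also have "\<dots> = (\<Sum>j<N. (sin_transform (\<phi> j) \<xi>)\<^sup>2)"
    using ip by (subst Bochner_Integration.integral_sum) (auto simp: power2_eq_square simp flip: sin_transform_def)
  finally have c2: "(LINT x|lborel. ws \<xi> x * sin (\<xi> \<bullet> x)) = (\<Sum>j<N. (sin_transform (\<phi> j) \<xi>)\<^sup>2)" .
  have "(LINT x|lborel. indicator \<Omega> x * defect \<xi> x) = (LINT x|lborel. indicator \<Omega> x) - 2 * (LINT x|lborel. wc \<xi> x * cos (\<xi> \<bullet> x))
      - 2 * (LINT x|lborel. ws \<xi> x * sin (\<xi> \<bullet> x)) + (LINT x|lborel. (wc \<xi> x)\<^sup>2 + (ws \<xi> x)\<^sup>2)"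
    unfolding e using i0 i1 i2
    by (simp only: Bochner_Integration.integral_add Bochner_Integration.integral_diff Bochner_Integration.integrable_diff integrable_mult_right integral_mult_right_zero)
  also have "(LINT x|lborel. indicator \<Omega> x) = vol" unfolding vol_def by simp
  finally show "(LINT x|lborel. indicator \<Omega> x * defect \<xi> x) = vol - F \<xi>"
    unfolding c1 c2 integral_w_square by (simp add: F_def sum.distrib)
qed

lemma F_bounds: "0 \<le> F \<xi>" "F \<xi> \<le> vol"
proof -
  show "0 \<le> F \<xi>" unfolding F_def by (intro sum_nonneg) simp
  have "0 \<le> (LINT x|lborel. indicator \<Omega> x * defect \<xi> x)" by (intro Bochner_Integration.integral_nonneg) (simp add: defect_def)
  then show "F \<xi> \<le> vol" unfolding integral_defect by simp
qed

lemma integral_F: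
  "integrable lborel F" "(LINT \<xi>|lborel. F \<xi>) = (2 * pi) ^ DIM('a) * N"
proof -
  note pl = plancherel[OF C1c_compactly_supported(1)[OF C1c]]
  show "integrable lborel F" unfolding F_def[abs_def] using pl(1) by (intro Bochner_Integration.integrable_sum) auto
  have "(LINT \<xi>|lborel. F \<xi>) = (\<Sum>j<N. (2 * pi) ^ DIM('a) * (LINT x|lborel. (\<phi> j x)\<^sup>2))"
    unfolding F_def using pl by (subst Bochner_Integration.integral_sum) (auto intro!: sum.cong)
  also have "\<dots> = (\<Sum>j<N. (2 * pi) ^ DIM('a))"
    using orthonormal by (intro sum.cong) (auto simp: power2_eq_square)
  finally show "(LINT \<xi>|lborel. F \<xi>) = (2 * pi) ^ DIM('a) * N" by (simp add: mult.commute)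
qed

lemma integral_F_directional:
  "integrable lborel (\<lambda>\<xi>. (n \<bullet> \<xi>)\<^sup>2 * F \<xi>)" "(LINT \<xi>|lborel. (n \<bullet> \<xi>)\<^sup>2 * F \<xi>) = (2 * pi) ^ DIM('a) * energy n"
proof -
  note pl = plancherel_dderiv[OF C1c]
  show "integrable lborel (\<lambda>\<xi>. (n \<bullet> \<xi>)\<^sup>2 * F \<xi>)"
    unfolding F_def sum_distrib_left using pl(1) by (intro Bochner_Integration.integrable_sum) auto
  show "(LINT \<xi>|lborel. (n \<bullet> \<xi>)\<^sup>2 * F \<xi>) = (2 * pi) ^ DIM('a) * energy n"
    unfolding F_def sum_distrib_left energy_def using pl by (subst Bochner_Integration.integral_sum) (auto intro!: sum.cong)
qed

definition total_energy :: real where "total_energy = (\<Sum>b\<in>Basis. energy b)"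

lemma integral_F_norm:
  "integrable lborel (\<lambda>\<xi>. (norm \<xi>)\<^sup>2 * F \<xi>)" "(LINT \<xi>|lborel. (norm \<xi>)\<^sup>2 * F \<xi>) = (2 * pi) ^ DIM('a) * total_energy"
proof -
  have e: "(norm \<xi>)\<^sup>2 * F \<xi> = (\<Sum>b\<in>Basis. (b \<bullet> \<xi>)\<^sup>2 * F \<xi>)" for \<xi>
    by (subst power2_norm_eq_inner, subst euclidean_inner) (simp add: sum_distrib_right power2_eq_square inner_commute)
  show "integrable lborel (\<lambda>\<xi>. (norm \<xi>)\<^sup>2 * F \<xi>)"
    unfolding e using integral_F_directional(1) by (intro Bochner_Integration.integrable_sum)
  show "(LINT \<xi>|lborel. (norm \<xi>)\<^sup>2 * F \<xi>) = (2 * pi) ^ DIM('a) * total_energy"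
    unfolding e total_energy_def sum_distrib_left using integral_F_directional
    by (subst Bochner_Integration.integral_sum) auto
qed

lemma P_eq: "P n \<xi> = (\<Sum>i<N. \<Sum>j<N. (cos_transform (\<phi> i) \<xi> * cos_transform (\<phi> j) \<xi> + sin_transform (\<phi> i) \<xi> * sin_transform (\<phi> j) \<xi>)
    * (LINT x|lborel. dderiv n (\<phi> i) x * dderiv n (\<phi> j) x))"
proof -
  have "P n \<xi> = (LINT x|lborel. (dderiv n (wc \<xi>) x)\<^sup>2) + (LINT x|lborel. (dderiv n (ws \<xi>) x)\<^sup>2)"
    unfolding P_def by (rule Bochner_Integration.integral_add[OF int_w(3,4)])
  then show ?thesis
    unfolding C1c_w integral_square_combination by (simp add: sum.distrib distrib_right)
qed

text \<open>The energy of the projections is a quadratic form in the transforms of the \<open>\<phi> j\<close>. By Plancherel these transforms are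
orthogonal for different indices, so only the diagonal terms survive the integration over \<open>\<xi>\<close>.\<close>

lemma integral_P:
  "integrable lborel (P n)" "(LINT \<xi>|lborel. P n \<xi>) = (2 * pi) ^ DIM('a) * energy n"
proof -
  note pl = plancherel_inner[OF C1c_compactly_supported(1)[OF C1c] C1c_compactly_supported(1)[OF C1c]]
  show "integrable lborel (P n)"
    unfolding P_eq[abs_def] using pl(1) by (intro Bochner_Integration.integrable_sum integrable_mult_left) auto
  have "(LINT \<xi>|lborel. P n \<xi>) = (LINT \<xi>|lborel. (\<Sum>i<N. \<Sum>j<N. (LINT x|lborel. dderiv n (\<phi> i) x * dderiv n (\<phi> j) x) *
      (cos_transform (\<phi> i) \<xi> * cos_transform (\<phi> j) \<xi> + sin_transform (\<phi> i) \<xi> * sin_transform (\<phi> j) \<xi>)))"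
    unfolding P_eq by (simp only: mult.commute)
  also have "\<dots> = (\<Sum>i<N. \<Sum>j<N. (LINT x|lborel. dderiv n (\<phi> i) x * dderiv n (\<phi> j) x) *
      (LINT \<xi>|lborel. cos_transform (\<phi> i) \<xi> * cos_transform (\<phi> j) \<xi> + sin_transform (\<phi> i) \<xi> * sin_transform (\<phi> j) \<xi>))"
    by (rule integral_double_sum) (rule pl(1))
  also have "\<dots> = (\<Sum>i<N. \<Sum>j<N. (2 * pi) ^ DIM('a) * (LINT x|lborel. \<phi> i x * \<phi> j x) * (LINT x|lborel. dderiv n (\<phi> i) x * dderiv n (\<phi> j) x))"
    by (intro sum.cong refl) (simp add: pl(2))
  also have "\<dots> = (\<Sum>i<N. \<Sum>j<N. if i = j then (2 * pi) ^ DIM('a) * (LINT x|lborel. (dderiv n (\<phi> i) x)\<^sup>2) else 0)"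
    by (intro sum.cong refl) (auto simp: orthonormal power2_eq_square)
  also have "\<dots> = (2 * pi) ^ DIM('a) * energy n" by (simp add: energy_def sum_distrib_left)
  finally show "(LINT \<xi>|lborel. P n \<xi>) = (2 * pi) ^ DIM('a) * energy n" .
qed

lemma P_nonneg: "0 \<le> P n \<xi>" unfolding P_def by (intro Bochner_Integration.integral_nonneg) simp

end

section \<open>How far plane waves are from the span\<close>

lemma integral_pos_part:
  fixes \<rho> :: "'a::euclidean_space \<Rightarrow> real"
  assumes r: "\<rho> \<in> borel_measurable borel" "\<And>\<xi>. 0 \<le> \<rho> \<xi>"
    and vol: "\<And>t. 0 \<le> t \<Longrightarrow> emeasure lborel {\<xi>. \<rho> \<xi> < t} = ennreal (c * t powr p)"
    and c: "0 \<le> c" "0 \<le> p" "0 \<le> K"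
  shows "integrable lborel (\<lambda>\<xi>. max 0 (K - \<rho> \<xi>))"
    "(LINT \<xi>|lborel. max 0 (K - \<rho> \<xi>)) = c * K powr (p+1) / (p+1)"
    "integrable lborel (\<lambda>\<xi>. (max 0 (K - \<rho> \<xi>))\<^sup>2)"
    "(LINT \<xi>|lborel. (max 0 (K - \<rho> \<xi>))\<^sup>2) = 2 * c * K powr (p+2) / ((p+1) * (p+2))"
proof -
  have "has_bochner_integral lborel (\<lambda>\<xi>. max 0 (K - \<rho> \<xi>)) (c * K powr (p+1) / (p+1))"
    using c r(1) nn_integral_pos_part[OF r vol c] by (intro has_bochner_integral_nn_integral) auto
  then show "integrable lborel (\<lambda>\<xi>. max 0 (K - \<rho> \<xi>))"
    "(LINT \<xi>|lborel. max 0 (K - \<rho> \<xi>)) = c * K powr (p+1) / (p+1)"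
    by (auto simp: has_bochner_integral_iff)
  have "has_bochner_integral lborel (\<lambda>\<xi>. (max 0 (K - \<rho> \<xi>))\<^sup>2) (2 * c * K powr (p+2) / ((p+1) * (p+2)))"
    using c r(1) nn_integral_pos_part_square[OF r vol c] by (intro has_bochner_integral_nn_integral) auto
  then show "integrable lborel (\<lambda>\<xi>. (max 0 (K - \<rho> \<xi>))\<^sup>2)"
    "(LINT \<xi>|lborel. (max 0 (K - \<rho> \<xi>))\<^sup>2) = 2 * c * K powr (p+2) / ((p+1) * (p+2))"
    by (auto simp: has_bochner_integral_iff)
qed

lemma young:
  fixes a u v R :: real
  assumes a: "0 < a"
  shows "R * (u * v) \<le> a * u\<^sup>2 + R\<^sup>2 / (4 * a) * v\<^sup>2"
proof -
  have "0 \<le> a * (u - R * v / (2 * a))\<^sup>2" using a by simp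
  also have "\<dots> = a * u\<^sup>2 - R * (u * v) + R\<^sup>2 / (4 * a) * v\<^sup>2"
    using a by (simp add: power2_eq_square field_simps)
  finally show ?thesis by simp
qed

text \<open>Young's inequality for the real part of a product of two complex numbers \<open>u\<close> and \<open>v = \<partial>w - i k w\<close>, together with
\<open>|v|\<^sup>2 \<le> 2 |\<partial>w|\<^sup>2 + 2 k\<^sup>2 |w|\<^sup>2\<close>, written in real and imaginary parts.\<close>

lemma young_pair:
  fixes u1 u2 d1 d2 k w1 w2 a R :: real
  assumes a: "0 < a" and R: "0 < R"
  shows "R / 2 * \<bar>2 * (u1 * (d1 + k * w2) + u2 * (d2 - k * w1))\<bar>
    \<le> a * (u1\<^sup>2 + u2\<^sup>2) + R\<^sup>2 / (4 * a) * (2 * (d1\<^sup>2 + d2\<^sup>2) + 2 * k\<^sup>2 * (w1\<^sup>2 + w2\<^sup>2))"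
proof -
  define v1 v2 where "v1 = d1 + k * w2" and "v2 = d2 - k * w1"
  have v1: "v1\<^sup>2 \<le> 2 * d1\<^sup>2 + 2 * k\<^sup>2 * w2\<^sup>2"
    unfolding v1_def using sum_squares_bound[of d1 "k * w2"] by (simp add: power2_sum power_mult_distrib)
  have v2: "v2\<^sup>2 \<le> 2 * d2\<^sup>2 + 2 * k\<^sup>2 * w1\<^sup>2"
    unfolding v2_def using sum_squares_bound[of d2 "- (k * w1)"] by (simp add: power2_diff power_mult_distrib)
  have "R / 2 * \<bar>2 * (u1 * v1 + u2 * v2)\<bar> = \<bar>R * (u1 * v1) + R * (u2 * v2)\<bar>"
  proof -
    have "R / 2 * \<bar>2 * z\<bar> = \<bar>R * z\<bar>" for z using R by (simp add: abs_mult)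
    then show ?thesis by (simp only: distrib_left[of R])
  qed
  also have "\<dots> \<le> (a * u1\<^sup>2 + R\<^sup>2 / (4 * a) * v1\<^sup>2) + (a * u2\<^sup>2 + R\<^sup>2 / (4 * a) * v2\<^sup>2)"
    unfolding abs_le_iff using young[OF a, of R u1 v1] young[OF a, of R u2 v2] young[OF a, of R u1 "-v1"] young[OF a, of R u2 "-v2"]
    by simp
  also have "\<dots> = a * (u1\<^sup>2 + u2\<^sup>2) + R\<^sup>2 / (4 * a) * (v1\<^sup>2 + v2\<^sup>2)" by (simp add: distrib_left)
  also have "\<dots> \<le> a * (u1\<^sup>2 + u2\<^sup>2) + R\<^sup>2 / (4 * a) * (2 * (d1\<^sup>2 + d2\<^sup>2) + 2 * k\<^sup>2 * (w1\<^sup>2 + w2\<^sup>2))"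
    using v1 v2 a by (intro add_left_mono mult_left_mono) (auto simp: algebra_simps)
  finally show ?thesis unfolding v1_def v2_def .
qed

locale li_yau_setting = balanced_halfspaces \<Omega> I c R + orthonormal_family \<Omega> \<phi> N
  for \<Omega> :: "'a::euclidean_space set" and I c R \<phi> N
begin

definition mean_energy :: real where "mean_energy = (\<Sum>p\<in>I. c p * energy (fst p))"

text \<open>If the plane wave \<open>e\<close> were equal to \<open>w\<close> on \<open>\<Omega>\<close>, the function \<open>\<psi> = 1 - |e - w|\<^sup>2\<close> would jump from \<open>1\<close> to \<open>0\<close> at the boundary,
which is expensive to differentiate. Integrating \<open>\<psi> * H\<close> by parts against the barriers expresses this: the left-hand side
is at least \<open>vol / 2\<close> minus the defect, and the derivatives of \<open>\<psi>\<close> are controlled by the defect, the directional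
energies of \<open>w\<close> and those of a plane wave with the mass of \<open>w\<close>, in proportions governed by \<open>a\<close>.\<close>

lemma defect_lower_bound:
  assumes a: "a > 0"
  shows "vol / 2 \<le> (1 + a) * (vol - F \<xi>) + R\<^sup>2 / (4 * a) * (\<Sum>p\<in>I. c p * (2 * P (fst p) \<xi> + 2 * ((fst p \<bullet> \<xi>)\<^sup>2 * F \<xi>)))"
proof -
  \<comment> \<open>on \<open>\<Omega>\<close> this is \<open>1 - |e - w|\<^sup>2\<close>; in this form it is visibly of class \<open>C1c\<close> and vanishes outside \<open>\<Omega>\<close>\<close>
  define \<psi> where "\<psi> = (\<lambda>x. wc \<xi> x * (2 * cos (\<xi> \<bullet> x) - wc \<xi> x) + ws \<xi> x * (2 * sin (\<xi> \<bullet> x) - ws \<xi> x))"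
  have d1: "((\<lambda>x. 2 * cos (\<xi> \<bullet> x) - wc \<xi> x) has_derivative (\<lambda>n. - 2 * sin (\<xi> \<bullet> x) * (\<xi> \<bullet> n) - dderiv n (wc \<xi>) x)) (at x)" for x
    by (auto intro!: derivative_eq_intros C1c_has_derivative C1c_w)
  have d2: "((\<lambda>x. 2 * sin (\<xi> \<bullet> x) - ws \<xi> x) has_derivative (\<lambda>n. 2 * cos (\<xi> \<bullet> x) * (\<xi> \<bullet> n) - dderiv n (ws \<xi>) x)) (at x)" for x
    by (auto intro!: derivative_eq_intros C1c_has_derivative C1c_w)
  have k1: "continuous_on UNIV (\<lambda>x. - 2 * sin (\<xi> \<bullet> x) * (\<xi> \<bullet> n) - dderiv n (wc \<xi>) x)" for n
    by (intro continuous_intros C1c_continuous C1c_w)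
  have k2: "continuous_on UNIV (\<lambda>x. 2 * cos (\<xi> \<bullet> x) * (\<xi> \<bullet> n) - dderiv n (ws \<xi>) x)" for n
    by (intro continuous_intros C1c_continuous C1c_w)
  note M1 = C1c_mult[OF C1c_w(1) d1 k1] and M2 = C1c_mult[OF C1c_w(2) d2 k2]
  have psi: "C1c \<psi>" unfolding \<psi>_def by (rule C1c_add(1)[OF M1(1) M2(1)])
  \<comment> \<open>twice the real part of \<open>cnj (e - w) * (\<partial>w - i k w)\<close> with \<open>k = n \<bullet> \<xi>\<close>: in \<open>\<partial>e = i k e\<close> the
    part \<open>i k (e - w)\<close> contributes nothing, as \<open>i k |e - w|\<^sup>2\<close> is purely imaginary\<close>
  have dpsi: "dderiv n \<psi> x = 2 * ((cos (\<xi> \<bullet> x) - wc \<xi> x) * (dderiv n (wc \<xi>) x + (n \<bullet> \<xi>) * ws \<xi> x)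
      + (sin (\<xi> \<bullet> x) - ws \<xi> x) * (dderiv n (ws \<xi>) x - (n \<bullet> \<xi>) * wc \<xi> x))" for n x
    unfolding \<psi>_def C1c_add(2)[OF M1(1) M2(1)] M1(2) M2(2) by (simp add: algebra_simps inner_commute)
  define B :: "'a \<times> real \<Rightarrow> 'a \<Rightarrow> real" where "B = (\<lambda>p x. a * defect \<xi> x + R\<^sup>2 / (4 * a) * (2 * ((dderiv (fst p) (wc \<xi>) x)\<^sup>2 + (dderiv (fst p) (ws \<xi>) x)\<^sup>2)
     + 2 * (fst p \<bullet> \<xi>)\<^sup>2 * ((wc \<xi> x)\<^sup>2 + (ws \<xi> x)\<^sup>2)))"
  have B: "R / 2 * \<bar>dderiv (fst p) \<psi> x\<bar> \<le> B p x" for p :: "'a \<times> real" and x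
    unfolding dpsi B_def defect_def by (rule young_pair[OF a R_pos])
  have Be: "indicator \<Omega> x * B p x = a * (indicator \<Omega> x * defect \<xi> x) + R\<^sup>2 / (4 * a) * (2 * ((dderiv (fst p) (wc \<xi>) x)\<^sup>2 + (dderiv (fst p) (ws \<xi>) x)\<^sup>2)
     + 2 * (fst p \<bullet> \<xi>)\<^sup>2 * ((wc \<xi> x)\<^sup>2 + (ws \<xi> x)\<^sup>2))" for p :: "'a \<times> real" and x
    by (cases "x \<in> \<Omega>") (auto simp: B_def w_outside)
  note i1 = Bochner_Integration.integrable_add[OF int_w(1,2)] and i2 = Bochner_Integration.integrable_add[OF int_w(3,4)]
  have Bi: "integrable lborel (\<lambda>x. indicator \<Omega> x * B p x)" for p
    unfolding Be by (intro Bochner_Integration.integrable_add integrable_mult_right integral_defect int_w)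
  have BI: "(LINT x|lborel. indicator \<Omega> x * B p x) = a * (vol - F \<xi>) + R\<^sup>2 / (4 * a) * (2 * P (fst p) \<xi> + 2 * ((fst p \<bullet> \<xi>)\<^sup>2 * F \<xi>))" for p
  proof -
    have "(LINT x|lborel. indicator \<Omega> x * B p x) = a * (LINT x|lborel. indicator \<Omega> x * defect \<xi> x)
        + R\<^sup>2 / (4 * a) * (2 * (LINT x|lborel. (dderiv (fst p) (wc \<xi>) x)\<^sup>2 + (dderiv (fst p) (ws \<xi>) x)\<^sup>2)
         + 2 * (fst p \<bullet> \<xi>)\<^sup>2 * (LINT x|lborel. (wc \<xi> x)\<^sup>2 + (ws \<xi> x)\<^sup>2))"
      unfolding Be using i1 i2 integral_defect(1)
      by (simp only: Bochner_Integration.integral_add Bochner_Integration.integrable_add integrable_mult_right integral_mult_right_zero)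
    then show ?thesis unfolding integral_defect integral_w_square P_def by simp
  qed
  have "vol / 2 - (vol - F \<xi>) = (LINT x|lborel. (1/2) * indicator \<Omega> x - indicator \<Omega> x * defect \<xi> x)"
    using emeasure_Omega integral_defect by (subst Bochner_Integration.integral_diff) (auto simp: vol_def)
  also have "\<dots> \<le> (LINT x|lborel. \<psi> x * H x)"
  proof (rule integral_mono)
    show "integrable lborel (\<lambda>x. (1/2) * indicator \<Omega> x - indicator \<Omega> x * defect \<xi> x)"
      using emeasure_Omega integral_defect by (intro Bochner_Integration.integrable_diff) auto
    show "integrable lborel (\<lambda>x. \<psi> x * H x)"
      by (intro compactly_supported_integrable compactly_supported_mult C1c_compactly_supported psi continuous_H)
    fix x
    show "(1/2) * indicator \<Omega> x - indicator \<Omega> x * defect \<xi> x \<le> \<psi> x * H x"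
    proof (cases "x \<in> \<Omega>")
      case True
      have "(cos (\<xi> \<bullet> x))\<^sup>2 + (sin (\<xi> \<bullet> x))\<^sup>2 = 1" by simp
      then have e: "\<psi> x = 1 - defect \<xi> x" unfolding \<psi>_def defect_def
        by (simp add: power2_eq_square algebra_simps)
      have "defect \<xi> x * H x \<le> defect \<xi> x * 1" using H_bounds[OF True] by (intro mult_left_mono) (auto simp: defect_def)
      then show ?thesis using H_bounds[OF True] True unfolding e by (simp add: left_diff_distrib)
    qed (simp add: \<psi>_def w_outside)
  qed
  also have "\<dots> \<le> (\<Sum>p\<in>I. c p * (LINT x|lborel. indicator \<Omega> x * B p x))"
    by (rule integral_H_le[OF psi _ B Bi]) (simp add: dpsi w_outside)
  also have "\<dots> = a * (vol - F \<xi>) * sum c I + R\<^sup>2 / (4 * a) * (\<Sum>p\<in>I. c p * (2 * P (fst p) \<xi> + 2 * ((fst p \<bullet> \<xi>)\<^sup>2 * F \<xi>)))"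
    unfolding BI sum_distrib_left sum.distrib[symmetric] by (intro sum.cong refl) (simp add: algebra_simps)
  finally show ?thesis by (simp add: c_sum algebra_simps)
qed

text \<open>A Hardy-type inequality: the barriers are applied to the square of each function of the family. Young's
inequality with the parameter \<open>1/4\<close> spends half of the lower bound \<open>1/2\<close> on \<open>H\<close> and leaves \<open>1/4\<close>.\<close>

lemma mean_energy_ge: "N / 4 \<le> R\<^sup>2 * mean_energy"
proof -
  have j: "1 / 4 \<le> R\<^sup>2 * (\<Sum>p\<in>I. c p * (LINT x|lborel. (dderiv (fst p) (\<phi> j) x)\<^sup>2))" if j: "j < N" for j
  proof -
    note Cj = C1c[OF j]
    define \<psi> where "\<psi> = (\<lambda>x. \<phi> j x * \<phi> j x)"
    note M = C1c_mult[OF Cj C1c_has_derivative[OF Cj] C1c_continuous(2)[OF Cj]]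
    have psi: "C1c \<psi>" unfolding \<psi>_def by (rule M(1))
    have dpsi: "dderiv n \<psi> x = 2 * (\<phi> j x * dderiv n (\<phi> j) x)" for n x
      unfolding \<psi>_def M(2) by simp
    have i1: "integrable lborel \<psi>" "integrable lborel (\<lambda>x. (dderiv n (\<phi> j) x)\<^sup>2)" for n
      unfolding \<psi>_def power2_eq_square by (intro int_mult C1c_compactly_supported Cj)+
    have I1: "(LINT x|lborel. \<psi> x) = 1" unfolding \<psi>_def using orthonormal[OF j j] by simp
    define B :: "'a \<times> real \<Rightarrow> 'a \<Rightarrow> real" where "B = (\<lambda>p x. (1/4) * \<psi> x + R\<^sup>2 * (dderiv (fst p) (\<phi> j) x)\<^sup>2)"
    have B: "R / 2 * \<bar>dderiv (fst p) \<psi> x\<bar> \<le> B p x" for p :: "'a \<times> real" and x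
    proof -
      have "R / 2 * \<bar>dderiv (fst p) \<psi> x\<bar> = R * (\<bar>\<phi> j x\<bar> * \<bar>dderiv (fst p) (\<phi> j) x\<bar>)" by (simp add: dpsi abs_mult)
      also have "\<dots> \<le> (1/4) * \<bar>\<phi> j x\<bar>\<^sup>2 + R\<^sup>2 / (4 * (1/4)) * \<bar>dderiv (fst p) (\<phi> j) x\<bar>\<^sup>2"
        by (rule young) simp
      also have "\<dots> = B p x" by (simp add: B_def \<psi>_def power2_eq_square)
      finally show ?thesis .
    qed
    have Be: "indicator \<Omega> x * B p x = B p x" for p x
      using zero_outside[OF j] by (cases "x \<in> \<Omega>") (auto simp: B_def \<psi>_def)
    have Bi: "integrable lborel (\<lambda>x. indicator \<Omega> x * B p x)" for p
      unfolding Be unfolding B_def by (intro Bochner_Integration.integrable_add integrable_mult_right i1)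
    have BI: "(LINT x|lborel. indicator \<Omega> x * B p x) = 1/4 + R\<^sup>2 * (LINT x|lborel. (dderiv (fst p) (\<phi> j) x)\<^sup>2)" for p
      unfolding Be unfolding B_def using i1 by (subst Bochner_Integration.integral_add) (auto simp: I1)
    have "1 / 2 = (LINT x|lborel. (1/2) * \<psi> x)" by (simp add: I1)
    also have "\<dots> \<le> (LINT x|lborel. \<psi> x * H x)"
    proof (rule integral_mono)
      show "integrable lborel (\<lambda>x. (1/2) * \<psi> x)" using i1 by simp
      show "integrable lborel (\<lambda>x. \<psi> x * H x)"
        by (intro compactly_supported_integrable compactly_supported_mult C1c_compactly_supported psi continuous_H)
      fix x
      show "(1/2) * \<psi> x \<le> \<psi> x * H x"
      proof (cases "x \<in> \<Omega>")
        case True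
        have "\<psi> x * (1/2) \<le> \<psi> x * H x" using H_bounds[OF True] by (intro mult_left_mono) (auto simp: \<psi>_def)
        then show ?thesis by (simp add: mult.commute)
      qed (simp add: \<psi>_def zero_outside[OF j])
    qed
    also have "\<dots> \<le> (\<Sum>p\<in>I. c p * (LINT x|lborel. indicator \<Omega> x * B p x))"
      by (rule integral_H_le[OF psi _ B Bi]) (simp add: dpsi zero_outside[OF j])
    also have "\<dots> = (1/4) * sum c I + R\<^sup>2 * (\<Sum>p\<in>I. c p * (LINT x|lborel. (dderiv (fst p) (\<phi> j) x)\<^sup>2))"
      unfolding BI sum_distrib_left sum.distrib[symmetric] by (intro sum.cong refl) (simp add: algebra_simps)
    finally show ?thesis by (simp add: c_sum)
  qed
  have "N / 4 = (\<Sum>j<N. 1 / 4)" by simp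
  also have "\<dots> \<le> (\<Sum>j<N. R\<^sup>2 * (\<Sum>p\<in>I. c p * (LINT x|lborel. (dderiv (fst p) (\<phi> j) x)\<^sup>2)))"
    using j by (intro sum_mono) auto
  also have "\<dots> = R\<^sup>2 * mean_energy"
    unfolding mean_energy_def energy_def sum_distrib_left by (subst sum.swap) simp
  finally show ?thesis .
qed

end

section \<open>The improved bound for orthonormal test functions\<close>

text \<open>Here \<open>z\<close>, \<open>e\<close> and \<open>y\<close> stand for \<open>R\<^sup>2 (S - L) / N\<close>, \<open>R\<^sup>2 E / N\<close> and \<open>R\<^sup>2 \<sigma>\<close>. If \<open>z < 1/64\<close>, the bounds on \<open>e\<close> force
\<open>y > 0.31\<close>. The choice \<open>a = 19/2 y\<close> makes the last term independent of \<open>y\<close> except through \<open>e\<close>, and then the main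
inequality forces \<open>y < 0.28\<close>.\<close>

lemma spectral_arithmetic:
  fixes y z e :: real
  assumes e: "1 / 4 \<le> e" "e \<le> 2 * z + 25 / 36 * y" and y: "0 < y"
    and main: "\<And>a. 0 < a \<Longrightarrow> 3 / 8 * y \<le> (1 + a) * z + 2 * y * e / a"
  shows "1 / 64 \<le> z"
proof (rule ccontr)
  assume "\<not> 1 / 64 \<le> z"
  then have z: "z < 1 / 64" by simp
  have "3 / 8 * y \<le> (1 + 19 / 2 * y) * z + 2 * y * e / (19 / 2 * y)" using y by (intro main) simp
  also have "2 * y * e / (19 / 2 * y) = 4 / 19 * e" using y by (simp add: field_simps)
  also have "(1 + 19 / 2 * y) * z \<le> (1 + 19 / 2 * y) * (1 / 64)" using y z by (intro mult_left_mono) auto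
  finally show False using e z y by (simp add: algebra_simps)
qed

context li_yau_setting
begin

text \<open>The lower bound on the defect is integrated over frequencies with a weight \<open>T\<close>. The natural weight \<open>s = max 0 (K - |\<xi>|\<^sup>2)\<close>
turns \<open>\<integral>s (vol - F)\<close> into at most the excess of the energy over the Li-Yau bound. The energies of \<open>w\<close>, however,
are known only through their unweighted integrals, so the weight must also be bounded by a multiple of \<open>\<sigma>\<close>, the
mean value of \<open>s\<close> over the ball. Truncating \<open>s\<close> at \<open>2 \<sigma>\<close> keeps three quarters of its integral in every dimension.\<close>

lemma total_energy_defect_bound:
  fixes K a \<sigma> :: real
  assumes K: "0 < K" "vol * unit_ball_vol DIM('a) * K powr (DIM('a) / 2) = (2 * pi) ^ DIM('a) * N" and a: "0 < a"
  defines "\<sigma> \<equiv> 2 * K / (real DIM('a) + 2)"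
  shows "3 / 8 * \<sigma> * N \<le> (1 + a) * (total_energy - K * N + \<sigma> * N) + 2 * R\<^sup>2 * \<sigma> / a * mean_energy"
proof -
  define d where "d = real DIM('a)"
  have d: "0 < d" by (simp add: d_def)
  define V where "V = unit_ball_vol d * K powr (d / 2)"
  have V: "0 \<le> V" "vol * V = (2 * pi) ^ DIM('a) * N" using K by (simp_all add: V_def d_def mult.assoc)
  have s0: "0 < \<sigma>" using K(1) by (simp add: \<sigma>_def)
  define s where "s = (\<lambda>\<xi>::'a. max 0 (K - (norm \<xi>)\<^sup>2))"
  define T where "T = (\<lambda>\<xi>. min (s \<xi>) (2 * \<sigma>))"
  have sm: "(\<lambda>\<xi>::'a. (norm \<xi>)\<^sup>2) \<in> borel_measurable borel" by measurable
  have ps: "integrable lborel s" "(LINT \<xi>|lborel. s \<xi>) = \<sigma> * V"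
    "integrable lborel (\<lambda>\<xi>. (s \<xi>)\<^sup>2)" "(LINT \<xi>|lborel. (s \<xi>)\<^sup>2) \<le> 2 * \<sigma>\<^sup>2 * V"
  proof -
    have v: "emeasure lborel {\<xi>::'a. (norm \<xi>)\<^sup>2 < t} = ennreal (unit_ball_vol d * t powr (d / 2))" if "0 \<le> t" for t
      using emeasure_ball0[OF that, where 'a='a] by (simp add: d_def)
    have c: "0 \<le> unit_ball_vol d" "0 \<le> d / 2" "0 \<le> K" using d K by simp_all
    have r0: "0 \<le> (norm \<xi>)\<^sup>2" for \<xi> :: 'a by simp
    note I = integral_pos_part[OF sm r0 v c]
    show "integrable lborel s" unfolding s_def by (rule I(1))
    have "(LINT \<xi>|lborel. s \<xi>) = unit_ball_vol d * K powr (d / 2 + 1) / (d / 2 + 1)" unfolding s_def by (rule I(2))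
    also have "K powr (d / 2 + 1) = K powr (d / 2) * K" using K by (simp add: powr_add)
    also have "unit_ball_vol d * (K powr (d / 2) * K) / (d / 2 + 1) = \<sigma> * V"
      using d by (simp add: \<sigma>_def V_def d_def[symmetric] field_simps)
    finally show "(LINT \<xi>|lborel. s \<xi>) = \<sigma> * V" .
    show "integrable lborel (\<lambda>\<xi>. (s \<xi>)\<^sup>2)" unfolding s_def by (rule I(3))
    have "(LINT \<xi>|lborel. (s \<xi>)\<^sup>2) = 2 * unit_ball_vol d * K powr (d / 2 + 2) / ((d / 2 + 1) * (d / 2 + 2))" unfolding s_def by (rule I(4))
    also have "K powr (d / 2 + 2) = K powr (d / 2) * K\<^sup>2" using K by (simp add: powr_add)
    also have "2 * unit_ball_vol d * (K powr (d / 2) * K\<^sup>2) / ((d / 2 + 1) * (d / 2 + 2)) = 2 * V * K\<^sup>2 * (1 / ((d / 2 + 1) * (d / 2 + 2)))"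
      by (simp add: V_def)
    also have "\<dots> \<le> 2 * V * K\<^sup>2 * (1 / ((d / 2 + 1) * (d / 2 + 1)))"
      using d V by (intro mult_left_mono divide_left_mono) auto
    also have "\<dots> = 2 * \<sigma>\<^sup>2 * V"
    proof -
      have "\<sigma> = K / (d / 2 + 1)" using d by (simp add: \<sigma>_def d_def[symmetric] field_simps)
      then show ?thesis by (simp add: power_divide power2_eq_square)
    qed
    finally show "(LINT \<xi>|lborel. (s \<xi>)\<^sup>2) \<le> 2 * \<sigma>\<^sup>2 * V" .
  qed
  have sb: "s \<in> borel_measurable lborel" using ps(1) by simp
  \<comment> \<open>the parabola \<open>s - s\<^sup>2 / (8 \<sigma>)\<close> has its maximum \<open>2 \<sigma>\<close> at \<open>s = 4 \<sigma>\<close>, so it lies below the truncation\<close>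
  have T: "0 \<le> T \<xi>" "T \<xi> \<le> s \<xi>" "T \<xi> \<le> 2 * \<sigma>" "s \<xi> - (s \<xi>)\<^sup>2 / (8 * \<sigma>) \<le> T \<xi>" for \<xi>
  proof -
    show "0 \<le> T \<xi>" "T \<xi> \<le> s \<xi>" "T \<xi> \<le> 2 * \<sigma>" using s0 by (auto simp: T_def s_def)
    have "0 \<le> (s \<xi> - 4 * \<sigma>)\<^sup>2 / (8 * \<sigma>)" using s0 by simp
    also have "(s \<xi> - 4 * \<sigma>)\<^sup>2 / (8 * \<sigma>) = 2 * \<sigma> - (s \<xi> - (s \<xi>)\<^sup>2 / (8 * \<sigma>))"
      using s0 by (simp add: field_simps power2_eq_square)
    finally have "s \<xi> - (s \<xi>)\<^sup>2 / (8 * \<sigma>) \<le> 2 * \<sigma>" by simp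
    moreover have "s \<xi> - (s \<xi>)\<^sup>2 / (8 * \<sigma>) \<le> s \<xi>" using s0 by simp
    ultimately show "s \<xi> - (s \<xi>)\<^sup>2 / (8 * \<sigma>) \<le> T \<xi>" by (simp add: T_def)
  qed
  have Ti: "integrable lborel T"
    by (rule Bochner_Integration.integrable_bound[OF ps(1)]) (use sb T s0 in \<open>auto simp: T_def s_def\<close>)
  have TI: "3 / 4 * \<sigma> * V \<le> (LINT \<xi>|lborel. T \<xi>)"
  proof -
    have "(LINT \<xi>|lborel. (s \<xi>)\<^sup>2) / (8 * \<sigma>) \<le> 2 * \<sigma>\<^sup>2 * V / (8 * \<sigma>)"
      using ps(4) s0 by (intro divide_right_mono) auto
    also have "\<dots> = \<sigma> * V / 4" using s0 by (simp add: power2_eq_square)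
    finally have "3 / 4 * \<sigma> * V \<le> \<sigma> * V - (LINT \<xi>|lborel. (s \<xi>)\<^sup>2) / (8 * \<sigma>)" by linarith
    also have "\<dots> = (LINT \<xi>|lborel. s \<xi> - (s \<xi>)\<^sup>2 / (8 * \<sigma>))"
      using ps by (subst Bochner_Integration.integral_diff) auto
    also have "\<dots> \<le> (LINT \<xi>|lborel. T \<xi>)"
      using ps Ti T(4) by (intro integral_mono) auto
    finally show ?thesis .
  qed
  define Z where "Z = (\<lambda>\<xi>. \<Sum>p\<in>I. c p * (2 * P (fst p) \<xi> + 2 * ((fst p \<bullet> \<xi>)\<^sup>2 * F \<xi>)))"
  have Z0: "0 \<le> Z \<xi>" for \<xi> unfolding Z_def
    using c_nonneg P_nonneg F_bounds(1) by (intro sum_nonneg mult_nonneg_nonneg add_nonneg_nonneg) auto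
  have Zi: "integrable lborel Z" unfolding Z_def[abs_def]
    by (intro Bochner_Integration.integrable_sum integrable_mult_right Bochner_Integration.integrable_add integral_P integral_F_directional)
  have ZI: "(LINT \<xi>|lborel. Z \<xi>) = (2 * pi) ^ DIM('a) * 4 * mean_energy"
  proof -
    have "(LINT \<xi>|lborel. Z \<xi>) = (\<Sum>p\<in>I. c p * (2 * (LINT \<xi>|lborel. P (fst p) \<xi>) + 2 * (LINT \<xi>|lborel. (fst p \<bullet> \<xi>)\<^sup>2 * F \<xi>)))"
      unfolding Z_def using integral_P(1) integral_F_directional(1)
      by (subst Bochner_Integration.integral_sum) auto
    also have "\<dots> = (2 * pi) ^ DIM('a) * 4 * mean_energy"
      unfolding integral_P integral_F_directional mean_energy_def sum_distrib_left by (intro sum.cong) auto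
    finally show ?thesis .
  qed
  have sFi: "integrable lborel (\<lambda>\<xi>. s \<xi> * F \<xi>)"
  proof (rule Bochner_Integration.integrable_bound)
    show "integrable lborel (\<lambda>\<xi>. vol * s \<xi>)" using ps by simp
    show "(\<lambda>\<xi>. s \<xi> * F \<xi>) \<in> borel_measurable lborel" using sb integral_F(1) by (intro borel_measurable_times) auto
    show "AE \<xi> in lborel. norm (s \<xi> * F \<xi>) \<le> norm (vol * s \<xi>)"
    proof (rule AE_I2)
      fix \<xi>
      have "0 \<le> s \<xi>" by (simp add: s_def)
      then have "s \<xi> * F \<xi> \<le> s \<xi> * vol" "0 \<le> s \<xi> * F \<xi>" using F_bounds[of \<xi>] by (auto intro: mult_left_mono)
      then show "norm (s \<xi> * F \<xi>) \<le> norm (vol * s \<xi>)" by (simp add: mult.commute)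
    qed
  qed
  have sFI: "(2 * pi) ^ DIM('a) * (K * N - total_energy) \<le> (LINT \<xi>|lborel. s \<xi> * F \<xi>)"
  proof -
    have "(2 * pi) ^ DIM('a) * (K * N - total_energy) = (LINT \<xi>|lborel. K * F \<xi> - (norm \<xi>)\<^sup>2 * F \<xi>)"
      using integral_F integral_F_norm by (subst Bochner_Integration.integral_diff) (auto simp: algebra_simps)
    also have "\<dots> \<le> (LINT \<xi>|lborel. s \<xi> * F \<xi>)"
    proof (rule integral_mono)
      show "integrable lborel (\<lambda>\<xi>. K * F \<xi> - (norm \<xi>)\<^sup>2 * F \<xi>)" using integral_F integral_F_norm by auto
      fix \<xi> :: 'a
      have "(K - (norm \<xi>)\<^sup>2) * F \<xi> \<le> s \<xi> * F \<xi>" using F_bounds[of \<xi>] by (intro mult_right_mono) (auto simp: s_def)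
      then show "K * F \<xi> - (norm \<xi>)\<^sup>2 * F \<xi> \<le> s \<xi> * F \<xi>" by (simp add: left_diff_distrib)
    qed (rule sFi)
    finally show ?thesis .
  qed
  have pt: "vol / 2 * T \<xi> \<le> (1 + a) * (vol * s \<xi> - s \<xi> * F \<xi>) + R\<^sup>2 / (4 * a) * (2 * \<sigma>) * Z \<xi>" for \<xi>
  proof -
    have "vol / 2 * T \<xi> \<le> ((1 + a) * (vol - F \<xi>) + R\<^sup>2 / (4 * a) * Z \<xi>) * T \<xi>"
      using defect_lower_bound[OF a, of \<xi>] T(1) unfolding Z_def by (rule mult_right_mono)
    also have "\<dots> = (1 + a) * ((vol - F \<xi>) * T \<xi>) + R\<^sup>2 / (4 * a) * (T \<xi> * Z \<xi>)" by (simp add: algebra_simps)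
    also have "\<dots> \<le> (1 + a) * ((vol - F \<xi>) * s \<xi>) + R\<^sup>2 / (4 * a) * (2 * \<sigma> * Z \<xi>)"
      using T a Z0 F_bounds by (intro add_mono mult_left_mono mult_right_mono) auto
    finally show ?thesis by (simp add: algebra_simps)
  qed
  have "vol / 2 * (3 / 4 * \<sigma> * V) \<le> vol / 2 * (LINT \<xi>|lborel. T \<xi>)"
    using TI by (intro mult_left_mono) (auto simp: vol_def)
  also have "\<dots> = (LINT \<xi>|lborel. vol / 2 * T \<xi>)" by simp
  also have "\<dots> \<le> (LINT \<xi>|lborel. (1 + a) * (vol * s \<xi> - s \<xi> * F \<xi>) + R\<^sup>2 / (4 * a) * (2 * \<sigma>) * Z \<xi>)"
    using Ti ps sFi Zi pt
    by (intro integral_mono Bochner_Integration.integrable_add integrable_mult_right Bochner_Integration.integrable_diff) auto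
  also have "\<dots> = (1 + a) * (vol * (\<sigma> * V) - (LINT \<xi>|lborel. s \<xi> * F \<xi>)) + R\<^sup>2 / (4 * a) * (2 * \<sigma>) * ((2 * pi) ^ DIM('a) * 4 * mean_energy)"
    unfolding ZI[symmetric] ps(2)[symmetric] using ps(1) sFi Zi
    by (simp only: Bochner_Integration.integral_add Bochner_Integration.integral_diff Bochner_Integration.integrable_diff integrable_mult_right integral_mult_right_zero)
  also have "\<dots> \<le> (1 + a) * (vol * (\<sigma> * V) - (2 * pi) ^ DIM('a) * (K * N - total_energy)) + R\<^sup>2 / (4 * a) * (2 * \<sigma>) * ((2 * pi) ^ DIM('a) * 4 * mean_energy)"
    using sFI a by (intro add_right_mono mult_left_mono) auto
  finally have fin: "vol / 2 * (3 / 4 * \<sigma> * V) \<le> (1 + a) * (vol * (\<sigma> * V) - (2 * pi) ^ DIM('a) * (K * N - total_energy)) + R\<^sup>2 / (4 * a) * (2 * \<sigma>) * ((2 * pi) ^ DIM('a) * 4 * mean_energy)" .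
  have "vol / 2 * (3 / 4 * \<sigma> * V) = 3 / 8 * \<sigma> * (vol * V)" by simp
  also have "\<dots> = (2 * pi) ^ DIM('a) * (3 / 8 * \<sigma> * N)" unfolding V(2) by simp
  finally have l: "vol / 2 * (3 / 4 * \<sigma> * V) = (2 * pi) ^ DIM('a) * (3 / 8 * \<sigma> * N)" .
  have "vol * (\<sigma> * V) = \<sigma> * (vol * V)" by simp
  then have m: "vol * (\<sigma> * V) = (2 * pi) ^ DIM('a) * (\<sigma> * N)" unfolding V(2) by simp
  have "(2 * pi) ^ DIM('a) * (3 / 8 * \<sigma> * N) \<le> (2 * pi) ^ DIM('a) * ((1 + a) * (total_energy - K * N + \<sigma> * N) + 2 * R\<^sup>2 * \<sigma> / a * mean_energy)"
    using fin unfolding l m using a by (simp add: algebra_simps)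
  then show ?thesis by simp
qed

text \<open>The bathtub principle for the quadratic form \<open>\<rho> \<xi> = |\<xi>|\<^sup>2 - (n \<bullet> \<xi>)\<^sup>2 / 2\<close>, whose integral against \<open>F\<close> is the total energy minus
half the energy in the direction \<open>n\<close>. Halving one of the \<open>d\<close> directions lowers the minimum only by the factor
\<open>2 powr (- 1 / d) \<ge> 1 - ln 2 / d\<close>, and \<open>ln 2 \<le> 25/36\<close>.\<close>

lemma energy_le:
  fixes K \<sigma> :: real
  assumes K: "0 < K" "vol * unit_ball_vol DIM('a) * K powr (DIM('a) / 2) = (2 * pi) ^ DIM('a) * N" and n: "norm n = 1"
  defines "\<sigma> \<equiv> 2 * K / (real DIM('a) + 2)"
  shows "energy n \<le> 2 * (total_energy - (K * N - \<sigma> * N)) + 25 / 36 * \<sigma> * N"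
proof -
  define d where "d = real DIM('a)"
  have d: "0 < d" by (simp add: d_def)
  \<comment> \<open>with this \<open>K'\<close> the ellipsoid \<open>\<rho> \<xi> < K'\<close> has the volume of the ball \<open>|\<xi>|\<^sup>2 < K\<close>\<close>
  define K' where "K' = K * 2 powr (- 1 / d)"
  have K': "0 < K'" using K by (simp add: K'_def)
  define \<rho> where "\<rho> = (\<lambda>\<xi>::'a. (norm \<xi>)\<^sup>2 - (n \<bullet> \<xi>)\<^sup>2 / 2)"
  have r0: "0 \<le> \<rho> \<xi>" for \<xi>
  proof -
    have "\<bar>n \<bullet> \<xi>\<bar> \<le> norm \<xi>" using Cauchy_Schwarz_ineq2[of n \<xi>] n by simp
    then have "(n \<bullet> \<xi>)\<^sup>2 \<le> (norm \<xi>)\<^sup>2" using power_mono[of "\<bar>n \<bullet> \<xi>\<bar>" "norm \<xi>" 2] by simp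
    moreover have "0 \<le> (n \<bullet> \<xi>)\<^sup>2" by simp
    ultimately show ?thesis unfolding \<rho>_def by linarith
  qed
  have rm: "\<rho> \<in> borel_measurable borel" unfolding \<rho>_def by measurable
  have v: "emeasure lborel {\<xi>. \<rho> \<xi> < t} = ennreal (sqrt 2 * unit_ball_vol d * t powr (d / 2))" if "0 \<le> t" for t
    unfolding \<rho>_def d_def by (rule emeasure_ellipsoid[OF n that])
  have c: "0 \<le> sqrt 2 * unit_ball_vol d" "0 \<le> d / 2" "0 \<le> K'" using d K' by simp_all
  note I = integral_pos_part[OF rm r0 v c]
  have "(2 * pi) ^ DIM('a) * (K' * N - total_energy + energy n / 2) = (LINT \<xi>|lborel. K' * F \<xi> - (norm \<xi>)\<^sup>2 * F \<xi> + (n \<bullet> \<xi>)\<^sup>2 * F \<xi> / 2)"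
    using integral_F integral_F_norm integral_F_directional[of n] by (simp add: algebra_simps)
  also have "\<dots> \<le> (LINT \<xi>|lborel. vol * max 0 (K' - \<rho> \<xi>))"
  proof (rule integral_mono)
    show "integrable lborel (\<lambda>\<xi>. K' * F \<xi> - (norm \<xi>)\<^sup>2 * F \<xi> + (n \<bullet> \<xi>)\<^sup>2 * F \<xi> / 2)"
      using integral_F integral_F_norm integral_F_directional[of n] by auto
    show "integrable lborel (\<lambda>\<xi>. vol * max 0 (K' - \<rho> \<xi>))" using I by simp
    fix \<xi> :: 'a
    have "K' * F \<xi> - (norm \<xi>)\<^sup>2 * F \<xi> + (n \<bullet> \<xi>)\<^sup>2 * F \<xi> / 2 = (K' - \<rho> \<xi>) * F \<xi>" by (simp add: \<rho>_def algebra_simps)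
    also have "\<dots> \<le> max 0 (K' - \<rho> \<xi>) * F \<xi>" using F_bounds by (intro mult_right_mono) auto
    also have "\<dots> \<le> max 0 (K' - \<rho> \<xi>) * vol" using F_bounds by (intro mult_left_mono) auto
    finally show "K' * F \<xi> - (norm \<xi>)\<^sup>2 * F \<xi> + (n \<bullet> \<xi>)\<^sup>2 * F \<xi> / 2 \<le> vol * max 0 (K' - \<rho> \<xi>)" by (simp add: mult.commute)
  qed
  also have "\<dots> = vol * (sqrt 2 * unit_ball_vol d * K' powr (d / 2 + 1) / (d / 2 + 1))" using I by simp
  also have "\<dots> = (2 * pi) ^ DIM('a) * (2 / (d + 2) * K' * N)"
  proof -
    have "K' powr (d / 2 + 1) = K' powr (d / 2) * K'" using K' by (simp add: powr_add)
    also have "K' powr (d / 2) = K powr (d / 2) * (1 / sqrt 2)"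
    proof -
      have "K' powr (d / 2) = K powr (d / 2) * (2 powr (- 1 / d)) powr (d / 2)"
        unfolding K'_def by (rule powr_mult)
      also have "(2 powr (- 1 / d)) powr (d / 2) = 2 powr ((- 1 / d) * (d / 2))" by (rule powr_powr)
      also have "(- 1 / d) * (d / 2) = - (1 / 2)" using d by simp
      also have "(2::real) powr (- (1 / 2)) = inverse (2 powr (1 / 2))" by (rule powr_minus)
      also have "(2::real) powr (1 / 2) = sqrt 2" by (rule powr_half_sqrt) simp
      finally show ?thesis by (simp only: inverse_eq_divide)
    qed
    finally have "vol * (sqrt 2 * unit_ball_vol d * K' powr (d / 2 + 1) / (d / 2 + 1)) = vol * unit_ball_vol d * K powr (d / 2) * (K' / (d / 2 + 1))"
      by simp
    also have "\<dots> = (2 * pi) ^ DIM('a) * N * (K' / (d / 2 + 1))" using K(2) unfolding d_def by simp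
    also have "K' / (d / 2 + 1) = 2 / (d + 2) * K'" using d by (simp add: field_simps)
    finally show ?thesis by simp
  qed
  finally have "K' * N - total_energy + energy n / 2 \<le> 2 / (d + 2) * K' * N"
    by (rule mult_left_le_imp_le) simp
  then have e1: "energy n \<le> 2 * total_energy - 2 * (d / (d + 2) * N * K')"
    using d by (simp add: field_simps)
  have k: "K * (1 - 25 / 36 / d) \<le> K'"
  proof -
    have "ln 2 / d \<le> 25 / 36 / d" using d by (intro divide_right_mono ln2_le_25_over_36) simp
    then have "1 - 25 / 36 / d \<le> 1 + - ln 2 / d" unfolding minus_divide_left[symmetric] by linarith
    also have "\<dots> \<le> exp (- ln 2 / d)" by (rule exp_ge_add_one_self)
    also have "\<dots> = 2 powr (- 1 / d)" by (simp add: powr_def)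
    finally show ?thesis unfolding K'_def using K(1) by (intro mult_left_mono) auto
  qed
  have "d / (d + 2) * N * (K * (1 - 25 / 36 / d)) \<le> d / (d + 2) * N * K'" using k d by (intro mult_left_mono) auto
  moreover have "d / (d + 2) * N * (K * (1 - 25 / 36 / d)) = (K * N - \<sigma> * N) - 25 / 72 * \<sigma> * N"
  proof -
    define X where "X = N * K / (d + 2)"
    have "(d + 2) * X = K * N" using d by (simp add: X_def)
    then have X: "d * X + 2 * X = K * N" by (simp only: distrib_right)
    have sX: "\<sigma> * N = 2 * X" by (simp add: \<sigma>_def d_def[symmetric] X_def)
    have "d / (d + 2) * N * (K * (1 - 25 / 36 / d)) = (d * (1 - 25 / 36 / d)) * X" by (simp add: X_def)
    also have "d * (1 - 25 / 36 / d) = d - 25 / 36" using d by (simp add: right_diff_distrib)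
    also have "(d - 25 / 36) * X = (K * N - 2 * X) - 25 / 72 * (2 * X)" unfolding X[symmetric] by (simp add: left_diff_distrib)
    finally show ?thesis unfolding sX[symmetric] by (simp only: mult.assoc)
  qed
  ultimately show ?thesis using e1 by simp
qed

theorem total_energy_lower_bound:
  fixes K :: real
  assumes N: "0 < N" and K: "0 < K" "vol * unit_ball_vol DIM('a) * K powr (DIM('a) / 2) = (2 * pi) ^ DIM('a) * N"
  shows "real DIM('a) / (real DIM('a) + 2) * K * N + N / (64 * R\<^sup>2) \<le> total_energy"
proof -
  define \<sigma> where "\<sigma> = 2 * K / (real DIM('a) + 2)"
  have s0: "0 < \<sigma>" using K by (simp add: \<sigma>_def)
  have KN: "K * N - \<sigma> * N = real DIM('a) / (real DIM('a) + 2) * K * N" by (simp add: \<sigma>_def field_simps)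
  have Em: "mean_energy \<le> 2 * (total_energy - (K * N - \<sigma> * N)) + 25 / 36 * \<sigma> * N"
  proof -
    have "mean_energy \<le> (\<Sum>p\<in>I. c p * (2 * (total_energy - (K * N - \<sigma> * N)) + 25 / 36 * \<sigma> * N))"
      unfolding mean_energy_def using energy_le[OF K unit_normal] c_nonneg
      by (intro sum_mono mult_left_mono) (auto simp: \<sigma>_def)
    then show ?thesis by (simp add: c_sum flip: sum_distrib_right)
  qed
  define r where "r = R\<^sup>2 / N"
  have r: "0 < r" "r * N = R\<^sup>2" using R_pos N by (auto simp: r_def)
  have "1 / 64 \<le> r * (total_energy - (K * N - \<sigma> * N))"
  proof (rule spectral_arithmetic)
    show "1 / 4 \<le> r * mean_energy"
      using mean_energy_ge N by (simp add: r_def field_simps)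
    have "r * mean_energy \<le> r * (2 * (total_energy - (K * N - \<sigma> * N)) + 25 / 36 * \<sigma> * N)"
      using Em r by (intro mult_left_mono) auto
    also have "\<dots> = 2 * (r * (total_energy - (K * N - \<sigma> * N))) + 25 / 36 * (\<sigma> * (r * N))" by (simp add: algebra_simps)
    finally show "r * mean_energy \<le> 2 * (r * (total_energy - (K * N - \<sigma> * N))) + 25 / 36 * (\<sigma> * R\<^sup>2)" unfolding r(2) .
    show "0 < \<sigma> * R\<^sup>2" using s0 R_pos by simp
    fix a :: real assume a: "0 < a"
    have "r * (3 / 8 * \<sigma> * N) \<le> r * ((1 + a) * (total_energy - K * N + \<sigma> * N) + 2 * R\<^sup>2 * \<sigma> / a * mean_energy)"
      using total_energy_defect_bound[OF K a] r unfolding \<sigma>_def by (intro mult_left_mono) auto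
    also have "\<dots> = (1 + a) * (r * (total_energy - (K * N - \<sigma> * N))) + 2 * (\<sigma> * R\<^sup>2) * (r * mean_energy) / a"
      by (simp add: algebra_simps)
    also have "r * (3 / 8 * \<sigma> * N) = 3 / 8 * (\<sigma> * (r * N))" by simp
    finally show "3 / 8 * (\<sigma> * R\<^sup>2) \<le> (1 + a) * (r * (total_energy - (K * N - \<sigma> * N))) + 2 * (\<sigma> * R\<^sup>2) * (r * mean_energy) / a"
      unfolding r(2) .
  qed
  then have "N / (64 * R\<^sup>2) \<le> total_energy - (K * N - \<sigma> * N)"
    using R_pos N by (simp add: r_def field_simps)
  then show ?thesis unfolding KN by simp
qed

end

lemma test_functionsD:
  assumes "\<phi> \<in> test_functions \<Omega>"
  shows "C_k k \<phi>" "compact (closure {x. \<phi> x \<noteq> 0})" "closure {x. \<phi> x \<noteq> 0} \<subseteq> \<Omega>"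
  using assms by (simp_all only: test_functions_def mem_Collect_eq)

lemma test_function_partial:
  assumes "\<phi> \<in> test_functions \<Omega>"
  shows "\<phi> differentiable at x" "b \<in> Basis \<Longrightarrow> continuous_on UNIV (dderiv b \<phi>)"
proof -
  have "C_k (Suc 0) \<phi>" by (rule test_functionsD[OF assms])
  then show "\<phi> differentiable at x" "b \<in> Basis \<Longrightarrow> continuous_on UNIV (dderiv b \<phi>)"
    by (auto simp: dderiv_def[abs_def])
qed

lemma dderiv_eq_sum:
  assumes "f differentiable at x"
  shows "dderiv n f x = (\<Sum>b\<in>Basis. (n \<bullet> b) * dderiv b f x)"
proof -
  have l: "linear (frechet_derivative f (at x))" using linear_frechet_derivative[OF assms] .
  have "frechet_derivative f (at x) (\<Sum>b\<in>Basis. (n \<bullet> b) *\<^sub>R b) = (\<Sum>b\<in>Basis. (n \<bullet> b) *\<^sub>R frechet_derivative f (at x) b)"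
    by (simp add: linear_sum[OF l] linear_scale[OF l])
  then show ?thesis unfolding dderiv_def by (simp add: euclidean_representation)
qed

lemma test_function_C1c:
  assumes "\<phi> \<in> test_functions \<Omega>" shows "C1c \<phi>"
  unfolding C1c_def
proof (intro conjI allI)
  show "\<phi> differentiable at x" for x using test_function_partial[OF assms] by simp
  fix n
  have "continuous_on UNIV (\<lambda>x. \<Sum>b\<in>Basis. (n \<bullet> b) * dderiv b \<phi> x)"
    using test_function_partial(2)[OF assms] by (intro continuous_intros)
  then show "continuous_on UNIV (dderiv n \<phi>)"
    unfolding dderiv_eq_sum[OF test_function_partial(1)[OF assms], of n, abs_def] .
next
  have "C_k 0 \<phi>" by (rule test_functionsD[OF assms])
  then have c: "continuous_on UNIV \<phi>" by simp
  have z: "\<phi> x = 0" if "x \<notin> closure {x. \<phi> x \<noteq> 0}" for x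
  proof (rule ccontr)
    assume "\<phi> x \<noteq> 0"
    then have "x \<in> closure {x. \<phi> x \<noteq> 0}" by (intro subsetD[OF closure_subset]) simp
    with that show False ..
  qed
  show "compactly_supported \<phi>" by (rule compactly_supportedI[OF c test_functionsD(2)[OF assms] z])
qed

lemma test_function_outside:
  assumes "\<phi> \<in> test_functions \<Omega>" "x \<notin> \<Omega>"
  shows "\<phi> x = 0" "dderiv n \<phi> x = 0"
proof -
  let ?C = "closure {x. \<phi> x \<noteq> 0}"
  have x: "x \<notin> ?C" using test_functionsD(3)[OF assms(1)] assms(2) by blast
  have z: "\<phi> y = 0" if "y \<notin> ?C" for y
  proof (rule ccontr)
    assume "\<phi> y \<noteq> 0"
    then have "y \<in> ?C" by (intro subsetD[OF closure_subset]) simp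
    with that show False ..
  qed
  show "\<phi> x = 0" by (rule z[OF x])
  have "(\<phi> has_derivative (\<lambda>_. 0)) (at x)"
  proof (rule has_derivative_transform_within_open[where f="\<lambda>_. 0" and s="- ?C"])
    show "open (- ?C)" by (rule open_Compl[OF closed_closure])
    show "x \<in> - ?C" using x by (rule Compl_iff[THEN iffD2])
    show "0 = \<phi> y" if "y \<in> - ?C" for y by (rule z[OF ComplD[OF that], symmetric])
  qed simp
  then show "dderiv n \<phi> x = 0" by (rule dderiv_eqI)
qed

text \<open>The number \<open>K\<close> is the squared radius of the ball in frequency space that carries \<open>N\<close> functions at full density
\<open>v / (2\<pi>)\<^sup>d\<close>; the third part identifies the mean of \<open>|\<xi>|\<^sup>2\<close> over this ball, times \<open>N\<close>, with the first term of the bound.\<close>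

lemma li_yau_constant:
  fixes v :: real
  assumes v: "0 < v" and N: "0 < N"
  defines "K \<equiv> ((2 * pi) ^ DIM('a) * real N / (v * unit_ball_vol (real DIM('a::euclidean_space)))) powr (2 / real DIM('a))"
  shows "0 < K" "v * unit_ball_vol (real DIM('a)) * K powr (real DIM('a) / 2) = (2 * pi) ^ DIM('a) * real N"
    "real DIM('a) / (real DIM('a) + 2) * K * real N = C_const DIM('a) * v powr (- (2 / real DIM('a))) * real N powr (1 + 2 / real DIM('a))"
proof -
  define d where "d = real DIM('a)"
  have d: "0 < d" by (simp add: d_def)
  define X where "X = (2 * pi) ^ DIM('a) * real N / (v * unit_ball_vol d)"
  have K: "K = X powr (2 / d)" by (simp add: K_def X_def d_def)
  have w: "0 < unit_ball_vol d" using d by simp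
  have X: "0 < X" unfolding X_def using v N w by simp
  then show "0 < K" by (simp add: K)
  have "K powr (d / 2) = X" unfolding K powr_powr using X d by simp
  then show "v * unit_ball_vol (real DIM('a)) * K powr (real DIM('a) / 2) = (2 * pi) ^ DIM('a) * real N"
    using v w by (simp add: d_def[symmetric] X_def)
  have g: "0 < Gamma (d / 2 + 1)" using d by simp
  have "X = (2 * pi) powr d * real N * inverse v * (Gamma (d / 2 + 1) * inverse (pi powr (d / 2)))"
  proof -
    have "(2 * pi) powr d = (2 * pi) ^ DIM('a)" unfolding d_def by (rule powr_realpow) simp
    then show ?thesis unfolding X_def unit_ball_vol_def divide_inverse inverse_mult_distrib inverse_inverse_eq
      by (simp only: mult_ac)
  qed
  then have "K = ((2 * pi) powr d) powr (2 / d) * real N powr (2 / d) * (inverse v) powr (2 / d) * (Gamma (d / 2 + 1) powr (2 / d) * (inverse (pi powr (d / 2))) powr (2 / d))"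
    unfolding K by (simp only: powr_mult)
  also have "((2 * pi) powr d) powr (2 / d) = 4 * pi\<^sup>2"
  proof -
    have "((2 * pi) powr d) powr (2 / d) = (2 * pi) powr 2" unfolding powr_powr using d by simp
    also have "\<dots> = (2 * pi) ^ 2" using powr_realpow[of "2 * pi" 2] by simp
    also have "\<dots> = 4 * pi\<^sup>2" by (simp add: power_mult_distrib)
    finally show ?thesis .
  qed
  also have "(inverse (pi powr (d / 2))) powr (2 / d) = inverse pi"
  proof -
    have "(inverse (pi powr (d / 2))) powr (2 / d) = inverse ((pi powr (d / 2)) powr (2 / d))" by (simp add: inverse_powr)
    also have "(pi powr (d / 2)) powr (2 / d) = pi" unfolding powr_powr using d by simp
    finally show ?thesis .
  qed
  also have "(inverse v) powr (2 / d) = v powr (- (2 / d))" using v by (simp add: inverse_powr powr_minus)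
  finally have K2: "K = 4 * pi\<^sup>2 * real N powr (2 / d) * v powr (- (2 / d)) * (Gamma (d / 2 + 1) powr (2 / d) * inverse pi)" .
  have "d / (d + 2) * K * real N = 4 * pi * d / (d + 2) * Gamma (d / 2 + 1) powr (2 / d) * v powr (- (2 / d)) * (real N * real N powr (2 / d)) * (pi * inverse pi)"
    unfolding K2 by (simp add: power2_eq_square mult_ac)
  also have "real N * real N powr (2 / d) = real N powr (1 + 2 / d)" using N by (simp add: powr_add)
  also have "pi * inverse pi = 1" by simp
  finally show "real DIM('a) / (real DIM('a) + 2) * K * real N = C_const DIM('a) * v powr (- (2 / real DIM('a))) * real N powr (1 + 2 / real DIM('a))"
    by (simp add: C_const_def d_def)
qed

text \<open>The half-spaces exist for every \<open>R\<close> above the in-radius. The in-radius itself is reached as a limit.\<close>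

theorem test_function_energy_lower_bound:
  fixes \<Omega> :: "'a::euclidean_space set" and \<phi> :: "nat \<Rightarrow> 'a \<Rightarrow> real"
  assumes O: "open \<Omega>" "bounded \<Omega>" "convex \<Omega>" "\<Omega> \<noteq> {}" and N: "0 < N"
    and phi: "\<And>j. j < N \<Longrightarrow> \<phi> j \<in> test_functions \<Omega>"
    and orth: "\<And>i j. i < N \<Longrightarrow> j < N \<Longrightarrow> (LINT x|lborel. \<phi> i x * \<phi> j x) = (if i = j then 1 else 0)"
  shows "C_const DIM('a) * measure lborel \<Omega> powr (- (2 / real DIM('a))) * real N powr (1 + 2 / real DIM('a))
      + real N / (64 * (inradius \<Omega>)\<^sup>2) \<le> (\<Sum>j<N. \<Sum>b\<in>Basis. LINT x|lborel. (dderiv b (\<phi> j) x)\<^sup>2)"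
proof -
  define L where "L = C_const DIM('a) * measure lborel \<Omega> powr (- (2 / real DIM('a))) * real N powr (1 + 2 / real DIM('a))"
  define E where "E = (\<Sum>j<N. \<Sum>b\<in>Basis. LINT x|lborel. (dderiv b (\<phi> j) x)\<^sup>2)"
  have v: "0 < measure lborel \<Omega>"
  proof -
    obtain x e where e: "e > 0" "ball x e \<subseteq> \<Omega>" using O(1,4) open_contains_ball by (metis all_not_in_conv)
    have "0 < measure lborel (ball x e)" using content_ball_gt_0_iff[of x e] e by simp
    also have "\<dots> \<le> measure lborel \<Omega>"
      using e O emeasure_bounded_finite[OF O(2)] by (intro measure_mono_fmeasurable) (auto simp: fmeasurable_def)
    finally show ?thesis .
  qed
  have r: "0 < inradius \<Omega>" by (rule inradius_pos[OF O(1,2,4)])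
  have bound: "L + real N / (64 * R\<^sup>2) \<le> E" if R: "inradius \<Omega> < R" for R
  proof (rule balanced_supporting_halfspaces[OF O R])
    fix I :: "('a \<times> real) set" and c
    assume I: "finite I" "\<And>p. p \<in> I \<Longrightarrow> 0 \<le> c p" "\<And>p. p \<in> I \<Longrightarrow> norm (fst p) = 1"
      "\<And>p x. p \<in> I \<Longrightarrow> x \<in> \<Omega> \<Longrightarrow> fst p \<bullet> x \<le> snd p"
      "sum c I = 1" "(\<Sum>p\<in>I. c p *\<^sub>R fst p) = 0" "(\<Sum>p\<in>I. c p * snd p) = R"
    have R0: "0 < R" using r R by linarith
    interpret li_yau_setting \<Omega> I c R \<phi> N
    proof unfold_locales
      show "C1c (\<phi> j)" if "j < N" for j by (rule test_function_C1c[OF phi[OF that]])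
      show "\<phi> j x = 0" "dderiv n (\<phi> j) x = 0" if "j < N" "x \<notin> \<Omega>" for j x n
        by (rule test_function_outside[OF phi[OF that(1)] that(2)])+
    qed (fact O I R0 orth)+
    note K = li_yau_constant[where 'a='a, OF v N, folded vol_def]
    have "L + real N / (64 * R\<^sup>2) \<le> total_energy"
      using total_energy_lower_bound[OF N K(1,2)] unfolding K(3) by (simp only: L_def vol_def)
    also have "total_energy = E" unfolding total_energy_def energy_def E_def by (rule sum.swap)
    finally show ?thesis .
  qed
  have lim: "(\<lambda>n. L + real N / (64 * (inradius \<Omega> + inverse (real (Suc n)))\<^sup>2)) \<longlonglongrightarrow> L + real N / (64 * (inradius \<Omega> + 0)\<^sup>2)"
    using r by (intro tendsto_intros LIMSEQ_inverse_real_of_nat) simp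
  have "L + real N / (64 * (inradius \<Omega> + 0)\<^sup>2) \<le> E"
    by (rule LIMSEQ_le_const2[OF lim]) (use bound in auto)
  then show ?thesis by (simp add: L_def E_def)
qed

section \<open>Smooth bumps and the vanishing lemma\<close>

text \<open>The smooth step \<open>exp (- 1 / t)\<close> for \<open>t > 0\<close> with an additional polynomial factor in \<open>1 / t\<close>: this family is
closed under differentiation, so one differentiability lemma yields derivatives of all orders.\<close>

definition exp_step :: "real poly \<Rightarrow> real \<Rightarrow> real" where
  "exp_step p t = (if t \<le> 0 then 0 else poly p (1 / t) * exp (- (1 / t)))"

lemma poly_exp_neg_tendsto_0:
  fixes p :: "real poly"
  shows "((\<lambda>s. poly p s * exp (- s)) \<longlongrightarrow> 0) at_top"
proof (induction p)
  case 0
  show ?case by simp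
next
  case (pCons a p)
  have "((\<lambda>s. poly p s * exp (- s)) \<longlongrightarrow> 0) at_top" for p :: "real poly"
  proof -
    have "((\<lambda>s. \<Sum>i\<le>degree p. coeff p i * (s ^ i * exp (- s))) \<longlongrightarrow> (\<Sum>i\<le>degree p. coeff p i * 0)) at_top"
    proof (intro tendsto_sum tendsto_mult_left)
      fix i
      have "((\<lambda>s::real. s ^ i / exp s) \<longlongrightarrow> 0) at_top" by (rule tendsto_power_div_exp_0)
      then show "((\<lambda>s::real. s ^ i * exp (- s)) \<longlongrightarrow> 0) at_top" by (simp add: exp_minus divide_inverse)
    qed
    then show ?thesis by (simp add: poly_altdef sum_distrib_right mult.assoc)
  qed
  then show ?case .
qed

lemma exp_step_has_derivative:
  "(exp_step p has_real_derivative exp_step ((p - pderiv p) * [:0, 0, 1:]) t) (at t)"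
proof -
  consider "t > 0" | "t < 0" | "t = 0" by linarith
  then show ?thesis
  proof cases
    case 1
    have "((\<lambda>t. poly p (1 / t) * exp (- (1 / t))) has_real_derivative exp_step ((p - pderiv p) * [:0, 0, 1:]) t) (at t)"
      using 1 by (auto intro!: derivative_eq_intros simp: exp_step_def field_simps power2_eq_square)
    then show ?thesis
      by (rule has_field_derivative_transform_within_open[where S="{0<..}"]) (use 1 in \<open>auto simp: exp_step_def\<close>)
  next
    case 2
    have "((\<lambda>t. 0) has_real_derivative 0) (at t)" by simp
    then have "(exp_step p has_real_derivative 0) (at t)"
      by (rule has_field_derivative_transform_within_open[where S="{..<0}"]) (use 2 in \<open>auto simp: exp_step_def\<close>)
    then show ?thesis using 2 by (simp add: exp_step_def)
  next
    case 3
    have "((\<lambda>h. exp_step p h / h) \<longlongrightarrow> 0) (at 0)"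
    proof (rule filterlim_split_at)
      show "((\<lambda>h. exp_step p h / h) \<longlongrightarrow> 0) (at_left 0)"
        by (rule tendsto_eventually) (auto simp: exp_step_def eventually_at_filter)
      have "((\<lambda>s. poly (pCons 0 p) s * exp (- s)) \<longlongrightarrow> 0) at_top" by (rule poly_exp_neg_tendsto_0)
      then have "((\<lambda>h. poly (pCons 0 p) (inverse h) * exp (- inverse h)) \<longlongrightarrow> 0) (at_right 0)"
        by (rule filterlim_compose[OF _ filterlim_inverse_at_top_right])
      moreover have "\<forall>\<^sub>F h in at_right 0. poly (pCons 0 p) (inverse h) * exp (- inverse h) = exp_step p h / h"
        unfolding eventually_at_filter by (auto simp: exp_step_def divide_inverse)
      ultimately show "((\<lambda>h. exp_step p h / h) \<longlongrightarrow> 0) (at_right 0)" by (rule Lim_transform_eventually)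
    qed
    then show ?thesis using 3 by (simp add: DERIV_def exp_step_def)
  qed
qed

lemma C_k_add: "C_k k f \<Longrightarrow> C_k k g \<Longrightarrow> C_k k (\<lambda>x. f x + g x)"
proof (induction k arbitrary: f g)
  case 0
  then show ?case by (auto intro: continuous_intros)
next
  case (Suc k)
  have d: "(\<lambda>x. f x + g x) differentiable at x" for x using Suc.prems by (auto intro: differentiable_add)
  have e: "frechet_derivative (\<lambda>x. f x + g x) (at x) = (\<lambda>b. frechet_derivative f (at x) b + frechet_derivative g (at x) b)" for x
    using Suc.prems by (intro frechet_derivative_at[symmetric] has_derivative_add) (auto simp: frechet_derivative_works[symmetric])
  show ?case using Suc d by (simp add: e)
qed

lemma C_k_zero: "C_k k (\<lambda>x. 0)"
proof (induction k)
  case (Suc k)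
  have "frechet_derivative (\<lambda>x. 0) (at x) = (\<lambda>b. 0)" for x :: 'a
    by (rule frechet_derivative_at[symmetric]) (rule has_derivative_const)
  then show ?case using Suc by simp
qed simp

lemma C_k_sum: "(\<And>i. i \<in> I \<Longrightarrow> C_k k (f i)) \<Longrightarrow> C_k k (\<lambda>x. \<Sum>i\<in>I. f i x)"
  by (induction I rule: infinite_finite_induct) (auto simp: C_k_zero C_k_add)

lemma C_k_cmult: "C_k k f \<Longrightarrow> C_k k (\<lambda>x. c * f x)"
proof (induction k arbitrary: f)
  case 0
  then show ?case by (auto intro: continuous_intros)
next
  case (Suc k)
  have d: "(\<lambda>x. c * f x) differentiable at x" for x using Suc.prems by (auto intro: differentiable_mult)
  have e: "frechet_derivative (\<lambda>x. c * f x) (at x) = (\<lambda>b. c * frechet_derivative f (at x) b)" for x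
    using Suc.prems by (intro frechet_derivative_at[symmetric] has_derivative_mult_right) (auto simp: frechet_derivative_works[symmetric])
  show ?case using Suc d by (simp add: e)
qed

lemma exp_step_comp_has_derivative:
  "((\<lambda>x. exp_step p (v \<bullet> x + c)) has_derivative (\<lambda>n. exp_step ((p - pderiv p) * [:0, 0, 1:]) (v \<bullet> x + c) * (v \<bullet> n))) (at x)"
proof -
  have "((\<lambda>x. v \<bullet> x + c) has_derivative (\<lambda>n. v \<bullet> n)) (at x)" by (auto intro!: derivative_eq_intros)
  from diff_chain_at[OF this exp_step_has_derivative[THEN has_field_derivative_imp_has_derivative]]
  show ?thesis by (simp add: o_def)
qed

text \<open>The derivative of such a product is a linear combination of products of the same form with other polynomials,
so the induction on \<open>k\<close> is over all choices of the polynomials.\<close>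

lemma C_k_prod_exp_step:
  fixes v :: "nat \<Rightarrow> 'a::euclidean_space"
  assumes "finite I"
  shows "C_k k (\<lambda>x. \<Prod>i\<in>I. exp_step (p i) (v i \<bullet> x + c i))"
proof (induction k arbitrary: p)
  case 0
  have "continuous_on UNIV (\<lambda>x. exp_step (p i) (v i \<bullet> x + c i))" for i
    by (intro continuous_at_imp_continuous_on ballI has_derivative_continuous[OF exp_step_comp_has_derivative])
  then show ?case by (auto intro: continuous_on_prod)
next
  case (Suc k)
  define q where "q = (\<lambda>j i. if i = j then (p j - pderiv (p j)) * [:0, 0, 1:] else p i)"
  have d: "((\<lambda>x. \<Prod>i\<in>I. exp_step (p i) (v i \<bullet> x + c i)) has_derivative
     (\<lambda>n. \<Sum>j\<in>I. exp_step ((p j - pderiv (p j)) * [:0, 0, 1:]) (v j \<bullet> x + c j) * (v j \<bullet> n) * (\<Prod>i\<in>I - {j}. exp_step (p i) (v i \<bullet> x + c i)))) (at x)" for x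
    by (rule has_derivative_prod[OF exp_step_comp_has_derivative])
  have e: "frechet_derivative (\<lambda>x. \<Prod>i\<in>I. exp_step (p i) (v i \<bullet> x + c i)) (at x)
     = (\<lambda>n. \<Sum>j\<in>I. (v j \<bullet> n) * (\<Prod>i\<in>I. exp_step (q j i) (v i \<bullet> x + c i)))" for x
  proof
    fix n
    have "exp_step ((p j - pderiv (p j)) * [:0, 0, 1:]) (v j \<bullet> x + c j) * (v j \<bullet> n) * (\<Prod>i\<in>I - {j}. exp_step (p i) (v i \<bullet> x + c i))
      = (v j \<bullet> n) * (\<Prod>i\<in>I. exp_step (q j i) (v i \<bullet> x + c i))" if "j \<in> I" for j
    proof -
      have "(\<Prod>i\<in>I. exp_step (q j i) (v i \<bullet> x + c i)) = exp_step (q j j) (v j \<bullet> x + c j) * (\<Prod>i\<in>I - {j}. exp_step (q j i) (v i \<bullet> x + c i))"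
        using assms that by (rule prod.remove)
      also have "(\<Prod>i\<in>I - {j}. exp_step (q j i) (v i \<bullet> x + c i)) = (\<Prod>i\<in>I - {j}. exp_step (p i) (v i \<bullet> x + c i))"
        by (intro prod.cong) (auto simp: q_def)
      finally show ?thesis by (simp add: q_def mult_ac)
    qed
    then show "frechet_derivative (\<lambda>x. \<Prod>i\<in>I. exp_step (p i) (v i \<bullet> x + c i)) (at x) n
      = (\<Sum>j\<in>I. (v j \<bullet> n) * (\<Prod>i\<in>I. exp_step (q j i) (v i \<bullet> x + c i)))"
      unfolding frechet_derivative_at[OF d, symmetric] by (intro sum.cong) auto
  qed
  show ?case
    unfolding C_k.simps e
  proof (intro conjI allI ballI)
    show "(\<lambda>x. \<Prod>i\<in>I. exp_step (p i) (v i \<bullet> x + c i)) differentiable at x" for x by (rule differentiableI[OF d])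
    show "C_k k (\<lambda>x. \<Sum>j\<in>I. (v j \<bullet> b) * (\<Prod>i\<in>I. exp_step (q j i) (v i \<bullet> x + c i)))" for b
      by (intro C_k_sum C_k_cmult Suc)
  qed
qed

text \<open>The bump is a product of \<open>2 d\<close> steps, one for each face of the box, in the distances to the faces scaled by \<open>n + 1\<close>. On the box
each factor \<open>exp (- 1 / ((n + 1) t))\<close> tends to \<open>1\<close>.\<close>

lemma box_bump:
  fixes l u :: "'a::euclidean_space"
  assumes sub: "cbox l u \<subseteq> \<Omega>"
  obtains \<phi> where "\<And>n::nat. \<phi> n \<in> test_functions \<Omega>" "\<And>n x. 0 \<le> \<phi> n x" "\<And>n x. \<phi> n x \<le> indicator (box l u) x"
    "\<And>x. (\<lambda>n. \<phi> n x) \<longlonglongrightarrow> indicator (box l u) x"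
proof -
  obtain e :: "nat \<Rightarrow> 'a" where e: "bij_betw e {0..<DIM('a)} Basis" using ex_bij_betw_nat_finite[OF finite_Basis] by blast
  define d where "d = DIM('a)"
  have eB: "e i \<in> Basis" if "i < d" for i using e that unfolding bij_betw_def d_def by auto
  have eS: "\<exists>i<d. e i = b" if "b \<in> Basis" for b
  proof -
    have "b \<in> e ` {0..<d}" using that bij_betw_imp_surj_on[OF e] unfolding d_def by blast
    then show ?thesis by auto
  qed
  define v where "v = (\<lambda>(n::nat) i. real (Suc n) *\<^sub>R (if i < d then e i else - e (i - d)))"
  define c where "c = (\<lambda>(n::nat) i. real (Suc n) * (if i < d then - (l \<bullet> e i) else u \<bullet> e (i - d)))"
  define \<phi> where "\<phi> = (\<lambda>n x. \<Prod>i<2*d. exp_step 1 (v n i \<bullet> x + c n i))"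
  define t where "t = (\<lambda>x i. if i < d then (x - l) \<bullet> e i else (u - x) \<bullet> e (i - d))"
  have vt: "v n i \<bullet> x + c n i = real (Suc n) * t x i" for n i x
    by (simp add: v_def c_def t_def inner_diff_left inner_diff_right inner_commute algebra_simps del: of_nat_Suc)
  have st: "0 \<le> exp_step 1 s" "exp_step 1 s \<le> 1" for s by (auto simp: exp_step_def)
  have inbox: "x \<in> box l u \<longleftrightarrow> (\<forall>i<2*d. 0 < t x i)" for x
  proof
    assume x: "x \<in> box l u"
    show "\<forall>i<2*d. 0 < t x i"
    proof (intro allI impI)
      fix i assume "i < 2 * d"
      show "0 < t x i"
      proof (cases "i < d")
        case True then show ?thesis using x eB[OF True] by (auto simp: t_def mem_box inner_diff_left)
      next
        case False
        then have "i - d < d" using \<open>i < 2 * d\<close> by simp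
        then show ?thesis using False x eB[of "i - d"] by (auto simp: t_def mem_box inner_diff_left)
      qed
    qed
  next
    assume t: "\<forall>i<2*d. 0 < t x i"
    show "x \<in> box l u" unfolding mem_box
    proof
      fix b :: 'a assume "b \<in> Basis"
      then obtain i where i: "i < d" "e i = b" using eS by blast
      then have "0 < t x i" "0 < t x (i + d)" using t by auto
      then show "l \<bullet> b < x \<bullet> b \<and> x \<bullet> b < u \<bullet> b" using i by (simp add: t_def inner_diff_left)
    qed
  qed
  have out: "\<phi> n x = 0" if nx: "x \<notin> box l u" for n x
  proof -
    obtain i where i: "i < 2 * d" "\<not> 0 < t x i" using nx unfolding inbox by blast
    then have "real (Suc n) * t x i \<le> 0" by (intro mult_nonneg_nonpos) auto
    then have "exp_step 1 (v n i \<bullet> x + c n i) = 0" unfolding vt exp_step_def by simp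
    then show ?thesis unfolding \<phi>_def using i(1) by (intro prod_zero) auto
  qed
  show thesis
  proof (rule that[of \<phi>])
    fix n
    have "closure {x. \<phi> n x \<noteq> 0} \<subseteq> closure (box l u)" using out by (intro closure_mono) auto
    also have "\<dots> \<subseteq> cbox l u" by (rule closure_minimal[OF box_subset_cbox closed_cbox])
    finally have cl: "closure {x. \<phi> n x \<noteq> 0} \<subseteq> cbox l u" .
    have "compact (cbox l u \<inter> closure {x. \<phi> n x \<noteq> 0})" by (intro compact_Int_closed compact_cbox closed_closure)
    then have "compact (closure {x. \<phi> n x \<noteq> 0})" using cl by (simp add: inf_absorb2)
    moreover have "C_k k (\<phi> n)" for k unfolding \<phi>_def by (rule C_k_prod_exp_step) simp
    ultimately show "\<phi> n \<in> test_functions \<Omega>" using cl sub unfolding test_functions_def by simp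
  next
    fix n x show "0 \<le> \<phi> n x" unfolding \<phi>_def by (intro prod_nonneg) (simp add: st)
  next
    fix n x
    have "\<phi> n x \<le> 1" unfolding \<phi>_def by (intro prod_le_1) (simp add: st)
    then show "\<phi> n x \<le> indicator (box l u) x" using out[of x n] by (cases "x \<in> box l u") auto
  next
    fix x
    show "(\<lambda>n. \<phi> n x) \<longlonglongrightarrow> indicator (box l u) x"
    proof (cases "x \<in> box l u")
      case False then show ?thesis by (simp add: out)
    next
      case True
      have "(\<lambda>n. \<phi> n x) \<longlonglongrightarrow> (\<Prod>i<2*d. 1)"
        unfolding \<phi>_def
      proof (rule tendsto_prod)
        fix i assume "i \<in> {..<2*d}"
        then have ti: "0 < t x i" using True inbox by auto
        have "(\<lambda>n. exp (- (inverse (t x i) * inverse (real (Suc n))))) \<longlonglongrightarrow> exp (- (inverse (t x i) * 0))"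
          by (intro tendsto_intros LIMSEQ_inverse_real_of_nat)
        moreover have "exp_step 1 (v n i \<bullet> x + c n i) = exp (- (inverse (t x i) * inverse (real (Suc n))))" for n
        proof -
          have "0 < real (Suc n) * t x i" using ti by (intro mult_pos_pos) auto
          then show ?thesis unfolding vt exp_step_def by (simp add: divide_inverse mult.commute del: of_nat_Suc)
        qed
        ultimately show "(\<lambda>n. exp_step 1 (v n i \<bullet> x + c n i)) \<longlonglongrightarrow> 1" by simp
      qed
      then show ?thesis using True by simp
    qed
  qed
qed

text \<open>Boxes are stable under intersection and generate the Borel sets, so the integrals over all Borel subsets of a fixed
closed box in \<open>\<Omega>\<close> vanish. Countably many such boxes exhaust \<open>\<Omega>\<close>.\<close>

lemma AE_zero_of_box_integrals:
  fixes g :: "'a::euclidean_space \<Rightarrow> real"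
  assumes g: "integrable lborel g" and O: "open \<Omega>"
    and z: "\<And>l u. cbox l u \<subseteq> \<Omega> \<Longrightarrow> (LINT x|lborel. indicator (box l u) x * g x) = 0"
  shows "AE x in lborel. x \<in> \<Omega> \<longrightarrow> g x = 0"
proof -
  have iA: "integrable lborel (\<lambda>x. indicator A x * g x)" if "A \<in> sets borel" for A
    using integrable_mult_indicator[OF _ g, of A] that by simp
  have C: "AE x in lborel. x \<in> cbox a b \<longrightarrow> g x = 0" if ab: "cbox a b \<subseteq> \<Omega>" for a b
  proof -
    define f where "f = (\<lambda>x. indicator (box a b) x * g x)"
    have fi: "integrable lborel f" unfolding f_def by (rule iA) simp
    have fiA: "integrable lborel (\<lambda>x. indicator A x * f x)" if "A \<in> sets borel" for A
      using integrable_mult_indicator[OF _ fi, of A] that by simp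
    have fb: "(LINT x|lborel. indicator (box l u) x * f x) = 0" for l u
    proof -
      have "box l u \<inter> box a b = box (\<Sum>i\<in>Basis. max (l \<bullet> i) (a \<bullet> i) *\<^sub>R i) (\<Sum>i\<in>Basis. min (u \<bullet> i) (b \<bullet> i) *\<^sub>R i)"
        by (rule box_Int_box)
      moreover have "cbox (\<Sum>i\<in>Basis. max (l \<bullet> i) (a \<bullet> i) *\<^sub>R i) (\<Sum>i\<in>Basis. min (u \<bullet> i) (b \<bullet> i) *\<^sub>R i) \<subseteq> cbox a b"
        by (auto simp: mem_box)
      ultimately have "(LINT x|lborel. indicator (box l u \<inter> box a b) x * g x) = 0" using z ab by (metis subset_trans)
      then show ?thesis by (simp add: f_def indicator_inter_arith mult.assoc)
    qed
    have f0: "(LINT x|lborel. f x) = 0" using fb[of a b] by (simp add: f_def indicator_inter_arith[symmetric] mult.assoc[symmetric])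
    have all: "(LINT x|lborel. indicator A x * f x) = 0" if "A \<in> sets borel" for A
    proof -
      have A: "A \<in> sigma_sets UNIV (range (\<lambda>(a, b). box a b :: 'a set))"
        using that unfolding borel_eq_box by simp
      have sub: "range (\<lambda>(a, b). box a b :: 'a set) \<subseteq> Pow UNIV" by simp
      have ist: "Int_stable (range (\<lambda>(a, b). box a b :: 'a set))" by (auto simp: Int_stable_def box_Int_box)
      have meas: "B \<in> sets borel" if "B \<in> sigma_sets UNIV (range (\<lambda>(a, b). box a b :: 'a set))" for B
        using that unfolding borel_eq_box by simp
      show ?thesis
        using ist sub A
      proof (induction rule: sigma_sets_induct_disjoint)
        case (basic B)
        then show ?case using fb by auto
      next
        case empty
        show ?case by simp
      next
        case (compl B)
        have "(LINT x|lborel. indicator (UNIV - B) x * f x) = (LINT x|lborel. f x - indicator B x * f x)"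
          by (intro Bochner_Integration.integral_cong) (auto split: split_indicator)
        also have "\<dots> = 0" using fi fiA[OF meas[OF compl.hyps]] compl.IH f0 by simp
        finally show ?case .
      next
        case (union B)
        have m: "B i \<in> sets borel" for i using meas union.hyps by auto
        have "(\<lambda>n. LINT x|lborel. indicator (\<Union>i<n. B i) x * f x) \<longlonglongrightarrow> (LINT x|lborel. indicator (\<Union>i. B i) x * f x)"
        proof (rule integral_dominated_convergence[where w="\<lambda>x. \<bar>f x\<bar>"])
          show "AE x in lborel. (\<lambda>n. indicator (\<Union>i<n. B i) x * f x) \<longlonglongrightarrow> indicator (\<Union>i. B i) x * f x"
            by (intro AE_I2 tendsto_mult tendsto_const LIMSEQ_indicator_UN)
          show "AE x in lborel. norm (indicator (\<Union>i<n. B i) x * f x) \<le> \<bar>f x\<bar>" for n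
            by (auto split: split_indicator)
        qed (use fi m in auto)
        moreover have "(LINT x|lborel. indicator (\<Union>i<n. B i) x * f x) = 0" for n
        proof -
          have ue: "indicator (\<Union>i<n. B i) x * f x = (\<Sum>i<n. indicator (B i) x * f x)" for x
            using union.hyps(1) by (subst indicator_UN_disjoint) (auto simp: sum_distrib_right disjoint_family_on_def)
          have "(LINT x|lborel. indicator (\<Union>i<n. B i) x * f x) = (\<Sum>i<n. LINT x|lborel. indicator (B i) x * f x)"
            unfolding ue by (rule Bochner_Integration.integral_sum) (rule fiA[OF m])
          then show ?thesis using union.IH by simp
        qed
        ultimately show ?case by (simp add: LIMSEQ_const_iff)
      qed
    qed
    have "AE x in lborel. f x = 0"
      by (rule sigma_finite_measure.density_zero[OF sigma_finite_lborel fi]) (simp add: set_lebesgue_integral_def all)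
    moreover have "AE x in lborel. x \<notin> cbox a b - box a b"
    proof (rule AE_not_in)
      have "cbox a b - box a b \<in> null_sets lebesgue"
        using negligible_frontier_interval[of a b] by (simp add: negligible_iff_null_sets)
      then show "cbox a b - box a b \<in> null_sets lborel" by (simp add: null_sets_completion_iff)
    qed
    ultimately show ?thesis
    proof eventually_elim
      case (elim x)
      then show ?case by (cases "x \<in> box a b") (auto simp: f_def)
    qed
  qed
  obtain D where D: "countable D" "D \<subseteq> Pow \<Omega>" "\<And>X. X \<in> D \<Longrightarrow> \<exists>a b. X = cbox a b" "\<Union>D = \<Omega>"
    using open_countable_Union_open_cbox[OF O] by metis
  have "AE x in lborel. \<forall>X\<in>D. x \<in> X \<longrightarrow> g x = 0"
  proof (rule AE_ball_countable'[OF _ D(1)])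
    fix X assume X: "X \<in> D"
    then obtain a b where "X = cbox a b" using D(3) by blast
    then show "AE x in lborel. x \<in> X \<longrightarrow> g x = 0" using C[of a b] D(2) X by blast
  qed
  then show ?thesis using D(4) by (rule_tac eventually_mono) auto
qed

lemma lebesgue_on_integral_eq:
  fixes f :: "'a::euclidean_space \<Rightarrow> real"
  assumes "\<Omega> \<in> sets lebesgue" "f \<in> borel_measurable borel" "\<And>x. x \<notin> \<Omega> \<Longrightarrow> f x = 0"
  shows "(LINT x|lebesgue_on \<Omega>. f x) = (LINT x|lborel. f x)"
    "integrable (lebesgue_on \<Omega>) f \<longleftrightarrow> integrable lborel f"
proof -
  have e: "(\<lambda>x. indicator \<Omega> x *\<^sub>R f x) = f" using assms(3) by (auto simp: fun_eq_iff split: split_indicator)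
  show "(LINT x|lebesgue_on \<Omega>. f x) = (LINT x|lborel. f x)"
    using assms e by (simp add: integral_restrict_space integral_completion)
  show "integrable (lebesgue_on \<Omega>) f \<longleftrightarrow> integrable lborel f"
    using assms e by (simp add: integrable_restrict_space integrable_completion)
qed

text \<open>The fundamental lemma of the calculus of variations: indicators of boxes are limits of test functions. It gives the
uniqueness of weak gradients.\<close>

lemma AE_zero_of_test_integrals:
  fixes h :: "'a::euclidean_space \<Rightarrow> real"
  assumes O: "open \<Omega>" and h: "integrable (lebesgue_on \<Omega>) h"
    and z: "\<And>\<phi>. \<phi> \<in> test_functions \<Omega> \<Longrightarrow> (LINT x|lebesgue_on \<Omega>. h x * \<phi> x) = 0"
  shows "AE x in lebesgue_on \<Omega>. h x = 0"
proof -
  have OL: "\<Omega> \<inter> space lebesgue \<in> sets lebesgue" using O by (auto intro: sets_completionI_sets)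
  define k where "k = (\<lambda>x. indicator \<Omega> x * h x)"
  have ki: "integrable lebesgue k" using h OL by (simp add: integrable_restrict_space k_def)
  then obtain g where g: "g \<in> borel_measurable lborel" "AE x in lborel. k x = g x"
    using completion_ex_borel_measurable_real[of k lborel] by auto
  have kg: "AE x in lebesgue. k x = g x" using g(2) by (rule AE_completion)
  have gm: "g \<in> borel_measurable lebesgue" using g(1) by (simp add: measurable_completion)
  have "integrable lebesgue g" by (rule integrable_cong_AE_imp[OF ki gm kg])
  then have gi: "integrable lborel g" using integrable_completion[OF g(1)] by blast
  have tz: "(LINT x|lborel. g x * \<phi> x) = 0" if phi: "\<phi> \<in> test_functions \<Omega>" for \<phi>
  proof -
    have pm: "\<phi> \<in> borel_measurable borel"
      using C1c_continuous(1)[OF test_function_C1c[OF phi]] by (rule borel_measurable_continuous_onI)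
    have pmL: "\<phi> \<in> borel_measurable lebesgue" using pm by (simp add: measurable_completion)
    have "(LINT x|lborel. g x * \<phi> x) = (LINT x|lebesgue. g x * \<phi> x)"
      using g(1) pm by (subst integral_completion) auto
    also have "\<dots> = (LINT x|lebesgue. k x * \<phi> x)"
      using gm pmL ki kg by (intro integral_cong_AE) (auto elim: eventually_mono)
    also have "\<dots> = (LINT x|lebesgue_on \<Omega>. h x * \<phi> x)"
      using OL by (subst integral_restrict_space) (auto simp: k_def mult.assoc)
    also have "\<dots> = 0" by (rule z[OF phi])
    finally show ?thesis .
  qed
  have "AE x in lborel. x \<in> \<Omega> \<longrightarrow> g x = 0"
  proof (rule AE_zero_of_box_integrals[OF gi O])
    fix l u assume lu: "cbox l u \<subseteq> \<Omega>"
    show "(LINT x|lborel. indicator (box l u) x * g x) = 0"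
    proof (rule box_bump[OF lu])
      fix \<phi> :: "nat \<Rightarrow> 'a \<Rightarrow> real"
      assume phi: "\<And>n. \<phi> n \<in> test_functions \<Omega>" "\<And>n x. 0 \<le> \<phi> n x" "\<And>n x. \<phi> n x \<le> indicator (box l u) x"
        "\<And>x. (\<lambda>n. \<phi> n x) \<longlonglongrightarrow> indicator (box l u) x"
      have pm: "\<phi> n \<in> borel_measurable borel" for n
        using C1c_continuous(1)[OF test_function_C1c[OF phi(1)]] by (rule borel_measurable_continuous_onI)
      have "(\<lambda>n. LINT x|lborel. g x * \<phi> n x) \<longlonglongrightarrow> (LINT x|lborel. g x * indicator (box l u) x)"
      proof (rule integral_dominated_convergence[where w="\<lambda>x. \<bar>g x\<bar>"])
        show "AE x in lborel. (\<lambda>n. g x * \<phi> n x) \<longlonglongrightarrow> g x * indicator (box l u) x"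
          by (intro AE_I2 tendsto_mult tendsto_const phi(4))
        show "AE x in lborel. norm (g x * \<phi> n x) \<le> \<bar>g x\<bar>" for n
        proof (rule AE_I2)
          fix x
          have "\<phi> n x \<le> 1" using phi(3)[of n x] indicator_le_1[of "box l u" x] by (rule order_trans)
          then show "norm (g x * \<phi> n x) \<le> \<bar>g x\<bar>" using phi(2)[of n x] by (simp add: abs_mult mult_left_le)
        qed
        show "(\<lambda>x. g x * indicator (box l u) x) \<in> borel_measurable lborel" using g(1) by measurable
        show "(\<lambda>x. g x * \<phi> n x) \<in> borel_measurable lborel" for n using g(1) pm[of n] by measurable
        show "integrable lborel (\<lambda>x. \<bar>g x\<bar>)" using gi by simp
      qed
      then show ?thesis unfolding tz[OF phi(1)] by (simp add: LIMSEQ_const_iff mult.commute)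
    qed
  qed
  then have "AE x in lebesgue. x \<in> \<Omega> \<longrightarrow> g x = 0" by (rule AE_completion)
  then have "AE x in lebesgue. x \<in> \<Omega> \<longrightarrow> h x = 0"
    using kg by eventually_elim (auto simp: k_def)
  then show ?thesis using OL by (simp add: AE_restrict_space_iff)
qed

section \<open>Semi-inner products: Gram-Schmidt and approximation\<close>

text \<open>Functions that agree almost everywhere are not identified, so the forms are only semi-definite. The form is required to be
bilinear only on \<open>V\<close>, because the integrals defining it have their meaning only there.\<close>

locale semi_inner =
  fixes V :: "('x \<Rightarrow> real) set" and B :: "('x \<Rightarrow> real) \<Rightarrow> ('x \<Rightarrow> real) \<Rightarrow> real"
  assumes zero_mem: "(\<lambda>x. 0) \<in> V"
    and lin_mem: "\<And>u v a b. u \<in> V \<Longrightarrow> v \<in> V \<Longrightarrow> (\<lambda>x. a * u x + b * v x) \<in> V"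
    and B_lin: "\<And>u v w a b. u \<in> V \<Longrightarrow> v \<in> V \<Longrightarrow> w \<in> V \<Longrightarrow> B (\<lambda>x. a * u x + b * v x) w = a * B u w + b * B v w"
    and B_sym: "\<And>u v. u \<in> V \<Longrightarrow> v \<in> V \<Longrightarrow> B u v = B v u"
    and B_nonneg: "\<And>u. u \<in> V \<Longrightarrow> 0 \<le> B u u"
begin

definition nrm :: "('x \<Rightarrow> real) \<Rightarrow> real" where "nrm u = sqrt (B u u)"

lemma nrm_nonneg: "u \<in> V \<Longrightarrow> 0 \<le> nrm u" and nrm_square: "u \<in> V \<Longrightarrow> (nrm u)\<^sup>2 = B u u"
  by (simp_all add: nrm_def B_nonneg)

lemma B_lin_right: "u \<in> V \<Longrightarrow> v \<in> V \<Longrightarrow> w \<in> V \<Longrightarrow> B w (\<lambda>x. a * u x + b * v x) = a * B w u + b * B w v"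
  using B_lin[of u v w a b] B_sym[of w] lin_mem[of u v a b] by simp

lemma B_zero: "w \<in> V \<Longrightarrow> B (\<lambda>x. 0) w = 0"
  using B_lin[OF zero_mem zero_mem, of w 0 0] by simp

lemma B_quadratic: "u \<in> V \<Longrightarrow> v \<in> V \<Longrightarrow>
  B (\<lambda>x. a * u x + b * v x) (\<lambda>x. a * u x + b * v x) = a\<^sup>2 * B u u + 2 * a * b * B u v + b\<^sup>2 * B v v"
  using B_lin[OF _ _ lin_mem] B_lin_right lin_mem B_sym by (simp add: power2_eq_square algebra_simps)

lemma cauchy_schwarz: assumes "u \<in> V" "v \<in> V" shows "\<bar>B u v\<bar> \<le> nrm u * nrm v"
proof -
  have q: "0 \<le> a\<^sup>2 * B u u + 2 * a * b * B u v + b\<^sup>2 * B v v" for a b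
    unfolding B_quadratic[OF assms, symmetric] by (rule B_nonneg[OF lin_mem[OF assms]])
  have "(B u v)\<^sup>2 \<le> B u u * B v v"
  proof (cases "B v v = 0")
    case True
    have "B u v = 0"
    proof (rule ccontr)
      assume n: "B u v \<noteq> 0"
      have "0 \<le> 1\<^sup>2 * B u u + 2 * 1 * (- (B u u + 1) / (2 * B u v)) * B u v + (- (B u u + 1) / (2 * B u v))\<^sup>2 * B v v" by (rule q)
      also have "\<dots> = - 1" using n True by (simp add: field_simps)
      finally show False by simp
    qed
    then show ?thesis using B_nonneg assms by simp
  next
    case False
    then have p: "0 < B v v" using B_nonneg[OF assms(2)] by simp
    have "0 \<le> (B v v)\<^sup>2 * B u u + 2 * B v v * (- B u v) * B u v + (- B u v)\<^sup>2 * B v v" by (rule q)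
    also have "\<dots> = B v v * (B u u * B v v - (B u v)\<^sup>2)" by (simp add: power2_eq_square algebra_simps)
    finally show ?thesis using p by (simp add: zero_le_mult_iff)
  qed
  then have "sqrt ((B u v)\<^sup>2) \<le> sqrt (B u u * B v v)" by (rule real_sqrt_le_mono)
  then show ?thesis by (simp add: nrm_def real_sqrt_mult)
qed

lemma nrm_lin: assumes "u \<in> V" "v \<in> V" shows "nrm (\<lambda>x. a * u x + b * v x) \<le> \<bar>a\<bar> * nrm u + \<bar>b\<bar> * nrm v"
proof (rule power2_le_imp_le)
  show "0 \<le> \<bar>a\<bar> * nrm u + \<bar>b\<bar> * nrm v" using assms by (simp add: nrm_nonneg)
  have "a * b * B u v \<le> \<bar>a * b\<bar> * (nrm u * nrm v)"
    using cauchy_schwarz[OF assms] abs_le_D1[of "a * b * B u v"] by (simp add: abs_mult mult_left_mono mult.assoc)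
  then show "(nrm (\<lambda>x. a * u x + b * v x))\<^sup>2 \<le> (\<bar>a\<bar> * nrm u + \<bar>b\<bar> * nrm v)\<^sup>2"
    unfolding nrm_square[OF lin_mem[OF assms]] B_quadratic[OF assms]
    by (simp add: power2_sum power_mult_distrib nrm_square assms abs_mult algebra_simps)
qed

lemma sum_mem: "(\<And>i. i \<in> I \<Longrightarrow> u i \<in> V) \<Longrightarrow> (\<lambda>x. \<Sum>i\<in>I. c i * u i x) \<in> V"
proof (induction I rule: infinite_finite_induct)
  case (insert i I)
  then have "(\<lambda>x. c i * u i x + 1 * (\<Sum>i\<in>I. c i * u i x)) \<in> V" by (intro lin_mem) auto
  then show ?case using insert.hyps by simp
qed (simp_all add: zero_mem)

lemma B_sum: "(\<And>i. i \<in> I \<Longrightarrow> u i \<in> V) \<Longrightarrow> w \<in> V \<Longrightarrow> B (\<lambda>x. \<Sum>i\<in>I. c i * u i x) w = (\<Sum>i\<in>I. c i * B (u i) w)"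
proof (induction I rule: infinite_finite_induct)
  case (insert i I)
  then have "B (\<lambda>x. c i * u i x + 1 * (\<Sum>i\<in>I. c i * u i x)) w = c i * B (u i) w + 1 * B (\<lambda>x. \<Sum>i\<in>I. c i * u i x) w"
    by (intro B_lin sum_mem) auto
  then show ?case using insert by simp
qed (simp_all add: B_zero)

definition orthonormal :: "nat \<Rightarrow> (nat \<Rightarrow> 'x \<Rightarrow> real) \<Rightarrow> bool" where
  "orthonormal n f \<longleftrightarrow> (\<forall>i<n. f i \<in> V) \<and> (\<forall>i<n. \<forall>j<n. B (f i) (f j) = (if i = j then 1 else 0))"

text \<open>One step of the Gram-Schmidt process.\<close>

lemma orthonormal_extend:
  assumes f: "orthonormal n f" and e: "e \<in> V"
  defines "\<eta> \<equiv> (\<lambda>x. e x - (\<Sum>i<n. B e (f i) * f i x))"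
  shows "\<eta> \<in> V" "\<And>j. j < n \<Longrightarrow> B \<eta> (f j) = 0"
    "0 < B \<eta> \<eta> \<Longrightarrow> orthonormal (Suc n) (f(n := (\<lambda>x. \<eta> x / nrm \<eta>)))"
proof -
  have fV: "\<And>i. i < n \<Longrightarrow> f i \<in> V" and fo: "\<And>i j. i < n \<Longrightarrow> j < n \<Longrightarrow> B (f i) (f j) = (if i = j then 1 else 0)"
    using f unfolding orthonormal_def by auto
  have eq: "\<eta> = (\<lambda>x. 1 * e x + (- 1) * (\<Sum>i<n. B e (f i) * f i x))" by (simp add: \<eta>_def)
  have sV: "(\<lambda>x. \<Sum>i<n. B e (f i) * f i x) \<in> V" using fV by (intro sum_mem) auto
  show xV: "\<eta> \<in> V" unfolding eq by (intro lin_mem e sV)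
  show o: "B \<eta> (f j) = 0" if "j < n" for j
  proof -
    have "B \<eta> (f j) = 1 * B e (f j) + (- 1) * B (\<lambda>x. \<Sum>i<n. B e (f i) * f i x) (f j)"
      unfolding eq by (rule B_lin[OF e sV fV[OF that]])
    also have "B (\<lambda>x. \<Sum>i<n. B e (f i) * f i x) (f j) = (\<Sum>i<n. B e (f i) * B (f i) (f j))"
      using fV that by (intro B_sum) auto
    also have "\<dots> = (\<Sum>i<n. if i = j then B e (f i) else 0)" using fo that by (intro sum.cong) auto
    finally show ?thesis using that by simp
  qed
  assume p: "0 < B \<eta> \<eta>"
  then have n0: "0 < nrm \<eta>" by (simp add: nrm_def)
  let ?h = "\<lambda>x. \<eta> x / nrm \<eta>"
  have h: "?h = (\<lambda>x. (1 / nrm \<eta>) * \<eta> x + 0 * \<eta> x)" by simp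
  have hV: "?h \<in> V" unfolding h by (intro lin_mem xV)
  have hB: "B ?h w = B \<eta> w / nrm \<eta>" if "w \<in> V" for w
    unfolding h using B_lin[OF xV xV that, of "1 / nrm \<eta>" 0] by simp
  have "B ?h ?h = 1"
  proof -
    have "B ?h ?h = B \<eta> ?h / nrm \<eta>" by (rule hB[OF hV])
    also have "B \<eta> ?h = B ?h \<eta>" by (rule B_sym[OF xV hV])
    also have "\<dots> = B \<eta> \<eta> / nrm \<eta>" by (rule hB[OF xV])
    also have "\<dots> / nrm \<eta> = 1" using n0 unfolding nrm_square[OF xV, symmetric] by (simp add: power2_eq_square)
    finally show ?thesis .
  qed
  moreover have "B ?h (f j) = 0" "B (f j) ?h = 0" if "j < n" for j
    using hB[OF fV[OF that]] o[OF that] B_sym[OF hV fV[OF that]] by auto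
  ultimately show "orthonormal (Suc n) (f(n := ?h))"
    using fV fo hV unfolding orthonormal_def by (auto simp: less_Suc_eq)
qed

text \<open>The explicit combinations are recorded because equations that are linear in each \<open>e i\<close>, such as the eigenvalue equation,
are then inherited by the new basis.\<close>

lemma orthonormal_basis_exists:
  assumes e: "\<And>i. i < n \<Longrightarrow> e i \<in> V"
    and indep: "\<And>c. B (\<lambda>x. \<Sum>i<n. c i * e i x) (\<lambda>x. \<Sum>i<n. c i * e i x) = 0 \<Longrightarrow> \<forall>i<n. c i = 0"
  shows "\<exists>f. orthonormal n f \<and> (\<forall>i<n. \<exists>t. f i = (\<lambda>x. \<Sum>j<n. t j * e j x))"
proof -
  have "\<exists>f. orthonormal m f \<and> (\<forall>i<m. \<exists>t. f i = (\<lambda>x. \<Sum>j<m. t j * e j x))" if "m \<le> n" for m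
    using that
  proof (induction m)
    case 0
    show ?case by (auto simp: orthonormal_def)
  next
    case (Suc m)
    then obtain f where f: "orthonormal m f" "\<forall>i<m. \<exists>t. f i = (\<lambda>x. \<Sum>j<m. t j * e j x)" by auto
    then obtain t where t: "\<And>i. i < m \<Longrightarrow> f i = (\<lambda>x. \<Sum>j<m. t i j * e j x)" by metis
    have em: "e m \<in> V" using Suc.prems e by simp
    define \<eta> where "\<eta> = (\<lambda>x. e m x - (\<Sum>i<m. B (e m) (f i) * f i x))"
    define s where "s = (\<lambda>j. if j = m then 1 else if j < m then - (\<Sum>i<m. B (e m) (f i) * t i j) else 0)"
    have X1: "\<eta> \<in> V" using orthonormal_extend(1)[OF f(1) em] unfolding \<eta>_def .
    have X3: "0 < B \<eta> \<eta> \<Longrightarrow> orthonormal (Suc m) (f(m := (\<lambda>x. \<eta> x / nrm \<eta>)))"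
      using orthonormal_extend(3)[OF f(1) em] unfolding \<eta>_def .
    have xs: "\<eta> = (\<lambda>x. \<Sum>j<Suc m. s j * e j x)"
    proof
      fix x
      have "(\<Sum>i<m. B (e m) (f i) * f i x) = (\<Sum>i<m. \<Sum>j<m. B (e m) (f i) * t i j * e j x)"
        by (intro sum.cong refl) (simp add: t sum_distrib_left mult.assoc)
      also have "\<dots> = (\<Sum>j<m. (\<Sum>i<m. B (e m) (f i) * t i j) * e j x)"
        by (subst sum.swap) (simp add: sum_distrib_right)
      finally have 1: "\<eta> x = e m x - (\<Sum>j<m. (\<Sum>i<m. B (e m) (f i) * t i j) * e j x)" by (simp only: \<eta>_def)
      have sm: "s m = 1" by (simp add: s_def)
      have "(\<Sum>j<m. s j * e j x) = (\<Sum>j<m. - ((\<Sum>i<m. B (e m) (f i) * t i j) * e j x))"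
        by (intro sum.cong refl) (simp add: s_def)
      then show "\<eta> x = (\<Sum>j<Suc m. s j * e j x)"
        unfolding 1 sum.lessThan_Suc sm sum_negf by simp
    qed
    have "B \<eta> \<eta> \<noteq> 0"
    proof
      assume z: "B \<eta> \<eta> = 0"
      have eqn: "\<eta> = (\<lambda>x. \<Sum>j<n. s j * e j x)"
        unfolding xs using Suc.prems by (intro ext sum.mono_neutral_left) (auto simp: s_def)
      from z[unfolded eqn] have "\<forall>i<n. s i = 0" by (rule indep)
      then have "s m = 0" using Suc.prems by simp
      then show False by (simp add: s_def)
    qed
    then have p: "0 < B \<eta> \<eta>" using B_nonneg[OF X1] by simp
    let ?f = "f(m := (\<lambda>x. \<eta> x / nrm \<eta>))"
    have "\<exists>t. ?f i = (\<lambda>x. \<Sum>j<Suc m. t j * e j x)" if "i < Suc m" for i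
    proof (cases "i = m")
      case True
      have "(\<lambda>x. \<eta> x / nrm \<eta>) = (\<lambda>x. \<Sum>j<Suc m. (s j / nrm \<eta>) * e j x)"
        unfolding xs by (simp add: sum_divide_distrib add_divide_distrib)
      then show ?thesis using True by (intro exI[of _ "\<lambda>j. s j / nrm \<eta>"]) (simp only: fun_upd_same)
    next
      case False
      then have "?f i = (\<lambda>x. \<Sum>j<Suc m. (if j < m then t i j else 0) * e j x)" using that t[of i] by simp
      then show ?thesis by (rule exI[of _ "\<lambda>j. if j < m then t i j else 0"])
    qed
    then have "\<forall>i<Suc m. \<exists>t. ?f i = (\<lambda>x. \<Sum>j<Suc m. t j * e j x)" by blast
    with X3[OF p] show ?case by (intro exI[of _ ?f] conjI)
  qed
  then show ?thesis by blast
qed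

end

text \<open>Gram-Schmidt for \<open>A\<close> is applied to arbitrary approximants in \<open>T\<close>. As these converge in the stronger norm of \<open>B\<close>, their
\<open>A\<close>-products converge to those of the orthonormal limit; hence the corrections made by Gram-Schmidt tend to
\<open>0\<close>, and convergence in the norm of \<open>B\<close> is preserved.\<close>

lemma orthonormal_approximation:
  assumes A: "semi_inner V A" and Bi: "semi_inner V B"
    and AB: "\<And>u. u \<in> V \<Longrightarrow> A u u \<le> B u u"
    and T: "T \<subseteq> V" "\<And>u v a b. u \<in> T \<Longrightarrow> v \<in> T \<Longrightarrow> (\<lambda>x. a * u x + b * v x) \<in> T" "(\<lambda>x. 0) \<in> T"
    and u: "semi_inner.orthonormal V A N u"
    and dense: "\<And>i e. i < N \<Longrightarrow> 0 < e \<Longrightarrow> \<exists>\<phi>\<in>T. semi_inner.nrm B (\<lambda>x. u i x - \<phi> x) < e"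
  shows "\<exists>\<psi>. (\<forall>n i. i < N \<longrightarrow> \<psi> n i \<in> T) \<and> (\<forall>\<^sub>F n in sequentially. semi_inner.orthonormal V A N (\<psi> n))
     \<and> (\<forall>i<N. (\<lambda>n. semi_inner.nrm B (\<lambda>x. u i x - \<psi> n i x)) \<longlonglongrightarrow> 0)"
proof -
  interpret A: semi_inner V A by (rule A)
  interpret B: semi_inner V B by (rule Bi)
  have uV: "\<And>i. i < N \<Longrightarrow> u i \<in> V" and uo: "\<And>i j. i < N \<Longrightarrow> j < N \<Longrightarrow> A (u i) (u j) = (if i = j then 1 else 0)"
    using u unfolding A.orthonormal_def by auto
  have AleB: "A.nrm w \<le> B.nrm w" if "w \<in> V" for w
    unfolding A.nrm_def B.nrm_def using AB[OF that] by simp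
  have Acs: "\<bar>A v w\<bar> \<le> B.nrm v * B.nrm w" if "v \<in> V" "w \<in> V" for v w
    using A.cauchy_schwarz[OF that] AleB that A.nrm_nonneg B.nrm_nonneg
    by (meson mult_mono order_trans)
  have dm: "(\<lambda>x. v x - w x) \<in> V" if "v \<in> V" "w \<in> V" for v w
    using A.lin_mem[OF that, of 1 "-1"] by simp
  have "m \<le> N \<Longrightarrow> \<exists>\<psi>. (\<forall>n i. i < m \<longrightarrow> \<psi> n i \<in> T) \<and> (\<forall>\<^sub>F n in sequentially. A.orthonormal m (\<psi> n))
     \<and> (\<forall>i<m. (\<lambda>n. B.nrm (\<lambda>x. u i x - \<psi> n i x)) \<longlonglongrightarrow> 0)" for m
  proof (induction m)
    case 0
    show ?case by (auto simp: A.orthonormal_def)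
  next
    case (Suc m)
    then obtain \<psi> where psi: "\<And>n i. i < m \<Longrightarrow> \<psi> n i \<in> T" "\<forall>\<^sub>F n in sequentially. A.orthonormal m (\<psi> n)"
      "\<And>i. i < m \<Longrightarrow> (\<lambda>n. B.nrm (\<lambda>x. u i x - \<psi> n i x)) \<longlonglongrightarrow> 0" by auto
    have mN: "m < N" using Suc.prems by simp
    note um = uV[OF mN]
    have "\<forall>n. \<exists>\<phi>\<in>T. B.nrm (\<lambda>x. u m x - \<phi> x) < inverse (real (Suc n))" using dense[OF mN] by simp
    then obtain \<phi> where phi: "\<And>n. \<phi> n \<in> T" "\<And>n. B.nrm (\<lambda>x. u m x - \<phi> n x) < inverse (real (Suc n))" by metis
    have pV: "\<psi> n i \<in> V" if "i < m" for n i using psi(1)[OF that] T(1) by blast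
    have fV: "\<phi> n \<in> V" for n using phi(1) T(1) by blast
    have phi0: "(\<lambda>n. B.nrm (\<lambda>x. u m x - \<phi> n x)) \<longlonglongrightarrow> 0"
      by (rule tendsto_sandwich[OF _ _ tendsto_const LIMSEQ_inverse_real_of_nat])
        (use phi(2) B.nrm_nonneg[OF dm[OF um fV]] in \<open>auto intro: always_eventually less_imp_le\<close>)
    define c where "c = (\<lambda>n i. A (\<phi> n) (\<psi> n i))"
    \<comment> \<open>the part of \<open>\<phi> n\<close> that is \<open>A\<close>-orthogonal to the approximants already found\<close>
    define \<eta> where "\<eta> = (\<lambda>n x. \<phi> n x - (\<Sum>i<m. c n i * \<psi> n i x))"
    have sT: "(\<lambda>x. \<Sum>i\<in>J. k i * \<psi> n i x) \<in> T" if "finite J" "J \<subseteq> {..<m}" for J k n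
      using that
    proof (induction J rule: finite_induct)
      case (insert i J)
      then have "(\<lambda>x. k i * \<psi> n i x + 1 * (\<Sum>i\<in>J. k i * \<psi> n i x)) \<in> T" by (intro T(2) psi(1)) auto
      then show ?case using insert.hyps by simp
    qed (simp add: T(3))
    have xT: "\<eta> n \<in> T" for n
      using T(2)[OF phi(1) sT[of "{..<m}"], of 1 n "-1" "c n" n] by (simp add: \<eta>_def)
    have xV: "\<eta> n \<in> V" for n using xT T(1) by blast
    have pbd: "B.nrm (\<psi> n i) \<le> B.nrm (u i) + B.nrm (\<lambda>x. u i x - \<psi> n i x)" if i: "i < m" for n i
    proof -
      have iN: "i < N" using i mN by simp
      have "B.nrm (\<lambda>x. 1 * u i x + (- 1) * (u i x - \<psi> n i x)) \<le> \<bar>1\<bar> * B.nrm (u i) + \<bar>- 1\<bar> * B.nrm (\<lambda>x. u i x - \<psi> n i x)"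
        by (intro B.nrm_lin uV iN dm pV i)
      then show ?thesis by simp
    qed
    have c0: "(\<lambda>n. c n i) \<longlonglongrightarrow> 0" if i: "i < m" for i
    proof (rule Lim_null_comparison)
      have iN: "i < N" using i mN by simp
      let ?g = "\<lambda>n. B.nrm (\<lambda>x. u m x - \<phi> n x) * (B.nrm (u i) + B.nrm (\<lambda>x. u i x - \<psi> n i x)) + B.nrm (u m) * B.nrm (\<lambda>x. u i x - \<psi> n i x)"
      have "?g \<longlonglongrightarrow> 0 * (B.nrm (u i) + 0) + B.nrm (u m) * 0"
        by (intro tendsto_intros phi0 psi(3) i)
      then show "?g \<longlonglongrightarrow> 0" by simp
      show "\<forall>\<^sub>F n in sequentially. norm (c n i) \<le> ?g n"
      proof (intro always_eventually allI)
        fix n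
        let ?d = "\<lambda>x. u m x - \<phi> n x" and ?e = "\<lambda>x. u i x - \<psi> n i x"
        have "A (\<lambda>x. 1 * u m x + (- 1) * ?d x) (\<psi> n i) = 1 * A (u m) (\<psi> n i) + (- 1) * A ?d (\<psi> n i)"
          by (intro A.B_lin um dm fV pV i)
        then have 1: "c n i = A (u m) (\<psi> n i) - A ?d (\<psi> n i)" by (simp add: c_def)
        have "A (u m) (\<lambda>x. 1 * u i x + (- 1) * ?e x) = 1 * A (u m) (u i) + (- 1) * A (u m) ?e"
          by (intro A.B_lin_right um dm uV iN pV i)
        then have "A (u m) (\<psi> n i) = - A (u m) ?e" using uo[OF mN iN] i by simp
        then have "\<bar>c n i\<bar> \<le> \<bar>A (u m) ?e\<bar> + \<bar>A ?d (\<psi> n i)\<bar>" using 1 by simp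
        also have "\<dots> \<le> B.nrm (u m) * B.nrm ?e + B.nrm ?d * B.nrm (\<psi> n i)"
          by (intro add_mono Acs um dm uV iN pV i fV)
        also have "\<dots> \<le> B.nrm (u m) * B.nrm ?e + B.nrm ?d * (B.nrm (u i) + B.nrm ?e)"
          by (intro add_left_mono mult_left_mono pbd i B.nrm_nonneg dm um fV)
        finally show "norm (c n i) \<le> ?g n" by simp
      qed
    qed
    have sbd: "B.nrm (\<lambda>x. \<Sum>i\<in>J. c n i * \<psi> n i x) \<le> (\<Sum>i\<in>J. \<bar>c n i\<bar> * B.nrm (\<psi> n i))" if "finite J" "J \<subseteq> {..<m}" for J n
      using that
    proof (induction J rule: finite_induct)
      case empty
      show ?case using B.B_zero[OF B.zero_mem] by (simp add: B.nrm_def)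
    next
      case (insert i J)
      have sV: "(\<lambda>x. \<Sum>i\<in>J. c n i * \<psi> n i x) \<in> V" using insert.prems insert.hyps sT[of J] T(1) by blast
      have "B.nrm (\<lambda>x. c n i * \<psi> n i x + 1 * (\<Sum>i\<in>J. c n i * \<psi> n i x)) \<le> \<bar>c n i\<bar> * B.nrm (\<psi> n i) + \<bar>1\<bar> * B.nrm (\<lambda>x. \<Sum>i\<in>J. c n i * \<psi> n i x)"
        by (intro B.nrm_lin pV sV) (use insert.prems in auto)
      then show ?case using insert by simp
    qed
    have x0: "(\<lambda>n. B.nrm (\<lambda>x. u m x - \<eta> n x)) \<longlonglongrightarrow> 0"
    proof (rule Lim_null_comparison)
      let ?g = "\<lambda>n. B.nrm (\<lambda>x. u m x - \<phi> n x) + (\<Sum>i<m. \<bar>c n i\<bar> * (B.nrm (u i) + B.nrm (\<lambda>x. u i x - \<psi> n i x)))"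
      have "?g \<longlonglongrightarrow> 0 + (\<Sum>i<m. \<bar>0\<bar> * (B.nrm (u i) + 0))"
        by (intro tendsto_intros phi0 psi(3) c0) auto
      then show "?g \<longlonglongrightarrow> 0" by simp
      show "\<forall>\<^sub>F n in sequentially. norm (B.nrm (\<lambda>x. u m x - \<eta> n x)) \<le> ?g n"
      proof (intro always_eventually allI)
        fix n
        have "B.nrm (\<lambda>x. u m x - \<eta> n x) = B.nrm (\<lambda>x. 1 * (u m x - \<phi> n x) + 1 * (\<Sum>i<m. c n i * \<psi> n i x))"
          by (simp add: \<eta>_def algebra_simps)
        also have "\<dots> \<le> \<bar>1\<bar> * B.nrm (\<lambda>x. u m x - \<phi> n x) + \<bar>1\<bar> * B.nrm (\<lambda>x. \<Sum>i<m. c n i * \<psi> n i x)"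
          using sT[of "{..<m}" "c n" n] T(1) by (intro B.nrm_lin dm um fV) auto
        also have "\<dots> \<le> B.nrm (\<lambda>x. u m x - \<phi> n x) + (\<Sum>i<m. \<bar>c n i\<bar> * B.nrm (\<psi> n i))"
          using sbd[of "{..<m}" n] by simp
        also have "\<dots> \<le> ?g n" by (intro add_left_mono sum_mono mult_left_mono pbd) auto
        finally show "norm (B.nrm (\<lambda>x. u m x - \<eta> n x)) \<le> ?g n" using B.nrm_nonneg[OF dm[OF um xV]] by simp
      qed
    qed
    have a1: "(\<lambda>n. A.nrm (\<eta> n)) \<longlonglongrightarrow> 1"
    proof -
      have Au: "A.nrm (u m) = 1" using uo[OF mN mN] by (simp add: A.nrm_def)
      have "(\<lambda>n. A.nrm (\<eta> n) - 1) \<longlonglongrightarrow> 0"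
      proof (rule Lim_null_comparison[OF _ x0], intro always_eventually allI)
        fix n
        let ?d = "\<lambda>x. u m x - \<eta> n x"
        have "A.nrm (\<lambda>x. 1 * u m x + (- 1) * ?d x) \<le> \<bar>1\<bar> * A.nrm (u m) + \<bar>- 1\<bar> * A.nrm ?d"
          by (intro A.nrm_lin um dm xV)
        moreover have "A.nrm (\<lambda>x. 1 * \<eta> n x + 1 * ?d x) \<le> \<bar>1\<bar> * A.nrm (\<eta> n) + \<bar>1\<bar> * A.nrm ?d"
          by (intro A.nrm_lin um dm xV)
        ultimately show "norm (A.nrm (\<eta> n) - 1) \<le> B.nrm ?d" using AleB[OF dm[OF um xV], of n] Au by (simp add: abs_le_iff)
      qed
      then show ?thesis by (simp add: LIM_zero_iff)
    qed
    define \<psi>' where "\<psi>' = (\<lambda>n. (\<psi> n)(m := (\<lambda>x. \<eta> n x / A.nrm (\<eta> n))))"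
    have hT: "(\<lambda>x. \<eta> n x / A.nrm (\<eta> n)) \<in> T" for n
      using T(2)[OF xT xT, of "1 / A.nrm (\<eta> n)" n 0 n] by simp
    have "\<psi>' n i \<in> T" if "i < Suc m" for n i using that psi(1) hT by (auto simp: \<psi>'_def less_Suc_eq)
    moreover have "\<forall>\<^sub>F n in sequentially. A.orthonormal (Suc m) (\<psi>' n)"
    proof -
      have "\<forall>\<^sub>F n in sequentially. 0 < A.nrm (\<eta> n)" using order_tendstoD(1)[OF a1, of 0] by simp
      then show ?thesis using psi(2)
      proof eventually_elim
        case (elim n)
        have "0 < A (\<eta> n) (\<eta> n)" using elim(1) by (simp add: A.nrm_def)
        then show ?case using A.orthonormal_extend(3)[OF elim(2) fV[of n]] unfolding \<psi>'_def \<eta>_def c_def by simp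
      qed
    qed
    moreover have "(\<lambda>n. B.nrm (\<lambda>x. u i x - \<psi>' n i x)) \<longlonglongrightarrow> 0" if "i < Suc m" for i
    proof (cases "i = m")
      case False
      then show ?thesis using that psi(3)[of i] by (simp add: \<psi>'_def)
    next
      case True
      have "(\<lambda>n. B.nrm (\<lambda>x. u m x - \<eta> n x / A.nrm (\<eta> n))) \<longlonglongrightarrow> 0"
      proof (rule Lim_null_comparison)
        let ?g = "\<lambda>n. B.nrm (\<lambda>x. u m x - \<eta> n x) + \<bar>1 - 1 / A.nrm (\<eta> n)\<bar> * (B.nrm (u m) + B.nrm (\<lambda>x. u m x - \<eta> n x))"
        have "?g \<longlonglongrightarrow> 0 + \<bar>1 - 1 / 1\<bar> * (B.nrm (u m) + 0)"
          by (intro tendsto_intros x0 a1) auto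
        then show "?g \<longlonglongrightarrow> 0" by simp
        show "\<forall>\<^sub>F n in sequentially. norm (B.nrm (\<lambda>x. u m x - \<eta> n x / A.nrm (\<eta> n))) \<le> ?g n"
        proof (intro always_eventually allI)
          fix n
          let ?d = "\<lambda>x. u m x - \<eta> n x"
          have hV: "(\<lambda>x. \<eta> n x / A.nrm (\<eta> n)) \<in> V" using hT T(1) by blast
          have "B.nrm (\<lambda>x. u m x - \<eta> n x / A.nrm (\<eta> n)) = B.nrm (\<lambda>x. 1 * ?d x + (1 - 1 / A.nrm (\<eta> n)) * \<eta> n x)"
            by (simp add: algebra_simps)
          also have "\<dots> \<le> \<bar>1\<bar> * B.nrm ?d + \<bar>1 - 1 / A.nrm (\<eta> n)\<bar> * B.nrm (\<eta> n)"
            by (intro B.nrm_lin dm um xV)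
          also have "B.nrm (\<eta> n) \<le> B.nrm (u m) + B.nrm ?d"
            using B.nrm_lin[OF um dm[OF um xV], of 1 "-1" n] by simp
          finally show "norm (B.nrm (\<lambda>x. u m x - \<eta> n x / A.nrm (\<eta> n))) \<le> ?g n"
            using B.nrm_nonneg[OF dm[OF um hV]] by (simp add: mult_left_mono)
        qed
      qed
      then show ?thesis using True by (simp add: \<psi>'_def)
    qed
    ultimately show ?case by blast
  qed
  from this[OF order_refl] show ?thesis .
qed

section \<open>Weak gradients and the Sobolev spaces\<close>

definition grad :: "('a::euclidean_space \<Rightarrow> real) \<Rightarrow> 'a \<Rightarrow> 'a" where
  "grad \<phi> x = (\<Sum>b\<in>Basis. dderiv b \<phi> x *\<^sub>R b)"

lemma grad_inner: "b \<in> Basis \<Longrightarrow> grad \<phi> x \<bullet> b = dderiv b \<phi> x"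
  by (simp add: grad_def)

lemma test_functions_lin:
  assumes "\<phi> \<in> test_functions \<Omega>" "\<psi> \<in> test_functions \<Omega>"
  shows "(\<lambda>x. a * \<phi> x + b * \<psi> x) \<in> test_functions \<Omega>"
proof -
  let ?A = "{x. \<phi> x \<noteq> 0}" and ?B = "{x. \<psi> x \<noteq> 0}" and ?C = "{x. a * \<phi> x + b * \<psi> x \<noteq> 0}"
  have "closure ?C \<subseteq> closure (?A \<union> ?B)" by (rule closure_mono) auto
  then have sub: "closure ?C \<subseteq> closure ?A \<union> closure ?B" by (simp only: closure_Un)
  have "compact (closure ?A \<union> closure ?B)" by (intro compact_Un test_functionsD[OF assms(1)] test_functionsD[OF assms(2)])
  then have "compact ((closure ?A \<union> closure ?B) \<inter> closure ?C)" by (rule compact_Int_closed[OF _ closed_closure])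
  then have "compact (closure ?C)" using sub by (simp only: Int_absorb1)
  moreover have "closure ?C \<subseteq> \<Omega>" using sub test_functionsD(3)[OF assms(1)] test_functionsD(3)[OF assms(2)] by (meson Un_least order_trans)
  moreover have "C_k k (\<lambda>x. a * \<phi> x + b * \<psi> x)" for k
    by (intro C_k_add C_k_cmult test_functionsD[OF assms(1)] test_functionsD[OF assms(2)])
  ultimately show ?thesis unfolding test_functions_def mem_Collect_eq by simp
qed

lemma test_functions_zero: "(\<lambda>x. 0) \<in> test_functions \<Omega>"
  unfolding test_functions_def by (simp add: C_k_zero)

locale bounded_open =
  fixes \<Omega> :: "'a::euclidean_space set"
  assumes open_Om: "open \<Omega>" and bounded_Om: "bounded \<Omega>"
begin

abbreviation M :: "'a measure" where "M \<equiv> lebesgue_on \<Omega>"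

lemma Om_sets: "\<Omega> \<in> sets lebesgue" using open_Om by (auto intro: sets_completionI_sets)

lemma finite_M: "finite_measure M"
proof
  have "emeasure lebesgue \<Omega> = emeasure lborel \<Omega>" using open_Om by (simp add: emeasure_completion)
  then show "emeasure M (space M) \<noteq> \<infinity>"
    using Om_sets emeasure_bounded_finite[OF bounded_Om] by (simp add: emeasure_restrict_space)
qed

lemma L2D: "f \<in> L2 \<Omega> \<Longrightarrow> f \<in> borel_measurable M" "f \<in> L2 \<Omega> \<Longrightarrow> integrable M (\<lambda>x. (norm (f x))\<^sup>2)"
  by (simp_all add: L2_def)

lemma L2I: "f \<in> borel_measurable M \<Longrightarrow> integrable M (\<lambda>x. (norm (f x))\<^sup>2) \<Longrightarrow> f \<in> L2 \<Omega>"
  by (simp add: L2_def)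

lemma L2_lin:
  fixes f g :: "'a \<Rightarrow> 'b::euclidean_space"
  assumes f: "f \<in> L2 \<Omega>" and g: "g \<in> L2 \<Omega>"
  shows "(\<lambda>x. a *\<^sub>R f x + b *\<^sub>R g x) \<in> L2 \<Omega>"
proof (rule L2I)
  note m = L2D(1)[OF f] L2D(1)[OF g]
  show mm: "(\<lambda>x. a *\<^sub>R f x + b *\<^sub>R g x) \<in> borel_measurable M"
    by (intro borel_measurable_add borel_measurable_scaleR m borel_measurable_const)
  show "integrable M (\<lambda>x. (norm (a *\<^sub>R f x + b *\<^sub>R g x))\<^sup>2)"
  proof (rule Bochner_Integration.integrable_bound)
    show "integrable M (\<lambda>x. 2 * a\<^sup>2 * (norm (f x))\<^sup>2 + 2 * b\<^sup>2 * (norm (g x))\<^sup>2)"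
      by (intro Bochner_Integration.integrable_add integrable_mult_right L2D f g)
    show "(\<lambda>x. (norm (a *\<^sub>R f x + b *\<^sub>R g x))\<^sup>2) \<in> borel_measurable M"
      by (intro borel_measurable_power measurable_compose[OF mm borel_measurable_norm])
    show "AE x in M. norm ((norm (a *\<^sub>R f x + b *\<^sub>R g x))\<^sup>2) \<le> norm (2 * a\<^sup>2 * (norm (f x))\<^sup>2 + 2 * b\<^sup>2 * (norm (g x))\<^sup>2)"
    proof (rule AE_I2)
      fix x
      let ?p = "\<bar>a\<bar> * norm (f x)" and ?q = "\<bar>b\<bar> * norm (g x)"
      have "norm (a *\<^sub>R f x + b *\<^sub>R g x) \<le> ?p + ?q" using norm_triangle_ineq[of "a *\<^sub>R f x" "b *\<^sub>R g x"] by simp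
      then have "(norm (a *\<^sub>R f x + b *\<^sub>R g x))\<^sup>2 \<le> (?p + ?q)\<^sup>2" by (intro power_mono) auto
      also have "\<dots> \<le> 2 * ?p\<^sup>2 + 2 * ?q\<^sup>2" using sum_squares_bound[of ?p ?q] by (simp add: power2_sum)
      also have "\<dots> = 2 * a\<^sup>2 * (norm (f x))\<^sup>2 + 2 * b\<^sup>2 * (norm (g x))\<^sup>2" by (simp add: power_mult_distrib)
      finally show "norm ((norm (a *\<^sub>R f x + b *\<^sub>R g x))\<^sup>2) \<le> norm (2 * a\<^sup>2 * (norm (f x))\<^sup>2 + 2 * b\<^sup>2 * (norm (g x))\<^sup>2)" by simp
    qed
  qed
qed

lemma L2_inner:
  fixes f g :: "'a \<Rightarrow> 'b::euclidean_space"
  assumes f: "f \<in> L2 \<Omega>" and g: "g \<in> L2 \<Omega>"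
  shows "integrable M (\<lambda>x. f x \<bullet> g x)"
proof (rule Bochner_Integration.integrable_bound)
  show "integrable M (\<lambda>x. (norm (f x))\<^sup>2 + (norm (g x))\<^sup>2)"
    by (intro Bochner_Integration.integrable_add L2D f g)
  show "(\<lambda>x. f x \<bullet> g x) \<in> borel_measurable M" by (intro borel_measurable_inner L2D f g)
  show "AE x in M. norm (f x \<bullet> g x) \<le> norm ((norm (f x))\<^sup>2 + (norm (g x))\<^sup>2)"
  proof (rule AE_I2)
    fix x
    have "\<bar>f x \<bullet> g x\<bar> \<le> norm (f x) * norm (g x)" by (rule Cauchy_Schwarz_ineq2)
    moreover have "2 * norm (f x) * norm (g x) \<le> (norm (f x))\<^sup>2 + (norm (g x))\<^sup>2" by (rule sum_squares_bound)
    moreover have "0 \<le> norm (f x) * norm (g x)" by simp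
    ultimately show "norm (f x \<bullet> g x) \<le> norm ((norm (f x))\<^sup>2 + (norm (g x))\<^sup>2)" by simp
  qed
qed

lemma L2_mult: "f \<in> L2 \<Omega> \<Longrightarrow> g \<in> L2 \<Omega> \<Longrightarrow> integrable M (\<lambda>x. f x * g x)" for f g :: "'a \<Rightarrow> real"
  using L2_inner[of f g] by simp

lemma L2_lin_real: "f \<in> L2 \<Omega> \<Longrightarrow> g \<in> L2 \<Omega> \<Longrightarrow> (\<lambda>x. a * f x + b * g x) \<in> L2 \<Omega>" for f g :: "'a \<Rightarrow> real"
  using L2_lin[of f g a b] by simp

lemma L2_component:
  fixes f :: "'a \<Rightarrow> 'b::euclidean_space"
  assumes f: "f \<in> L2 \<Omega>" shows "(\<lambda>x. f x \<bullet> b) \<in> L2 \<Omega>"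
proof (rule L2I)
  show m: "(\<lambda>x. f x \<bullet> b) \<in> borel_measurable M" by (intro borel_measurable_inner L2D f borel_measurable_const)
  show "integrable M (\<lambda>x. (norm (f x \<bullet> b))\<^sup>2)"
  proof (rule Bochner_Integration.integrable_bound)
    show "integrable M (\<lambda>x. (norm b)\<^sup>2 * (norm (f x))\<^sup>2)" by (intro integrable_mult_right L2D f)
    show "(\<lambda>x. (norm (f x \<bullet> b))\<^sup>2) \<in> borel_measurable M" by (intro borel_measurable_power measurable_compose[OF m borel_measurable_norm])
    show "AE x in M. norm ((norm (f x \<bullet> b))\<^sup>2) \<le> norm ((norm b)\<^sup>2 * (norm (f x))\<^sup>2)"
    proof (rule AE_I2)
      fix x
      have "\<bar>f x \<bullet> b\<bar>\<^sup>2 \<le> (norm (f x) * norm b)\<^sup>2" by (intro power_mono Cauchy_Schwarz_ineq2) simp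
      then show "norm ((norm (f x \<bullet> b))\<^sup>2) \<le> norm ((norm b)\<^sup>2 * (norm (f x))\<^sup>2)" by (simp add: power_mult_distrib mult.commute)
    qed
  qed
qed

lemma continuous_supported_L2:
  assumes "compactly_supported f" "\<And>x. x \<notin> \<Omega> \<Longrightarrow> f x = 0" shows "f \<in> L2 \<Omega>"
proof (rule L2I)
  have c: "continuous_on UNIV f" using assms(1) by (simp add: compactly_supported_def)
  then have m: "f \<in> borel_measurable borel" by (rule borel_measurable_continuous_onI)
  have m': "f \<in> borel_measurable lebesgue" using m by (simp add: measurable_completion)
  then show "f \<in> borel_measurable M" by (rule measurable_restrict_space1)
  have "integrable lborel (\<lambda>x. f x * f x)"
    by (intro compactly_supported_integrable compactly_supported_mult assms(1) c)
  then show "integrable M (\<lambda>x. (norm (f x))\<^sup>2)"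
    using m assms(2) by (subst lebesgue_on_integral_eq(2)[OF Om_sets]) (auto simp: power2_eq_square)
qed

lemma test_L2:
  assumes "\<phi> \<in> test_functions \<Omega>" shows "\<phi> \<in> L2 \<Omega>" "dderiv n \<phi> \<in> L2 \<Omega>"
  by (intro continuous_supported_L2 C1c_compactly_supported test_function_C1c[OF assms] test_function_outside[OF assms]; assumption)+

lemma L2_sum:
  fixes f :: "'i \<Rightarrow> 'a \<Rightarrow> 'b::euclidean_space"
  assumes "finite I" "\<And>i. i \<in> I \<Longrightarrow> f i \<in> L2 \<Omega>"
  shows "(\<lambda>x. \<Sum>i\<in>I. f i x) \<in> L2 \<Omega>"
  using assms
proof (induction I rule: finite_induct)
  case empty
  show ?case by (simp add: L2_def)
next
  case (insert i I)
  then have "(\<lambda>x. 1 *\<^sub>R f i x + 1 *\<^sub>R (\<Sum>i\<in>I. f i x)) \<in> L2 \<Omega>" by (intro L2_lin) auto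
  then show ?case using insert.hyps by simp
qed

lemma grad_L2:
  assumes "\<phi> \<in> test_functions \<Omega>" shows "grad \<phi> \<in> L2 \<Omega>"
  unfolding grad_def[abs_def]
proof (rule L2_sum[OF finite_Basis])
  fix b :: 'a assume b: "b \<in> Basis"
  show "(\<lambda>x. dderiv b \<phi> x *\<^sub>R b) \<in> L2 \<Omega>"
  proof (rule L2I)
    show "(\<lambda>x. dderiv b \<phi> x *\<^sub>R b) \<in> borel_measurable M"
      by (intro borel_measurable_scaleR borel_measurable_const L2D(1) test_L2 assms)
    show "integrable M (\<lambda>x. (norm (dderiv b \<phi> x *\<^sub>R b))\<^sup>2)"
      using L2D(2)[OF test_L2(2)[OF assms, of b]] b by simp
  qed
qed

lemma has_weak_gradient_iff: "has_weak_gradient \<Omega> u g \<longleftrightarrow>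
  (\<forall>\<phi>\<in>test_functions \<Omega>. \<forall>b\<in>Basis. (LINT x|M. u x * dderiv b \<phi> x) = - (LINT x|M. (g x \<bullet> b) * \<phi> x))"
  unfolding has_weak_gradient_def dderiv_def ..

lemma has_weak_gradient_lin:
  assumes "u \<in> L2 \<Omega>" "v \<in> L2 \<Omega>" "g \<in> L2 \<Omega>" "h \<in> L2 \<Omega>" "has_weak_gradient \<Omega> u g" "has_weak_gradient \<Omega> v h"
  shows "has_weak_gradient \<Omega> (\<lambda>x. a * u x + b * v x) (\<lambda>x. a *\<^sub>R g x + b *\<^sub>R h x)"
  unfolding has_weak_gradient_iff
proof (intro ballI)
  fix \<phi> :: "'a \<Rightarrow> real" and i :: 'a assume p: "\<phi> \<in> test_functions \<Omega>" and i: "i \<in> Basis"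
  note I = L2_mult[OF assms(1) test_L2(2)[OF p]] L2_mult[OF assms(2) test_L2(2)[OF p]]
    L2_mult[OF L2_component[OF assms(3)] test_L2(1)[OF p]] L2_mult[OF L2_component[OF assms(4)] test_L2(1)[OF p]]
  have "(LINT x|M. (a * u x + b * v x) * dderiv i \<phi> x) = (LINT x|M. a * (u x * dderiv i \<phi> x) + b * (v x * dderiv i \<phi> x))"
    by (simp add: algebra_simps)
  also have "\<dots> = a * (LINT x|M. u x * dderiv i \<phi> x) + b * (LINT x|M. v x * dderiv i \<phi> x)"
    using I by simp
  also have "\<dots> = - (a * (LINT x|M. (g x \<bullet> i) * \<phi> x) + b * (LINT x|M. (h x \<bullet> i) * \<phi> x))"
    using assms(5,6) p i unfolding has_weak_gradient_iff by simp
  also have "a * (LINT x|M. (g x \<bullet> i) * \<phi> x) + b * (LINT x|M. (h x \<bullet> i) * \<phi> x) = (LINT x|M. a * ((g x \<bullet> i) * \<phi> x) + b * ((h x \<bullet> i) * \<phi> x))"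
    using I by simp
  also have "\<dots> = (LINT x|M. ((a *\<^sub>R g x + b *\<^sub>R h x) \<bullet> i) * \<phi> x)"
    by (simp add: inner_add_left algebra_simps)
  finally show "(LINT x|M. (a * u x + b * v x) * dderiv i \<phi> x) = - (LINT x|M. ((a *\<^sub>R g x + b *\<^sub>R h x) \<bullet> i) * \<phi> x)" .
qed

text \<open>This is what makes the chosen representative \<open>weak_gradient \<Omega> u\<close> computable: it agrees almost everywhere with
any square-integrable weak gradient of \<open>u\<close>, in particular with the classical one for test functions.\<close>

lemma weak_gradient_unique:
  assumes "g \<in> L2 \<Omega>" "h \<in> L2 \<Omega>" "has_weak_gradient \<Omega> u g" "has_weak_gradient \<Omega> u h"
  shows "AE x in M. g x = h x"
proof -
  have "AE x in M. g x \<bullet> b - h x \<bullet> b = 0" if b: "b \<in> Basis" for b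
  proof (rule AE_zero_of_test_integrals[OF open_Om])
    have l: "(\<lambda>x. g x \<bullet> b - h x \<bullet> b) \<in> L2 \<Omega>"
      using L2_lin_real[OF L2_component[OF assms(1)] L2_component[OF assms(2)], of 1 b "-1" b] by simp
    interpret finite_measure M by (rule finite_M)
    show "integrable M (\<lambda>x. g x \<bullet> b - h x \<bullet> b)"
    proof (rule Bochner_Integration.integrable_bound)
      show "integrable M (\<lambda>x. 1 + (norm (g x \<bullet> b - h x \<bullet> b))\<^sup>2)"
        by (intro Bochner_Integration.integrable_add L2D(2)[OF l] integrable_const)
      show "(\<lambda>x. g x \<bullet> b - h x \<bullet> b) \<in> borel_measurable M" by (rule L2D(1)[OF l])
      show "AE x in M. norm (g x \<bullet> b - h x \<bullet> b) \<le> norm (1 + (norm (g x \<bullet> b - h x \<bullet> b))\<^sup>2)"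
      proof (rule AE_I2)
        fix x
        define r where "r = norm (g x \<bullet> b - h x \<bullet> b)"
        have "2 * r * 1 \<le> r\<^sup>2 + 1\<^sup>2" by (rule sum_squares_bound)
        moreover have "0 \<le> r" by (simp add: r_def)
        ultimately have "r \<le> norm (1 + r\<^sup>2)" by simp
        then show "norm (g x \<bullet> b - h x \<bullet> b) \<le> norm (1 + (norm (g x \<bullet> b - h x \<bullet> b))\<^sup>2)" by (simp only: r_def)
      qed
    qed
    fix \<phi> :: "'a \<Rightarrow> real" assume p: "\<phi> \<in> test_functions \<Omega>"
    note I = L2_mult[OF L2_component[OF assms(1)] test_L2(1)[OF p]] L2_mult[OF L2_component[OF assms(2)] test_L2(1)[OF p]]
    have "(LINT x|M. (g x \<bullet> b - h x \<bullet> b) * \<phi> x) = (LINT x|M. (g x \<bullet> b) * \<phi> x) - (LINT x|M. (h x \<bullet> b) * \<phi> x)"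
      using I by (simp add: left_diff_distrib)
    also have "\<dots> = 0"
      using bspec[OF bspec[OF assms(3)[unfolded has_weak_gradient_iff] p] b]
        bspec[OF bspec[OF assms(4)[unfolded has_weak_gradient_iff] p] b] by linarith
    finally show "(LINT x|M. (g x \<bullet> b - h x \<bullet> b) * \<phi> x) = 0" .
  qed
  then have "AE x in M. \<forall>b\<in>Basis. g x \<bullet> b - h x \<bullet> b = 0" by (rule AE_finite_allI[OF finite_Basis])
  then show ?thesis
  proof eventually_elim
    case (elim x)
    show ?case
    proof (rule euclidean_eqI)
      fix b :: 'a assume "b \<in> Basis"
      then show "g x \<bullet> b = h x \<bullet> b" using bspec[OF elim] by simp
    qed
  qed
qed

lemma has_weak_gradient_test:
  assumes p: "\<phi> \<in> test_functions \<Omega>" shows "has_weak_gradient \<Omega> \<phi> (grad \<phi>)"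
  unfolding has_weak_gradient_iff
proof (intro ballI)
  fix \<psi> :: "'a \<Rightarrow> real" and b :: 'a assume q: "\<psi> \<in> test_functions \<Omega>" and b: "b \<in> Basis"
  note Cp = test_function_C1c[OF p] and Cq = test_function_C1c[OF q]
  note X = C1c_mult[OF Cp C1c_has_derivative[OF Cq] C1c_continuous(2)[OF Cq]]
  have m: "\<phi> \<in> borel_measurable borel" "\<psi> \<in> borel_measurable borel" "dderiv b \<phi> \<in> borel_measurable borel" "dderiv b \<psi> \<in> borel_measurable borel"
    by (intro borel_measurable_continuous_onI C1c_continuous Cp Cq)+
  have i: "integrable lborel (\<lambda>x. \<phi> x * dderiv b \<psi> x)" "integrable lborel (\<lambda>x. dderiv b \<phi> x * \<psi> x)"
    by (intro compactly_supported_integrable compactly_supported_mult C1c_compactly_supported C1c_continuous Cp Cq)+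
  have "0 = (LINT x|lborel. \<phi> x * dderiv b \<psi> x + dderiv b \<phi> x * \<psi> x)"
    using C1c_compactly_supported(3)[OF X(1), of b] unfolding X(2) by simp
  also have "\<dots> = (LINT x|lborel. \<phi> x * dderiv b \<psi> x) + (LINT x|lborel. dderiv b \<phi> x * \<psi> x)"
    by (rule Bochner_Integration.integral_add[OF i])
  finally have "(LINT x|lborel. \<phi> x * dderiv b \<psi> x) = - (LINT x|lborel. dderiv b \<phi> x * \<psi> x)" by simp
  moreover have "(LINT x|M. \<phi> x * dderiv b \<psi> x) = (LINT x|lborel. \<phi> x * dderiv b \<psi> x)"
    using m by (intro lebesgue_on_integral_eq(1)[OF Om_sets]) (auto simp: test_function_outside[OF p])
  moreover have "(LINT x|M. dderiv b \<phi> x * \<psi> x) = (LINT x|lborel. dderiv b \<phi> x * \<psi> x)"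
    using m by (intro lebesgue_on_integral_eq(1)[OF Om_sets]) (auto simp: test_function_outside[OF p])
  ultimately show "(LINT x|M. \<phi> x * dderiv b \<psi> x) = - (LINT x|M. (grad \<phi> x \<bullet> b) * \<psi> x)"
    by (simp only: grad_inner[OF b])
qed

lemma weak_gradient_spec:
  assumes "u \<in> H1 \<Omega>" shows "weak_gradient \<Omega> u \<in> L2 \<Omega>" "has_weak_gradient \<Omega> u (weak_gradient \<Omega> u)"
proof -
  have "\<exists>g. g \<in> L2 \<Omega> \<and> has_weak_gradient \<Omega> u g" using assms by (auto simp: H1_def)
  then have "weak_gradient \<Omega> u \<in> L2 \<Omega> \<and> has_weak_gradient \<Omega> u (weak_gradient \<Omega> u)"
    unfolding weak_gradient_def by (rule someI_ex)
  then show "weak_gradient \<Omega> u \<in> L2 \<Omega>" "has_weak_gradient \<Omega> u (weak_gradient \<Omega> u)" by auto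
qed

lemma H1_L2: "u \<in> H1 \<Omega> \<Longrightarrow> u \<in> L2 \<Omega>" by (simp add: H1_def)

lemma H1I:
  assumes "u \<in> L2 \<Omega>" "g \<in> L2 \<Omega>" "has_weak_gradient \<Omega> u g"
  shows "u \<in> H1 \<Omega>" "AE x in M. weak_gradient \<Omega> u x = g x"
proof -
  show u: "u \<in> H1 \<Omega>" using assms by (auto simp: H1_def)
  show "AE x in M. weak_gradient \<Omega> u x = g x"
    using weak_gradient_unique[OF weak_gradient_spec(1)[OF u] assms(2) weak_gradient_spec(2)[OF u] assms(3)] .
qed

lemma H1_lin:
  assumes u: "u \<in> H1 \<Omega>" and v: "v \<in> H1 \<Omega>"
  shows "(\<lambda>x. a * u x + b * v x) \<in> H1 \<Omega>"
    "AE x in M. weak_gradient \<Omega> (\<lambda>x. a * u x + b * v x) x = a *\<^sub>R weak_gradient \<Omega> u x + b *\<^sub>R weak_gradient \<Omega> v x"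
proof -
  note U = weak_gradient_spec[OF u] and W = weak_gradient_spec[OF v]
  note X = H1I[OF L2_lin_real[OF H1_L2[OF u] H1_L2[OF v]] L2_lin[OF U(1) W(1)]
    has_weak_gradient_lin[OF H1_L2[OF u] H1_L2[OF v] U(1) W(1) U(2) W(2)]]
  show "(\<lambda>x. a * u x + b * v x) \<in> H1 \<Omega>" by (rule X(1))
  show "AE x in M. weak_gradient \<Omega> (\<lambda>x. a * u x + b * v x) x = a *\<^sub>R weak_gradient \<Omega> u x + b *\<^sub>R weak_gradient \<Omega> v x" by (rule X(2))
qed

lemma test_H1:
  assumes p: "\<phi> \<in> test_functions \<Omega>"
  shows "\<phi> \<in> H1 \<Omega>" "AE x in M. weak_gradient \<Omega> \<phi> x = grad \<phi> x"
  using H1I[OF test_L2(1)[OF p] grad_L2[OF p] has_weak_gradient_test[OF p]] by auto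

definition ip :: "('a \<Rightarrow> real) \<Rightarrow> ('a \<Rightarrow> real) \<Rightarrow> real" where
  "ip u v = (LINT x|M. u x * v x)"

lemma ip_semi_inner: "semi_inner (H1 \<Omega>) ip"
proof
  show "(\<lambda>x. 0) \<in> H1 \<Omega>" by (rule test_H1(1)[OF test_functions_zero])
  show "(\<lambda>x. a * u x + b * v x) \<in> H1 \<Omega>" if "u \<in> H1 \<Omega>" "v \<in> H1 \<Omega>" for u v a b by (rule H1_lin(1)[OF that])
  show "ip u v = ip v u" for u v by (simp add: ip_def mult.commute)
  show "0 \<le> ip u u" for u unfolding ip_def by (intro Bochner_Integration.integral_nonneg) simp
  show "ip (\<lambda>x. a * u x + b * v x) w = a * ip u w + b * ip v w" if "u \<in> H1 \<Omega>" "v \<in> H1 \<Omega>" "w \<in> H1 \<Omega>" for u v w a b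
  proof -
    note I = L2_mult[OF H1_L2[OF that(1)] H1_L2[OF that(3)]] L2_mult[OF H1_L2[OF that(2)] H1_L2[OF that(3)]]
    have "ip (\<lambda>x. a * u x + b * v x) w = (LINT x|M. a * (u x * w x) + b * (v x * w x))"
      unfolding ip_def by (simp add: algebra_simps)
    then show ?thesis using I by (simp add: ip_def)
  qed
qed

lemma dirichlet_form_semi_inner: "semi_inner (H1 \<Omega>) (dirichlet_form \<Omega>)"
proof
  show "(\<lambda>x. 0) \<in> H1 \<Omega>" by (rule test_H1(1)[OF test_functions_zero])
  show "(\<lambda>x. a * u x + b * v x) \<in> H1 \<Omega>" if "u \<in> H1 \<Omega>" "v \<in> H1 \<Omega>" for u v a b by (rule H1_lin(1)[OF that])
  show "dirichlet_form \<Omega> u v = dirichlet_form \<Omega> v u" for u v by (simp add: dirichlet_form_def inner_commute)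
  show "0 \<le> dirichlet_form \<Omega> u u" for u unfolding dirichlet_form_def by (intro Bochner_Integration.integral_nonneg) simp
  show "dirichlet_form \<Omega> (\<lambda>x. a * u x + b * v x) w = a * dirichlet_form \<Omega> u w + b * dirichlet_form \<Omega> v w"
    if "u \<in> H1 \<Omega>" "v \<in> H1 \<Omega>" "w \<in> H1 \<Omega>" for u v w a b
  proof -
    note U = weak_gradient_spec(1)[OF that(1)] and V = weak_gradient_spec(1)[OF that(2)] and W = weak_gradient_spec(1)[OF that(3)]
    note I = L2_inner[OF U W] L2_inner[OF V W]
    have "dirichlet_form \<Omega> (\<lambda>x. a * u x + b * v x) w
      = (LINT x|M. (a *\<^sub>R weak_gradient \<Omega> u x + b *\<^sub>R weak_gradient \<Omega> v x) \<bullet> weak_gradient \<Omega> w x)"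
      unfolding dirichlet_form_def
    proof (rule integral_cong_AE)
      show "(\<lambda>x. weak_gradient \<Omega> (\<lambda>x. a * u x + b * v x) x \<bullet> weak_gradient \<Omega> w x) \<in> borel_measurable M"
        by (intro borel_measurable_inner L2D(1) weak_gradient_spec(1) H1_lin(1) that)
      show "(\<lambda>x. (a *\<^sub>R weak_gradient \<Omega> u x + b *\<^sub>R weak_gradient \<Omega> v x) \<bullet> weak_gradient \<Omega> w x) \<in> borel_measurable M"
        by (intro borel_measurable_inner L2D(1) L2_lin U V W)
      show "AE x in M. weak_gradient \<Omega> (\<lambda>x. a * u x + b * v x) x \<bullet> weak_gradient \<Omega> w x = (a *\<^sub>R weak_gradient \<Omega> u x + b *\<^sub>R weak_gradient \<Omega> v x) \<bullet> weak_gradient \<Omega> w x"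
        using H1_lin(2)[OF that(1,2), of a b] by eventually_elim simp
    qed
    also have "\<dots> = (LINT x|M. a * (weak_gradient \<Omega> u x \<bullet> weak_gradient \<Omega> w x) + b * (weak_gradient \<Omega> v x \<bullet> weak_gradient \<Omega> w x))"
      by (simp add: inner_add_left)
    also have "\<dots> = a * dirichlet_form \<Omega> u w + b * dirichlet_form \<Omega> v w"
      using I by (simp add: dirichlet_form_def)
    finally show ?thesis .
  qed
qed

end

section \<open>Orthonormal eigenfunctions\<close>

context bounded_open begin

text \<open>The inner product of \<open>H1 \<Omega>\<close>, whose norm is \<open>H1_norm \<Omega>\<close>.\<close>

definition h1_ip :: "('a \<Rightarrow> real) \<Rightarrow> ('a \<Rightarrow> real) \<Rightarrow> real" where
  "h1_ip u v = ip u v + dirichlet_form \<Omega> u v"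

lemma h1_ip_semi_inner: "semi_inner (H1 \<Omega>) h1_ip"
proof -
  interpret A: semi_inner "H1 \<Omega>" ip by (rule ip_semi_inner)
  interpret E: semi_inner "H1 \<Omega>" "dirichlet_form \<Omega>" by (rule dirichlet_form_semi_inner)
  show ?thesis
  proof
    show "h1_ip (\<lambda>x. a * u x + b * v x) w = a * h1_ip u w + b * h1_ip v w"
      if "u \<in> H1 \<Omega>" "v \<in> H1 \<Omega>" "w \<in> H1 \<Omega>" for u v w a b
      unfolding h1_ip_def A.B_lin[OF that] E.B_lin[OF that] by (simp add: algebra_simps)
    show "h1_ip u v = h1_ip v u" if "u \<in> H1 \<Omega>" "v \<in> H1 \<Omega>" for u v
      unfolding h1_ip_def A.B_sym[OF that] E.B_sym[OF that] ..
    show "0 \<le> h1_ip u u" if "u \<in> H1 \<Omega>" for u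
      unfolding h1_ip_def using A.B_nonneg[OF that] E.B_nonneg[OF that] by simp
  qed (fact A.zero_mem A.lin_mem)+
qed

lemma H1_norm_eq: "H1_norm \<Omega> u = semi_inner.nrm h1_ip u"
  unfolding H1_norm_def semi_inner.nrm_def[OF h1_ip_semi_inner] h1_ip_def ip_def dirichlet_form_def
  by (simp add: power2_eq_square dot_square_norm)

lemma H10D: "u \<in> H10 \<Omega> \<Longrightarrow> u \<in> H1 \<Omega>"
  "u \<in> H10 \<Omega> \<Longrightarrow> 0 < \<epsilon> \<Longrightarrow> \<exists>\<phi>\<in>test_functions \<Omega>. semi_inner.nrm h1_ip (\<lambda>x. u x - \<phi> x) < \<epsilon>"
  by (simp_all add: H10_def H1_norm_eq)

lemma H10_zero: "(\<lambda>x. 0) \<in> H10 \<Omega>"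
proof -
  interpret B: semi_inner "H1 \<Omega>" h1_ip by (rule h1_ip_semi_inner)
  have "B.nrm (\<lambda>x. 0) = 0" unfolding B.nrm_def B.B_zero[OF B.zero_mem] by simp
  then show ?thesis
    unfolding H10_def H1_norm_eq by (auto simp: B.zero_mem intro!: bexI[OF _ test_functions_zero])
qed

lemma H10_lin:
  assumes u: "u \<in> H10 \<Omega>" and v: "v \<in> H10 \<Omega>" shows "(\<lambda>x. a * u x + b * v x) \<in> H10 \<Omega>"
proof -
  interpret B: semi_inner "H1 \<Omega>" h1_ip by (rule h1_ip_semi_inner)
  have "\<exists>\<chi>'\<in>test_functions \<Omega>. B.nrm (\<lambda>x. (a * u x + b * v x) - \<chi>' x) < \<epsilon>" if "0 < \<epsilon>" for \<epsilon> :: real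
  proof -
    define e where "e = \<epsilon> / (\<bar>a\<bar> + \<bar>b\<bar> + 1)"
    have p: "0 < \<bar>a\<bar> + \<bar>b\<bar> + 1" by simp
    have e: "0 < e" using that p by (simp add: e_def)
    obtain \<phi> where f: "\<phi> \<in> test_functions \<Omega>" "B.nrm (\<lambda>x. u x - \<phi> x) < e" using H10D(2)[OF u e] by auto
    obtain \<psi> where g: "\<psi> \<in> test_functions \<Omega>" "B.nrm (\<lambda>x. v x - \<psi> x) < e" using H10D(2)[OF v e] by auto
    have m: "(\<lambda>x. u x - \<phi> x) \<in> H1 \<Omega>" "(\<lambda>x. v x - \<psi> x) \<in> H1 \<Omega>"
      using B.lin_mem[OF H10D(1)[OF u] test_H1(1)[OF f(1)], of 1 "-1"]
        B.lin_mem[OF H10D(1)[OF v] test_H1(1)[OF g(1)], of 1 "-1"] by simp_all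
    have "(\<lambda>x. (a * u x + b * v x) - (a * \<phi> x + b * \<psi> x)) = (\<lambda>x. a * (u x - \<phi> x) + b * (v x - \<psi> x))"
      by (simp add: algebra_simps)
    then have "B.nrm (\<lambda>x. (a * u x + b * v x) - (a * \<phi> x + b * \<psi> x)) \<le> \<bar>a\<bar> * B.nrm (\<lambda>x. u x - \<phi> x) + \<bar>b\<bar> * B.nrm (\<lambda>x. v x - \<psi> x)"
      using B.nrm_lin[OF m] by simp
    also have "\<dots> \<le> \<bar>a\<bar> * e + \<bar>b\<bar> * e" using f(2) g(2) by (intro add_mono mult_left_mono) auto
    also have "\<dots> < (\<bar>a\<bar> + \<bar>b\<bar> + 1) * e" using e by (simp add: algebra_simps)
    also have "\<dots> = \<epsilon>" using p by (simp add: e_def)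
    finally show ?thesis using test_functions_lin[OF f(1) g(1)] by (intro bexI)
  qed
  then show ?thesis
    using B.lin_mem[OF H10D(1)[OF u] H10D(1)[OF v], of a b] unfolding H10_def H1_norm_eq mem_Collect_eq by simp
qed

lemma H10_sum: "(\<And>i. i \<in> I \<Longrightarrow> e i \<in> H10 \<Omega>) \<Longrightarrow> (\<lambda>x. \<Sum>i\<in>I. c i * e i x) \<in> H10 \<Omega>"
proof (induction I rule: infinite_finite_induct)
  case (insert i I)
  then have "(\<lambda>x. c i * e i x + 1 * (\<Sum>i\<in>I. c i * e i x)) \<in> H10 \<Omega>" by (intro H10_lin) auto
  then show ?case using insert.hyps by simp
qed (simp_all add: H10_zero)

lemma eigenspaceD:
  assumes "u \<in> eigenspace \<Omega> \<mu>"
  shows "u \<in> H10 \<Omega>" "\<And>v. v \<in> H10 \<Omega> \<Longrightarrow> dirichlet_form \<Omega> u v = \<mu> * ip u v"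
  using assms by (simp_all add: eigenspace_def dirichlet_laplacian_def ip_def mult.assoc)

text \<open>A combination of the basis that vanishes in norm vanishes almost everywhere, so independence modulo null functions is
what Gram-Schmidt requires.\<close>

lemma eigenspace_orthonormal_basis:
  assumes "has_dim_ae \<Omega> (eigenspace \<Omega> \<mu>) n"
  shows "\<exists>f. semi_inner.orthonormal (H1 \<Omega>) ip n f \<and>
    (\<forall>i<n. f i \<in> H10 \<Omega> \<and> (\<forall>v\<in>H10 \<Omega>. dirichlet_form \<Omega> (f i) v = \<mu> * ip (f i) v))"
proof -
  interpret A: semi_inner "H1 \<Omega>" ip by (rule ip_semi_inner)
  interpret E: semi_inner "H1 \<Omega>" "dirichlet_form \<Omega>" by (rule dirichlet_form_semi_inner)
  obtain e :: "nat \<Rightarrow> 'a \<Rightarrow> real" where e: "\<And>i. i < n \<Longrightarrow> e i \<in> eigenspace \<Omega> \<mu>"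
    and ind: "\<And>c :: nat \<Rightarrow> real. (AE x in M. (\<Sum>i<n. c i * e i x) = 0) \<Longrightarrow> \<forall>i<n. c i = 0"
    using assms unfolding has_dim_ae_def by auto
  have e0: "\<And>i. i < n \<Longrightarrow> e i \<in> H10 \<Omega>" and e1: "\<And>i. i < n \<Longrightarrow> e i \<in> H1 \<Omega>"
    using eigenspaceD(1)[OF e] H10D(1) by auto
  have "\<exists>f. A.orthonormal n f \<and> (\<forall>i<n. \<exists>t. f i = (\<lambda>x. \<Sum>j<n. t j * e j x))"
  proof (rule A.orthonormal_basis_exists[OF e1])
    fix c :: "nat \<Rightarrow> real"
    let ?w = "\<lambda>x. \<Sum>i<n. c i * e i x"
    assume z: "ip ?w ?w = 0"
    have "?w \<in> H1 \<Omega>" using e1 by (intro A.sum_mem) auto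
    then have "integrable M (\<lambda>x. ?w x * ?w x)" by (intro L2_mult H1_L2)
    moreover have "(LINT x|M. ?w x * ?w x) = 0" using z by (simp only: ip_def)
    ultimately have "AE x in M. ?w x * ?w x = 0"
      using integral_nonneg_eq_0_iff_AE[of M "\<lambda>x. ?w x * ?w x"] by simp
    then have "AE x in M. ?w x = 0" by eventually_elim simp
    then show "\<forall>i<n. c i = 0" by (rule ind)
  qed
  then obtain f where f: "A.orthonormal n f" "\<And>i. i < n \<Longrightarrow> \<exists>t. f i = (\<lambda>x. \<Sum>j<n. t j * e j x)" by auto
  have "f i \<in> H10 \<Omega> \<and> (\<forall>v\<in>H10 \<Omega>. dirichlet_form \<Omega> (f i) v = \<mu> * ip (f i) v)" if i: "i < n" for i
  proof -
    obtain t where t: "f i = (\<lambda>x. \<Sum>j<n. t j * e j x)" using f(2)[OF i] by auto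
    have "dirichlet_form \<Omega> (f i) v = \<mu> * ip (f i) v" if v: "v \<in> H10 \<Omega>" for v
    proof -
      have "dirichlet_form \<Omega> (f i) v = (\<Sum>j<n. t j * dirichlet_form \<Omega> (e j) v)"
        unfolding t using e1 H10D(1)[OF v] by (intro E.B_sum) auto
      also have "\<dots> = (\<Sum>j<n. \<mu> * (t j * ip (e j) v))"
        using eigenspaceD(2)[OF e v] by (intro sum.cong refl) simp
      also have "\<dots> = \<mu> * (\<Sum>j<n. t j * ip (e j) v)" by (simp only: sum_distrib_left)
      also have "(\<Sum>j<n. t j * ip (e j) v) = ip (f i) v"
        unfolding t using e1 H10D(1)[OF v] by (intro A.B_sum[symmetric]) auto
      finally show ?thesis .
    qed
    moreover have "f i \<in> H10 \<Omega>" unfolding t using e0 by (intro H10_sum) auto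
    ultimately show ?thesis by simp
  qed
  with f(1) show ?thesis by (intro exI[of _ f]) simp
qed

text \<open>The positions at which \<open>ev\<close> takes a value \<open>\<mu>\<close> are as many as the dimension of the eigenspace of \<open>\<mu>\<close>, so they can be
matched with an orthonormal basis of it. Symmetry of the form makes eigenfunctions for different values
orthogonal.\<close>

lemma orthonormal_eigenfunctions:
  fixes ev :: "nat \<Rightarrow> real"
  assumes "dirichlet_eigenvalues \<Omega> ev"
  shows "\<exists>u. semi_inner.orthonormal (H1 \<Omega>) ip N u \<and>
    (\<forall>i<N. u i \<in> H10 \<Omega> \<and> dirichlet_form \<Omega> (u i) (u i) = ev (Suc i))"
proof -
  interpret A: semi_inner "H1 \<Omega>" ip by (rule ip_semi_inner)
  interpret E: semi_inner "H1 \<Omega>" "dirichlet_form \<Omega>" by (rule dirichlet_form_semi_inner)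
  define J where "J \<mu> = {j\<in>{1..}. ev j = \<mu>}" for \<mu>
  have fin: "finite (J \<mu>)" and dim: "has_dim_ae \<Omega> (eigenspace \<Omega> \<mu>) (card (J \<mu>))" for \<mu>
    using assms unfolding dirichlet_eigenvalues_def J_def by auto
  have "\<forall>\<mu>. \<exists>f. A.orthonormal (card (J \<mu>)) f \<and>
    (\<forall>i<card (J \<mu>). f i \<in> H10 \<Omega> \<and> (\<forall>v\<in>H10 \<Omega>. dirichlet_form \<Omega> (f i) v = \<mu> * ip (f i) v))"
    using eigenspace_orthonormal_basis[OF dim] by blast
  then obtain f where "\<forall>\<mu>. A.orthonormal (card (J \<mu>)) (f \<mu>) \<and>
    (\<forall>i<card (J \<mu>). f \<mu> i \<in> H10 \<Omega> \<and> (\<forall>v\<in>H10 \<Omega>. dirichlet_form \<Omega> (f \<mu> i) v = \<mu> * ip (f \<mu> i) v))"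
    by (rule choice[THEN exE])
  then have fo: "A.orthonormal (card (J \<mu>)) (f \<mu>)"
    and f0: "i < card (J \<mu>) \<Longrightarrow> f \<mu> i \<in> H10 \<Omega>"
    and fE: "i < card (J \<mu>) \<Longrightarrow> v \<in> H10 \<Omega> \<Longrightarrow> dirichlet_form \<Omega> (f \<mu> i) v = \<mu> * ip (f \<mu> i) v" for \<mu> i v
    by auto
  have "\<forall>\<mu>. \<exists>g. bij_betw g (J \<mu>) {0..<card (J \<mu>)}" using ex_bij_betw_finite_nat[OF fin] by blast
  then obtain g where g: "\<forall>\<mu>. bij_betw (g \<mu>) (J \<mu>) {0..<card (J \<mu>)}" by (rule choice[THEN exE])
  define k where "k i = g (ev (Suc i)) (Suc i)" for i
  define u where "u i = f (ev (Suc i)) (k i)" for i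
  have SJ: "Suc i \<in> J (ev (Suc i))" for i by (simp add: J_def)
  have kl: "k i < card (J (ev (Suc i)))" for i
    using bij_betwE[OF g[rule_format, of "ev (Suc i)"]] SJ[of i] by (simp add: k_def)
  have u0: "u i \<in> H10 \<Omega>" for i unfolding u_def by (rule f0[OF kl])
  note u1 = H10D(1)[OF u0]
  have uE: "dirichlet_form \<Omega> (u i) v = ev (Suc i) * ip (u i) v" if "v \<in> H10 \<Omega>" for i v
    unfolding u_def by (rule fE[OF kl that])
  have uu: "ip (u i) (u j) = (if i = j then 1 else 0)" for i j
  proof (cases "ev (Suc i) = ev (Suc j)")
    case True
    have "k i = k j \<longleftrightarrow> i = j"
      using inj_onD[OF bij_betw_imp_inj_on[OF g[rule_format, of "ev (Suc i)"]], of "Suc i" "Suc j"] SJ[of i] SJ[of j] True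
      by (auto simp: k_def)
    then show ?thesis
      using fo[of "ev (Suc i)"] kl[of i] kl[of j] True unfolding A.orthonormal_def u_def by simp
  next
    case False
    have "ev (Suc i) * ip (u i) (u j) = dirichlet_form \<Omega> (u i) (u j)" by (rule uE[OF u0, symmetric])
    also have "\<dots> = dirichlet_form \<Omega> (u j) (u i)" by (rule E.B_sym[OF u1 u1])
    also have "\<dots> = ev (Suc j) * ip (u j) (u i)" by (rule uE[OF u0])
    also have "ip (u j) (u i) = ip (u i) (u j)" by (rule A.B_sym[OF u1 u1])
    finally have "ip (u i) (u j) = 0" using False by simp
    then show ?thesis using False by auto
  qed
  have "A.orthonormal N u" unfolding A.orthonormal_def using uu u1 by simp
  then show ?thesis using uE[OF u0] uu u0 by (intro exI[of _ u]) simp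
qed

lemma ip_test:
  assumes p: "\<phi> \<in> test_functions \<Omega>" and q: "\<psi> \<in> test_functions \<Omega>"
  shows "ip \<phi> \<psi> = (LINT x|lborel. \<phi> x * \<psi> x)"
proof -
  have m: "\<phi> \<in> borel_measurable borel" "\<psi> \<in> borel_measurable borel"
    by (intro borel_measurable_continuous_onI C1c_continuous test_function_C1c[OF p] test_function_C1c[OF q])+
  show ?thesis unfolding ip_def
    using m by (intro lebesgue_on_integral_eq(1)[OF Om_sets]) (auto simp: test_function_outside[OF p])
qed

lemma dirichlet_form_test:
  assumes p: "\<phi> \<in> test_functions \<Omega>"
  shows "dirichlet_form \<Omega> \<phi> \<phi> = (\<Sum>b\<in>Basis. LINT x|lborel. (dderiv b \<phi> x)\<^sup>2)"
proof -
  have "dirichlet_form \<Omega> \<phi> \<phi> = (LINT x|M. grad \<phi> x \<bullet> grad \<phi> x)"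
    unfolding dirichlet_form_def
  proof (rule integral_cong_AE)
    show "(\<lambda>x. weak_gradient \<Omega> \<phi> x \<bullet> weak_gradient \<Omega> \<phi> x) \<in> borel_measurable M"
      by (intro borel_measurable_inner L2D(1) weak_gradient_spec(1) test_H1(1)[OF p])
    show "(\<lambda>x. grad \<phi> x \<bullet> grad \<phi> x) \<in> borel_measurable M"
      by (intro borel_measurable_inner L2D(1) grad_L2[OF p])
    show "AE x in M. weak_gradient \<Omega> \<phi> x \<bullet> weak_gradient \<Omega> \<phi> x = grad \<phi> x \<bullet> grad \<phi> x"
      using test_H1(2)[OF p] by eventually_elim simp
  qed
  also have "\<dots> = (LINT x|M. (\<Sum>b\<in>Basis. (dderiv b \<phi> x)\<^sup>2))"
    by (subst euclidean_inner) (simp add: grad_inner power2_eq_square)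
  also have "\<dots> = (\<Sum>b\<in>Basis. LINT x|M. (dderiv b \<phi> x)\<^sup>2)"
    using L2D(2)[OF test_L2(2)[OF p]] by (intro Bochner_Integration.integral_sum) simp
  also have "\<dots> = (\<Sum>b\<in>Basis. LINT x|lborel. (dderiv b \<phi> x)\<^sup>2)"
  proof (rule sum.cong[OF refl])
    fix b :: 'a
    have "dderiv b \<phi> \<in> borel_measurable borel"
      by (intro borel_measurable_continuous_onI C1c_continuous test_function_C1c[OF p])
    then show "(LINT x|M. (dderiv b \<phi> x)\<^sup>2) = (LINT x|lborel. (dderiv b \<phi> x)\<^sup>2)"
      by (intro lebesgue_on_integral_eq(1)[OF Om_sets]) (auto simp: test_function_outside[OF p])
  qed
  finally show ?thesis .
qed

end

section \<open>Passage to the eigenvalues\<close>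

theorem corollary2p4:
  fixes \<Omega> :: "'a::euclidean_space set" and ev :: "nat \<Rightarrow> real" and N :: nat
  assumes "open \<Omega>" and "bounded \<Omega>" and "connected \<Omega>" and "\<Omega> \<noteq> {}"
    and "hardy_constant \<Omega> > 0"
    and "convex \<Omega>"
    and "dirichlet_eigenvalues \<Omega> ev"
    and "N \<ge> 1"
  shows "(\<Sum>j=1..N. ev j) \<ge>
           C_const DIM('a) * measure lebesgue \<Omega> powr (- (2 / real DIM('a)))
             * real N powr (1 + 2 / real DIM('a))
           + real N / (64 * (inradius \<Omega>)\<^sup>2)"
proof -
  interpret bounded_open \<Omega> using assms(1,2) by unfold_locales
  interpret A: semi_inner "H1 \<Omega>" ip by (rule ip_semi_inner)
  interpret E: semi_inner "H1 \<Omega>" "dirichlet_form \<Omega>" by (rule dirichlet_form_semi_inner)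
  interpret B: semi_inner "H1 \<Omega>" h1_ip by (rule h1_ip_semi_inner)
  define L where "L = C_const DIM('a) * measure lborel \<Omega> powr (- (2 / real DIM('a)))
    * real N powr (1 + 2 / real DIM('a)) + real N / (64 * (inradius \<Omega>)\<^sup>2)"
  obtain u where u: "A.orthonormal N u"
    "\<And>i. i < N \<Longrightarrow> u i \<in> H10 \<Omega>" "\<And>i. i < N \<Longrightarrow> dirichlet_form \<Omega> (u i) (u i) = ev (Suc i)"
    using orthonormal_eigenfunctions[OF assms(7), of N] by auto
  have "\<exists>\<psi>. (\<forall>n i. i < N \<longrightarrow> \<psi> n i \<in> test_functions \<Omega>)
     \<and> (\<forall>\<^sub>F n in sequentially. A.orthonormal N (\<psi> n))
     \<and> (\<forall>i<N. (\<lambda>n. B.nrm (\<lambda>x. u i x - \<psi> n i x)) \<longlonglongrightarrow> 0)"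
  proof (rule orthonormal_approximation[OF ip_semi_inner h1_ip_semi_inner _ _ test_functions_lin test_functions_zero u(1)])
    show "ip v v \<le> h1_ip v v" if "v \<in> H1 \<Omega>" for v using E.B_nonneg[OF that] by (simp add: h1_ip_def)
    show "test_functions \<Omega> \<subseteq> H1 \<Omega>" using test_H1(1) by (rule subsetI)
    show "\<exists>\<phi>\<in>test_functions \<Omega>. B.nrm (\<lambda>x. u i x - \<phi> x) < e" if "i < N" "0 < e" for i e
      by (rule H10D(2)[OF u(2)[OF that(1)] that(2)])
  qed
  then obtain \<psi> where T: "\<And>n i. i < N \<Longrightarrow> \<psi> n i \<in> test_functions \<Omega>"
    and o: "\<forall>\<^sub>F n in sequentially. A.orthonormal N (\<psi> n)"
    and l: "\<And>i. i < N \<Longrightarrow> (\<lambda>n. B.nrm (\<lambda>x. u i x - \<psi> n i x)) \<longlonglongrightarrow> 0" by auto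
  have lim: "(\<lambda>n. dirichlet_form \<Omega> (\<psi> n i) (\<psi> n i)) \<longlonglongrightarrow> ev (Suc i)" if i: "i < N" for i
  proof -
    note ui = H10D(1)[OF u(2)[OF i]] and pi = test_H1(1)[OF T[OF i]]
    have "(\<lambda>n. E.nrm (\<psi> n i) - E.nrm (u i)) \<longlonglongrightarrow> 0"
    proof (rule Lim_null_comparison[OF _ l[OF i]], intro always_eventually allI)
      fix n
      let ?d = "\<lambda>x. u i x - \<psi> n i x"
      have d: "?d \<in> H1 \<Omega>" using E.lin_mem[OF ui pi, of 1 "-1" n] by simp
      have "E.nrm (\<lambda>x. 1 * u i x + (- 1) * ?d x) \<le> \<bar>1\<bar> * E.nrm (u i) + \<bar>- 1\<bar> * E.nrm ?d" by (rule E.nrm_lin[OF ui d])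
      moreover have "E.nrm (\<lambda>x. 1 * \<psi> n i x + 1 * ?d x) \<le> \<bar>1\<bar> * E.nrm (\<psi> n i) + \<bar>1\<bar> * E.nrm ?d" by (rule E.nrm_lin[OF pi d])
      moreover have "E.nrm ?d \<le> B.nrm ?d" using A.B_nonneg[OF d] by (simp add: E.nrm_def B.nrm_def h1_ip_def)
      ultimately show "norm (E.nrm (\<psi> n i) - E.nrm (u i)) \<le> B.nrm ?d" by (simp add: abs_le_iff)
    qed
    then have "(\<lambda>n. E.nrm (\<psi> n i)) \<longlonglongrightarrow> E.nrm (u i)" by (simp add: LIM_zero_iff)
    then have "(\<lambda>n. (E.nrm (\<psi> n i))\<^sup>2) \<longlonglongrightarrow> (E.nrm (u i))\<^sup>2" by (rule tendsto_power)
    then show ?thesis by (simp only: E.nrm_square[OF ui] E.nrm_square[OF pi] u(3)[OF i])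
  qed
  have "(\<lambda>n. \<Sum>i<N. dirichlet_form \<Omega> (\<psi> n i) (\<psi> n i)) \<longlonglongrightarrow> (\<Sum>i<N. ev (Suc i))"
    by (intro tendsto_sum lim) simp
  moreover have "\<forall>\<^sub>F n in sequentially. L \<le> (\<Sum>i<N. dirichlet_form \<Omega> (\<psi> n i) (\<psi> n i))"
    using o
  proof eventually_elim
    case (elim n)
    have "L \<le> (\<Sum>j<N. \<Sum>b\<in>Basis. LINT x|lborel. (dderiv b (\<psi> n j) x)\<^sup>2)"
      unfolding L_def
    proof (rule test_function_energy_lower_bound[OF assms(1,2,6,4)])
      show "0 < N" using assms(8) by simp
      show "\<psi> n j \<in> test_functions \<Omega>" if "j < N" for j by (rule T[OF that])
      show "(LINT x|lborel. \<psi> n i x * \<psi> n j x) = (if i = j then 1 else 0)" if "i < N" "j < N" for i j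
        using elim that unfolding A.orthonormal_def ip_test[OF T[OF that(1)] T[OF that(2)], symmetric] by simp
    qed
    also have "\<dots> = (\<Sum>i<N. dirichlet_form \<Omega> (\<psi> n i) (\<psi> n i))"
      by (intro sum.cong refl dirichlet_form_test[symmetric] T) simp
    finally show ?case .
  qed
  ultimately have "L \<le> (\<Sum>i<N. ev (Suc i))" by (rule tendsto_lowerbound) simp
  also have "\<dots> = (\<Sum>j=1..N. ev j)"
    by (rule sum.reindex_bij_witness[of _ "\<lambda>j. j - 1" Suc]) auto
  finally show ?thesis
    using assms(1) unfolding L_def by (simp add: measure_completion)
qed

end
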